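(* Let $\mathfrak C^\infty(\mathcal K)$ be a compact quantum group with Haar state $\mathsf h$, and let $L:\mathfrak C^\infty(\mathcal K)\to\mathfrak C^\infty(\mathcal K)$ be a linear operator that diagonalizes with real eigenvalues over the Peter--Weyl decomposition, commutes with the antipode $S$, and satisfies $L(1)=0$. Put $\phi=\epsilon\circ L$. (Equivalently, let $L=\phi\triangleright$ where $\phi\in\mathfrak C^\infty(\mathcal K)^*$ is a self-adjoint, $\mathrm{ad}$-invariant, Hermitian linear functional with $\phi(1)=0$.) Let $(\Omega_\phi,d_\phi)$ be the bicovariant $*$-FODC induced by $\phi$ and $Q_\phi$ its quantum germs map. Then the map $\langle\cdot,\cdot\rangle_\phi:\Omega_\phi\times\Omega_\phi\to\mathfrak C^\infty(\mathcal K)$ defined, for $f,g\in\mathfrak C^\infty(\mathcal K)$ and $x,y\in\ker\epsilon$, by $$\big\langle Q_\phi(x)f,\,Q_\phi(y)g\big\rangle_\phi=-\tfrac12\,f^*g\,\big(\phi,S(x)^*S(y)\big)$$ is a (well-defined) strongly nondegenerate right $\mathfrak C^\infty(\mathcal K)$-sesquilinear form on $\Omega_\phi$, and $\phi\triangleright$ is the Laplacian associated with $(\Omega_\phi,d_\phi,\langle\cdot,\cdot\rangle_\phi)$, i.e. for all $f,g\in\mathfrak C^\infty(\mathcal K)$, $$\mathsf h\big(f^*(\phi\triangleright g)\big)=\mathsf h\big(\langle d_\phi f,d_\phi g\rangle_\phi\big).$$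
   Context: A compact quantum group (CQG) is a Hopf $*$-algebra $\mathfrak C^\infty(\mathcal K)=(\mathfrak C^\infty(\mathcal K),\Delta,\epsilon,S)$ over $\mathbb C$ admitting a (unique) linear functional $\mathsf h$ with $\mathsf h(1)=1$, $\mathsf h(a^*a)\ge 0$, and $(\mathsf h\otimes\mathrm{id})\Delta(a)=\mathsf h(a)1=(\mathrm{id}\otimes\mathsf h)\Delta(a)$; it is automatically faithful. Sweedler notation $\Delta(a)=a_{(1)}\otimes a_{(2)}$ is used. Let $\{u^\mu\}_{\mu\in\mathrm{Irr}(\mathcal K)}$ be representatives of the irreducible unitary corepresentations, $u^\mu=(u^\mu_{ij})\in M_{n_\mu}(\mathfrak C^\infty(\mathcal K))$; the $u^\mu_{ij}$ form a linear basis (Peter--Weyl). An operator $L$ diagonalizes over the Peter--Weyl decomposition if for each $\mu$ there is a scalar $C_L(\mu)$ (its eigenvalue) with $Lu^\mu_{ij}=C_L(\mu)u^\mu_{ij}$ for all $i,j$. Write $A=\mathfrak C^\infty(\mathcal K)$. The dual $A^*$ is a unital $*$-algebra with $(\phi\psi,a)=(\phi,a_{(1)})(\psi,a_{(2)})$, $(\phi^*,a)=\overline{(\phi,S(a)^* )}$, unit $\epsilon$. For $\phi\in A^*$: $\phi\triangleright a=a_{(1)}(\phi,a_{(2)})$. $\phi$ is self-adjoint if $\phi=\phi^*$; Hermitian if $(\phi,a^* )=\overline{(\phi,a)}$ for all $a$; $\mathrm{ad}$-invariant if $(\phi\otimes\mathrm{id})\mathrm{ad}(a)=\phi(a)1$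 for all $a$, where $\mathrm{ad}(a)=a_{(2)}\otimes S(a_{(1)})a_{(3)}$. A first order differential calculus (FODC) over $A$ is an $A$-bimodule $\Omega$ with a linear map $d:A\to\Omega$ satisfying $d(ab)=(da)b+a\,db$ and $\Omega=\mathrm{span}\{a\,db\}$; it is bicovariant if there are left and right coactions $\Phi_\Omega:\Omega\to A\otimes\Omega$, ${}_\Omega\Phi:\Omega\to\Omega\otimes A$ that are $A$-bimodule maps, commute with each other, and satisfy $\Phi_\Omega d=(\mathrm{id}\otimes d)\Delta$, ${}_\Omega\Phi d=(d\otimes\mathrm{id})\Delta$. Set ${}_{\rm inv}\Omega=\{\omega:\Phi_\Omega(\omega)=1\otimes\omega\}$. The quantum germs map is $Q:A\to{}_{\rm inv}\Omega$, $Q(a)=S(a_{(1)})\,d a_{(2)}$ (surjective). The right multiplication map ${}_{\rm inv}\Omega\otimes A\to\Omega$ is a linear isomorphism. For an $\mathrm{ad}$-invariant self-adjoint $\phi$, $R_\phi=\{a\in\ker\epsilon:(\phi,ab)=0\ \forall b\in\ker\epsilon\}$ is an $\mathrm{ad}$-invariant right ideal (i.e. $\mathrm{ad}(R_\phi)\subseteq R_\phi\otimes A$) with $S(R_\phi)^*\subseteq R_\phi$. The bicovariant $*$-FODC induced by $\phi$ is $\Omega_\phi=A\otimes(\ker\epsilon/R_\phi)$ with, $\pi$ denoting the quotient map, $a(b\otimes\pi(c))=ab\otimes\pi(c)$, $(b\otimes\pi(c))a=ba_{(1)}\otimes\pi(ca_{(2)})$, $d_\phi a=a_{(1)}\otimes\pi(a_{(2)}-\epsilon(a_{(2)})1)$,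 $\Phi=\Delta\otimes\mathrm{id}$, ${}_\Omega\Phi(a\otimes\pi(b))=a_{(1)}\otimes\pi(b_{(2)})\otimes a_{(2)}S(b_{(1)})b_{(3)}$, $(a\otimes\pi(b))^*=-a_{(1)}^*\otimes\pi(S(b)^*a_{(2)}^* )$. So ${}_{\rm inv}\Omega_\phi=1\otimes\ker\epsilon/R_\phi$ and $Q_\phi(a)=1\otimes\pi(a-\epsilon(a)1)$. A strongly nondegenerate right $A$-sesquilinear form on $\Omega$ is a sesquilinear map (conjugate linear in the first variable) $\langle\cdot,\cdot\rangle:\Omega\times\Omega\to A$ with $\langle\omega f,\eta g\rangle=f^*\langle\omega,\eta\rangle g$ which restricts to a $\mathbb C$-valued nondegenerate sesquilinear form on ${}_{\rm inv}\Omega$. Given an FODC $(\Omega,d)$ with such a form, the Laplacian associated with it is the (unique, if it exists) linear operator $\square$ on $A$ with $\mathsf h(f^*\square g)=\mathsf h(\langle df,dg\rangle)$ for all $f,g$. *)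

theory Defs
  imports
    Complex_Main
    "HOL-Library.Poly_Mapping"
    "HOL-Library.Set_Algebras"
    "Jordan_Normal_Form.Matrix"
begin

section \<open>Complex vector spaces and algebras\<close>

class complex_vector = ab_group_add +
  fixes scaleC :: "complex \<Rightarrow> 'a \<Rightarrow> 'a"  (infixr \<open>*\<^sub>C\<close> 75)
  assumes scaleC_add_right: "c *\<^sub>C (x + y) = c *\<^sub>C x + c *\<^sub>C y"
    and scaleC_add_left: "(c + d) *\<^sub>C x = c *\<^sub>C x + d *\<^sub>C x"
    and scaleC_scaleC: "c *\<^sub>C d *\<^sub>C x = (c * d) *\<^sub>C x"
    and scaleC_one: "1 *\<^sub>C x = x"

global_interpretation complex_vector:
  vector_space "scaleC :: complex \<Rightarrow> 'a \<Rightarrow> 'a::complex_vector"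
  defines csubspace_raw_def: csubspace = complex_vector.subspace
    and cspan_raw_def: cspan = complex_vector.span
  by unfold_locales
    (simp_all add: scaleC_add_right scaleC_add_left scaleC_scaleC scaleC_one)

abbreviation clinear :: "('a::complex_vector \<Rightarrow> 'b::complex_vector) \<Rightarrow> bool" where
  "clinear \<equiv> Vector_Spaces.linear scaleC scaleC"

lemma clinearI:
  assumes "\<And>x y. f (x + y) = f x + f y" and "\<And>c x. f (c *\<^sub>C x) = c *\<^sub>C f x"
  shows "clinear f"
  using assms by unfold_locales

lemma clinear_add: "clinear f \<Longrightarrow> f (x + y) = f x + f y"
  and clinear_scale: "clinear f \<Longrightarrow> f (c *\<^sub>C x) = c *\<^sub>C f x"
  by (auto simp: Vector_Spaces.linear_def module_hom_def module_hom_axioms_def)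

lemma clinear_diff: "clinear f \<Longrightarrow> f (x - y) = f x - f y"
  using clinear_add[of f "x - y" y] by simp

lemma clinear_zero: "clinear f \<Longrightarrow> f 0 = 0"
  using clinear_diff[of f 0 0] by simp

instantiation complex :: complex_vector
begin
definition scaleC_complex :: "complex \<Rightarrow> complex \<Rightarrow> complex" where
  [simp]: "scaleC_complex c x = c * x"
instance by standard (simp_all add: algebra_simps)
end

class complex_algebra_1 = complex_vector + ring_1 +
  assumes mult_scaleC_left: "(c *\<^sub>C x) * y = c *\<^sub>C (x * y)"
    and mult_scaleC_right: "x * (c *\<^sub>C y) = c *\<^sub>C (x * y)"

class complex_star_algebra = complex_algebra_1 +
  fixes star :: "'a \<Rightarrow> 'a"
  assumes star_add: "star (x + y) = star x + star y"
    and star_scaleC: "star (c *\<^sub>C x) = cnj c *\<^sub>C star x"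
    and star_mult: "star (x * y) = star y * star x"
    and star_star: "star (star x) = x"

section \<open>The algebraic tensor product\<close>

instantiation poly_mapping :: (type, complex_vector) complex_vector
begin
lift_definition scaleC_poly_mapping :: "complex \<Rightarrow> ('a \<Rightarrow>\<^sub>0 'b) \<Rightarrow> ('a \<Rightarrow>\<^sub>0 'b)"
  is "\<lambda>c f k. c *\<^sub>C f k"
proof -
  fix c :: complex and f :: "'a \<Rightarrow> 'b" assume f: "finite {k. f k \<noteq> 0}"
  show "finite {k. c *\<^sub>C f k \<noteq> 0}"
    by (rule finite_subset[OF _ f]) auto
qed
instance
  by standard (transfer; simp add: scaleC_add_right scaleC_add_left scaleC_scaleC scaleC_one)+
end

definition tensor_null :: "('a::complex_vector \<times> 'b::complex_vector \<Rightarrow>\<^sub>0 complex) set" where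
  "tensor_null = cspan
     ({Poly_Mapping.single (x + y, z) 1 - Poly_Mapping.single (x, z) 1 - Poly_Mapping.single (y, z) 1 | x y z. True}
    \<union> {Poly_Mapping.single (x, y + z) 1 - Poly_Mapping.single (x, y) 1 - Poly_Mapping.single (x, z) 1 | x y z. True}
    \<union> {Poly_Mapping.single (c *\<^sub>C x, y) 1 - c *\<^sub>C Poly_Mapping.single (x, y) 1 | c x y. True}
    \<union> {Poly_Mapping.single (x, c *\<^sub>C y) 1 - c *\<^sub>C Poly_Mapping.single (x, y) 1 | c x y. True})"

lemma csubspace_tensor_null: "csubspace tensor_null"
  unfolding tensor_null_def by (rule complex_vector.subspace_span)

quotient_type (overloaded) ('a, 'b) tensor =
    "'a::complex_vector \<times> 'b::complex_vector \<Rightarrow>\<^sub>0 complex" / "\<lambda>r s. r - s \<in> tensor_null"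
proof (rule equivpI)
  note sub = csubspace_tensor_null
  show "reflp (\<lambda>r s. r - s \<in> (tensor_null :: ('a \<times> 'b \<Rightarrow>\<^sub>0 complex) set))"
    using complex_vector.subspace_0[OF sub] by (auto intro!: reflpI)
  show "symp (\<lambda>r s. r - s \<in> (tensor_null :: ('a \<times> 'b \<Rightarrow>\<^sub>0 complex) set))"
    using complex_vector.subspace_neg[OF sub] by (force intro!: sympI)
  show "transp (\<lambda>r s. r - s \<in> (tensor_null :: ('a \<times> 'b \<Rightarrow>\<^sub>0 complex) set))"
    using complex_vector.subspace_add[OF sub] by (force intro!: transpI)
qed

instantiation tensor :: (complex_vector, complex_vector) complex_vector
begin
lift_definition zero_tensor :: "('a, 'b) tensor" is 0 .
lift_definition plus_tensor :: "('a, 'b) tensor \<Rightarrow> ('a, 'b) tensor \<Rightarrow> ('a, 'b) tensor" is "(+)"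
  using complex_vector.subspace_add[OF csubspace_tensor_null] by (force simp: algebra_simps)
lift_definition minus_tensor :: "('a, 'b) tensor \<Rightarrow> ('a, 'b) tensor \<Rightarrow> ('a, 'b) tensor" is "(-)"
  using complex_vector.subspace_diff[OF csubspace_tensor_null] by (force simp: algebra_simps)
lift_definition uminus_tensor :: "('a, 'b) tensor \<Rightarrow> ('a, 'b) tensor" is uminus
  using complex_vector.subspace_neg[OF csubspace_tensor_null] by (force simp: algebra_simps)
lift_definition scaleC_tensor :: "complex \<Rightarrow> ('a, 'b) tensor \<Rightarrow> ('a, 'b) tensor" is scaleC
  using complex_vector.subspace_scale[OF csubspace_tensor_null]
  by (force simp: complex_vector.scale_right_diff_distrib[symmetric])
instance
  by standard (transfer; simp add: complex_vector.subspace_0[OF csubspace_tensor_null] algebra_simps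
      scaleC_add_right scaleC_add_left scaleC_scaleC scaleC_one)+
end

lift_definition tensor :: "'a::complex_vector \<Rightarrow> 'b::complex_vector \<Rightarrow> ('a, 'b) tensor"
    (infixl \<open>\<otimes>\<^sub>C\<close> 73)
  is "\<lambda>a b. Poly_Mapping.single (a, b) 1" .

text \<open>The linear map induced by a bilinear map \<open>f\<close>. The chosen representative does not
  matter if \<open>f\<close> is bilinear, see \<open>tensor_lift_tensor\<close> and \<open>clinear_tensor_lift\<close> below.\<close>

definition tensor_lift ::
  "('a::complex_vector \<Rightarrow> 'b::complex_vector \<Rightarrow> 'c::complex_vector) \<Rightarrow> ('a, 'b) tensor \<Rightarrow> 'c" where
  "tensor_lift f t =
     (\<Sum>k \<in> Poly_Mapping.keys (rep_tensor t). Poly_Mapping.lookup (rep_tensor t) k *\<^sub>C f (fst k) (snd k))"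

definition tensor_map ::
  "('a::complex_vector \<Rightarrow> 'c::complex_vector) \<Rightarrow> ('b::complex_vector \<Rightarrow> 'd::complex_vector)
    \<Rightarrow> ('a, 'b) tensor \<Rightarrow> ('c, 'd) tensor" where
  "tensor_map f g = tensor_lift (\<lambda>a b. f a \<otimes>\<^sub>C g b)"

definition tensor_assoc ::
  "(('a::complex_vector, 'b::complex_vector) tensor, 'c::complex_vector) tensor \<Rightarrow> ('a, ('b, 'c) tensor) tensor" where
  "tensor_assoc = tensor_lift (\<lambda>t c. tensor_lift (\<lambda>a b. a \<otimes>\<^sub>C (b \<otimes>\<^sub>C c)) t)"

instantiation tensor :: (complex_algebra_1, complex_algebra_1) times
begin
definition times_tensor :: "('a, 'b) tensor \<Rightarrow> ('a, 'b) tensor \<Rightarrow> ('a, 'b) tensor" where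
  "s * t = tensor_lift (\<lambda>a b. tensor_lift (\<lambda>c d. (a * c) \<otimes>\<^sub>C (b * d)) t) s"
instance ..
end

text \<open>The conjugate linear extension of \<open>a \<otimes> b \<mapsto> a\<^sup>* \<otimes> b\<^sup>*\<close>.\<close>

definition tensor_star ::
  "('a::complex_star_algebra, 'b::complex_star_algebra) tensor \<Rightarrow> ('a, 'b) tensor" where
  "tensor_star t =
     (\<Sum>k \<in> Poly_Mapping.keys (rep_tensor t).
        cnj (Poly_Mapping.lookup (rep_tensor t) k) *\<^sub>C (star (fst k) \<otimes>\<^sub>C star (snd k)))"

subsection \<open>Universal property\<close>

lemma tensor_eqI:
  assumes "r - s \<in> tensor_null" shows "abs_tensor r = abs_tensor s"
  using assms by (simp add: tensor.abs_eq_iff)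

lemma tensor_add_left: "(x + y) \<otimes>\<^sub>C z = x \<otimes>\<^sub>C z + y \<otimes>\<^sub>C z"
  by transfer (unfold diff_diff_eq[symmetric] tensor_null_def, rule complex_vector.span_base, blast)

lemma tensor_add_right: "x \<otimes>\<^sub>C (y + z) = x \<otimes>\<^sub>C y + x \<otimes>\<^sub>C z"
  by transfer (unfold diff_diff_eq[symmetric] tensor_null_def, rule complex_vector.span_base, blast)

lemma tensor_scale_left: "(c *\<^sub>C x) \<otimes>\<^sub>C y = c *\<^sub>C (x \<otimes>\<^sub>C y)"
  by transfer (unfold diff_diff_eq[symmetric] tensor_null_def, rule complex_vector.span_base, blast)

lemma tensor_scale_right: "x \<otimes>\<^sub>C (c *\<^sub>C y) = c *\<^sub>C (x \<otimes>\<^sub>C y)"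
  by transfer (unfold diff_diff_eq[symmetric] tensor_null_def, rule complex_vector.span_base, blast)

definition cbilinear ::
  "('a::complex_vector \<Rightarrow> 'b::complex_vector \<Rightarrow> 'c::complex_vector) \<Rightarrow> bool" where
  "cbilinear f \<longleftrightarrow> (\<forall>b. clinear (\<lambda>a. f a b)) \<and> (\<forall>a. clinear (f a))"

lemma cbilinearI:
  assumes "\<And>x y z. f (x + y) z = f x z + f y z" "\<And>c x z. f (c *\<^sub>C x) z = c *\<^sub>C f x z"
    and "\<And>x y z. f x (y + z) = f x y + f x z" "\<And>c x z. f x (c *\<^sub>C z) = c *\<^sub>C f x z"
  shows "cbilinear f"
  unfolding cbilinear_def using assms by (auto intro!: clinearI)

lemma cbilinear_simps:
  assumes "cbilinear f"
  shows "f (x + x') y = f x y + f x' y" "f (c *\<^sub>C x) y = c *\<^sub>C f x y"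
    "f x (y + y') = f x y + f x y'" "f x (c *\<^sub>C y) = c *\<^sub>C f x y"
  using assms clinear_add[of "\<lambda>a. f a y"] clinear_scale[of "\<lambda>a. f a y"]
  by (auto simp: cbilinear_def clinear_add clinear_scale)

definition free_lift ::
  "('a::complex_vector \<Rightarrow> 'b::complex_vector \<Rightarrow> 'c::complex_vector) \<Rightarrow> ('a \<times> 'b \<Rightarrow>\<^sub>0 complex) \<Rightarrow> 'c" where
  "free_lift f r = (\<Sum>k \<in> Poly_Mapping.keys r. Poly_Mapping.lookup r k *\<^sub>C f (fst k) (snd k))"

lemma free_lift_superset:
  assumes "finite S" "Poly_Mapping.keys r \<subseteq> S"
  shows "free_lift f r = (\<Sum>k \<in> S. Poly_Mapping.lookup r k *\<^sub>C f (fst k) (snd k))"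
  unfolding free_lift_def using assms
  by (intro sum.mono_neutral_left) (auto simp: in_keys_iff)

lemma clinear_free_lift: "clinear (free_lift f)"
proof (rule clinearI)
  fix r s :: "'a \<times> 'b \<Rightarrow>\<^sub>0 complex" and c :: complex
  have "Poly_Mapping.keys (r + s) \<subseteq> Poly_Mapping.keys r \<union> Poly_Mapping.keys s" by (rule keys_add)
  then show "free_lift f (r + s) = free_lift f r + free_lift f s"
    by (simp add: free_lift_superset[of "Poly_Mapping.keys r \<union> Poly_Mapping.keys s"] lookup_add scaleC_add_left sum.distrib)
  have "Poly_Mapping.keys (c *\<^sub>C r) \<subseteq> Poly_Mapping.keys r"
    by (auto simp: in_keys_iff scaleC_poly_mapping.rep_eq)
  then show "free_lift f (c *\<^sub>C r) = c *\<^sub>C free_lift f r"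
    by (simp add: free_lift_superset[of "Poly_Mapping.keys r"] scaleC_poly_mapping.rep_eq scaleC_scaleC
        complex_vector.scale_sum_right)
qed

lemma free_lift_single [simp]: "free_lift f (Poly_Mapping.single (a, b) 1) = f a b"
  by (simp add: free_lift_def scaleC_one)

lemma free_lift_null:
  assumes "cbilinear f" "r \<in> tensor_null"
  shows "free_lift f r = 0"
proof -
  note lin = clinear_free_lift[of f]
  have "tensor_null \<subseteq> {r. free_lift f r = 0}"
    unfolding tensor_null_def
  proof (rule complex_vector.span_minimal)
    show "csubspace {r. free_lift f r = 0}"
      by (auto simp: complex_vector.subspace_def clinear_add[OF lin] clinear_scale[OF lin] clinear_zero[OF lin])
  qed (auto simp: clinear_diff[OF lin] clinear_scale[OF lin] cbilinear_simps[OF assms(1)])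
  with assms(2) show ?thesis by auto
qed

lemma tensor_lift_abs:
  assumes "cbilinear f"
  shows "tensor_lift f (abs_tensor r) = free_lift f r"
proof -
  have "rep_tensor (abs_tensor r) - r \<in> tensor_null"
    using Quotient_rep_abs[OF Quotient_tensor, of r]
      complex_vector.subspace_0[OF csubspace_tensor_null] by auto
  then have "free_lift f (rep_tensor (abs_tensor r) - r) = 0"
    by (rule free_lift_null[OF assms])
  then show ?thesis
    unfolding clinear_diff[OF clinear_free_lift]
    by (simp add: tensor_lift_def free_lift_def)
qed

lemma tensor_lift_tensor:
  assumes "cbilinear f" shows "tensor_lift f (a \<otimes>\<^sub>C b) = f a b"
  by (simp add: tensor_def tensor_lift_abs[OF assms])

lemma clinear_tensor_lift:
  assumes "cbilinear f" shows "clinear (tensor_lift f)"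
proof (rule clinearI)
  fix s t :: "('a, 'b) tensor" and c :: complex
  show "tensor_lift f (s + t) = tensor_lift f s + tensor_lift f t"
    by (induct s rule: tensor.abs_induct, induct t rule: tensor.abs_induct)
      (simp add: plus_tensor.abs_eq tensor_lift_abs[OF assms] clinear_add[OF clinear_free_lift])
  show "tensor_lift f (c *\<^sub>C s) = c *\<^sub>C tensor_lift f s"
    by (induct s rule: tensor.abs_induct)
      (simp add: scaleC_tensor.abs_eq tensor_lift_abs[OF assms] clinear_scale[OF clinear_free_lift])
qed

lemma cbilinear_tensor_map: "clinear f \<Longrightarrow> clinear g \<Longrightarrow> cbilinear (\<lambda>a b. f a \<otimes>\<^sub>C g b)"
  by (rule cbilinearI) (simp_all add: clinear_add clinear_scale tensor_add_left tensor_add_right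
      tensor_scale_left tensor_scale_right)

lemma tensor_map_tensor:
  "clinear f \<Longrightarrow> clinear g \<Longrightarrow> tensor_map f g (a \<otimes>\<^sub>C b) = f a \<otimes>\<^sub>C g b"
  by (simp add: tensor_map_def tensor_lift_tensor[OF cbilinear_tensor_map])

lemma clinear_tensor_map: "clinear f \<Longrightarrow> clinear g \<Longrightarrow> clinear (tensor_map f g)"
  unfolding tensor_map_def by (intro clinear_tensor_lift cbilinear_tensor_map)

lemma clinear_mult_left: "clinear ((*) (a :: 'a::complex_algebra_1))"
  by (rule clinearI) (simp_all add: algebra_simps mult_scaleC_right)

lemma clinear_id: "clinear id"
  by (rule clinearI) simp_all

lemma cbilinear_mult_tensor:
  "cbilinear (\<lambda>c d. ((a :: 'a::complex_algebra_1) * c) \<otimes>\<^sub>C ((b :: 'b::complex_algebra_1) * d))"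
  by (intro cbilinear_tensor_map clinear_mult_left)

lemma times_tensor_left_linear:
  fixes s t u :: "('a::complex_algebra_1, 'b::complex_algebra_1) tensor"
  shows "cbilinear (\<lambda>a b. tensor_lift (\<lambda>c d. ((a :: 'a) * c) \<otimes>\<^sub>C ((b :: 'b) * d)) t)"
    and "(s + u) * t = s * t + u * t" and "(k *\<^sub>C s) * t = k *\<^sub>C (s * t)"
proof -
  let ?f = "\<lambda>a b. tensor_lift (\<lambda>c d. ((a :: 'a) * c) \<otimes>\<^sub>C ((b :: 'b) * d))"
  have lift: "?f a b (abs_tensor r) = (\<Sum>k \<in> Poly_Mapping.keys r.
      Poly_Mapping.lookup r k *\<^sub>C ((a * fst k) \<otimes>\<^sub>C (b * snd k)))" for a b r
    by (simp add: tensor_lift_abs[OF cbilinear_mult_tensor] free_lift_def)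
  show bil: "cbilinear (\<lambda>a b. ?f a b t)"
  proof (induct t rule: tensor.abs_induct, unfold lift, rule cbilinearI)
  qed (simp_all add: distrib_right mult_scaleC_left tensor_add_left tensor_add_right
      tensor_scale_left tensor_scale_right scaleC_add_right sum.distrib
      complex_vector.scale_sum_right complex_vector.scale_left_commute mult.commute)
  show "(s + u) * t = s * t + u * t" "(k *\<^sub>C s) * t = k *\<^sub>C (s * t)"
    unfolding times_tensor_def
    by (rule clinear_add[OF clinear_tensor_lift[OF bil]] clinear_scale[OF clinear_tensor_lift[OF bil]])+
qed

lemma times_tensor_left: "(a \<otimes>\<^sub>C b) * t = tensor_lift (\<lambda>c d. (a * c) \<otimes>\<^sub>C (b * d)) t"
  unfolding times_tensor_def by (rule tensor_lift_tensor[OF times_tensor_left_linear(1)])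

lemma times_tensor_tensor: "(a \<otimes>\<^sub>C b) * (c \<otimes>\<^sub>C d) = (a * c) \<otimes>\<^sub>C (b * d)"
  by (simp add: times_tensor_left tensor_lift_tensor[OF cbilinear_mult_tensor])

section \<open>Compact quantum groups\<close>

record (overloaded) 'a hopf =
  comult :: "'a \<Rightarrow> ('a, 'a) tensor"
  counit :: "'a \<Rightarrow> complex"
  antipode :: "'a \<Rightarrow> 'a"

definition hopf_star_algebra :: "'a::complex_star_algebra hopf \<Rightarrow> bool" where
  "hopf_star_algebra H \<longleftrightarrow>
     clinear (comult H) \<and> clinear (counit H) \<and> clinear (antipode H) \<and>
     (\<forall>a b. comult H (a * b) = comult H a * comult H b) \<and>
     comult H 1 = 1 \<otimes>\<^sub>C 1 \<and>
     (\<forall>a. comult H (star a) = tensor_star (comult H a)) \<and>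
     (\<forall>a b. counit H (a * b) = counit H a * counit H b) \<and>
     counit H 1 = 1 \<and>
     (\<forall>a. tensor_assoc (tensor_map (comult H) id (comult H a))
           = tensor_map id (comult H) (comult H a)) \<and>
     (\<forall>a. tensor_lift (\<lambda>x y. counit H x *\<^sub>C y) (comult H a) = a) \<and>
     (\<forall>a. tensor_lift (\<lambda>x y. counit H y *\<^sub>C x) (comult H a) = a) \<and>
     (\<forall>a. tensor_lift (\<lambda>x y. antipode H x * y) (comult H a) = counit H a *\<^sub>C 1) \<and>
     (\<forall>a. tensor_lift (\<lambda>x y. x * antipode H y) (comult H a) = counit H a *\<^sub>C 1)"

definition haar_state :: "'a::complex_star_algebra hopf \<Rightarrow> ('a \<Rightarrow> complex) \<Rightarrow> bool" where
  "haar_state H h \<longleftrightarrow> clinear h \<and> h 1 = 1 \<and>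
     (\<forall>a. h (star a * a) \<in> \<real> \<and> 0 \<le> Re (h (star a * a))) \<and>
     (\<forall>a. tensor_lift (\<lambda>x y. h x *\<^sub>C y) (comult H a) = h a *\<^sub>C 1) \<and>
     (\<forall>a. tensor_lift (\<lambda>x y. h y *\<^sub>C x) (comult H a) = h a *\<^sub>C 1)"

definition compact_quantum_group :: "'a::complex_star_algebra hopf \<Rightarrow> bool" where
  "compact_quantum_group H \<longleftrightarrow> hopf_star_algebra H \<and> (\<exists>h. haar_state H h)"

text \<open>Sweedler notation: \<open>sweedler2 H f a\<close> is \<open>f a\<^sub>1 a\<^sub>2\<close> and \<open>sweedler3 H f a\<close> is
  \<open>f a\<^sub>1 a\<^sub>2 a\<^sub>3\<close> (summation understood), for bilinear and trilinear \<open>f\<close>.\<close>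

definition sweedler2 ::
  "'a::complex_star_algebra hopf \<Rightarrow> ('a \<Rightarrow> 'a \<Rightarrow> 'b::complex_vector) \<Rightarrow> 'a \<Rightarrow> 'b" where
  "sweedler2 H f a = tensor_lift f (comult H a)"

definition sweedler3 ::
  "'a::complex_star_algebra hopf \<Rightarrow> ('a \<Rightarrow> 'a \<Rightarrow> 'a \<Rightarrow> 'b::complex_vector) \<Rightarrow> 'a \<Rightarrow> 'b" where
  "sweedler3 H f a =
     tensor_lift (\<lambda>t z. tensor_lift (\<lambda>x y. f x y z) t) (tensor_map (comult H) id (comult H a))"

subsection \<open>Irreducible unitary corepresentations\<close>

definition adjoint_mat :: "'a::complex_star_algebra mat \<Rightarrow> 'a mat" where
  "adjoint_mat u = map_mat star (transpose_mat u)"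

definition corepresentation :: "'a::complex_star_algebra hopf \<Rightarrow> 'a mat \<Rightarrow> bool" where
  "corepresentation H u \<longleftrightarrow> square_mat u \<and>
     (\<forall>i < dim_row u. \<forall>j < dim_row u.
        comult H (u $$ (i, j)) = (\<Sum>k < dim_row u. u $$ (i, k) \<otimes>\<^sub>C u $$ (k, j)) \<and>
        counit H (u $$ (i, j)) = (if i = j then 1 else 0))"

definition unitary_corepresentation :: "'a::complex_star_algebra hopf \<Rightarrow> 'a mat \<Rightarrow> bool" where
  "unitary_corepresentation H u \<longleftrightarrow> corepresentation H u \<and>
     adjoint_mat u * u = 1\<^sub>m (dim_row u) \<and> u * adjoint_mat u = 1\<^sub>m (dim_row u)"

text \<open>The coaction on \<open>\<complex>\<^sup>n\<close> attached to \<open>u\<close> sends \<open>e\<^sub>j\<close> to \<open>\<Sum>\<^sub>i e\<^sub>i \<otimes> u\<^sub>i\<^sub>j\<close>. A subspace \<open>W\<close>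
  is invariant if the image of each \<open>w \<in> W\<close>, whose \<open>e\<^sub>i\<close>-component is \<open>\<Sum>\<^sub>j w\<^sub>j u\<^sub>i\<^sub>j\<close>, lies in
  \<open>W \<otimes> A\<close>, i.e. is a finite sum of terms \<open>x\<^sub>l \<otimes> a\<^sub>l\<close> with \<open>x\<^sub>l \<in> W\<close>.\<close>

definition invariant_subspace :: "'a::complex_star_algebra mat \<Rightarrow> complex vec set \<Rightarrow> bool" where
  "invariant_subspace u W \<longleftrightarrow>
     W \<subseteq> carrier_vec (dim_row u) \<and> 0\<^sub>v (dim_row u) \<in> W \<and>
     (\<forall>v \<in> W. \<forall>w \<in> W. v + w \<in> W) \<and> (\<forall>c. \<forall>w \<in> W. c \<cdot>\<^sub>v w \<in> W) \<and>
     (\<forall>w \<in> W. \<exists>m (x :: nat \<Rightarrow> complex vec) (a :: nat \<Rightarrow> 'a). (\<forall>l < m. x l \<in> W) \<and>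
        (\<forall>i < dim_row u. (\<Sum>j < dim_row u. (w $ j) *\<^sub>C u $$ (i, j)) = (\<Sum>l < m. (x l $ i) *\<^sub>C a l)))"

definition irreducible_corepresentation :: "'a::complex_star_algebra hopf \<Rightarrow> 'a mat \<Rightarrow> bool" where
  "irreducible_corepresentation H u \<longleftrightarrow> corepresentation H u \<and> 0 < dim_row u \<and>
     (\<forall>W. invariant_subspace u W \<longrightarrow> W = {0\<^sub>v (dim_row u)} \<or> W = carrier_vec (dim_row u))"

definition equivalent_corepresentations :: "'a::complex_star_algebra mat \<Rightarrow> 'a mat \<Rightarrow> bool" where
  "equivalent_corepresentations u v \<longleftrightarrow> dim_row u = dim_row v \<and>
     (\<exists>T \<in> carrier_mat (dim_row u) (dim_row u). invertible_mat T \<and>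
        map_mat (\<lambda>c. c *\<^sub>C 1) T * u = v * map_mat (\<lambda>c. c *\<^sub>C 1) T)"

definition irreducible_representatives ::
  "'a::complex_star_algebra hopf \<Rightarrow> 'i set \<Rightarrow> ('i \<Rightarrow> 'a mat) \<Rightarrow> bool" where
  "irreducible_representatives H I u \<longleftrightarrow>
     (\<forall>\<mu> \<in> I. unitary_corepresentation H (u \<mu>) \<and> irreducible_corepresentation H (u \<mu>)) \<and>
     (\<forall>\<mu> \<in> I. \<forall>\<nu> \<in> I. equivalent_corepresentations (u \<mu>) (u \<nu>) \<longrightarrow> \<mu> = \<nu>) \<and>
     (\<forall>v. unitary_corepresentation H v \<and> irreducible_corepresentation H v \<longrightarrow>
        (\<exists>\<mu> \<in> I. equivalent_corepresentations v (u \<mu>)))"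

definition diagonalizes_with_real_eigenvalues ::
  "'i set \<Rightarrow> ('i \<Rightarrow> 'a::complex_star_algebra mat) \<Rightarrow> ('a \<Rightarrow> 'a) \<Rightarrow> bool" where
  "diagonalizes_with_real_eigenvalues I u L \<longleftrightarrow>
     (\<exists>C :: 'i \<Rightarrow> real. \<forall>\<mu> \<in> I. \<forall>i < dim_row (u \<mu>). \<forall>j < dim_row (u \<mu>).
        L (u \<mu> $$ (i, j)) = complex_of_real (C \<mu>) *\<^sub>C u \<mu> $$ (i, j))"

subsection \<open>Linear functionals\<close>

text \<open>\<open>convolve H \<phi> a\<close> is \<open>\<phi> \<triangleright> a\<close>.\<close>

definition convolve :: "'a::complex_star_algebra hopf \<Rightarrow> ('a \<Rightarrow> complex) \<Rightarrow> 'a \<Rightarrow> 'a" where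
  "convolve H \<phi> a = sweedler2 H (\<lambda>x y. \<phi> y *\<^sub>C x) a"

definition dual_star :: "'a::complex_star_algebra hopf \<Rightarrow> ('a \<Rightarrow> complex) \<Rightarrow> 'a \<Rightarrow> complex" where
  "dual_star H \<phi> a = cnj (\<phi> (star (antipode H a)))"

definition self_adjoint_functional ::
  "'a::complex_star_algebra hopf \<Rightarrow> ('a \<Rightarrow> complex) \<Rightarrow> bool" where
  "self_adjoint_functional H \<phi> \<longleftrightarrow> \<phi> = dual_star H \<phi>"

definition hermitian_functional :: "('a::complex_star_algebra \<Rightarrow> complex) \<Rightarrow> bool" where
  "hermitian_functional \<phi> \<longleftrightarrow> (\<forall>a. \<phi> (star a) = cnj (\<phi> a))"

definition ad :: "'a::complex_star_algebra hopf \<Rightarrow> 'a \<Rightarrow> ('a, 'a) tensor" where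
  "ad H a = sweedler3 H (\<lambda>x y z. y \<otimes>\<^sub>C (antipode H x * z)) a"

definition ad_invariant_functional ::
  "'a::complex_star_algebra hopf \<Rightarrow> ('a \<Rightarrow> complex) \<Rightarrow> bool" where
  "ad_invariant_functional H \<phi> \<longleftrightarrow>
     (\<forall>a. tensor_lift (\<lambda>x y. \<phi> x *\<^sub>C y) (ad H a) = \<phi> a *\<^sub>C 1)"

section \<open>First order calculi and sesquilinear forms\<close>

text \<open>The data of a left covariant first order calculus that the notions below refer to; the
  underlying vector space is a carrier set \<open>forms\<close>, and \<open>left_inv\<close> is the space of left
  invariant forms.\<close>

record ('a, 'w) calculus =
  forms :: "'w set"
  form_zero :: 'w
  form_add :: "'w \<Rightarrow> 'w \<Rightarrow> 'w"
  form_scale :: "complex \<Rightarrow> 'w \<Rightarrow> 'w"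
  left_mult :: "'a \<Rightarrow> 'w \<Rightarrow> 'w"
  right_mult :: "'w \<Rightarrow> 'a \<Rightarrow> 'w"
  differential :: "'a \<Rightarrow> 'w"
  left_inv :: "'w set"

definition sesquilinear_form :: "('a, 'w) calculus \<Rightarrow> ('w \<Rightarrow> 'w \<Rightarrow> 'a::complex_vector) \<Rightarrow> bool" where
  "sesquilinear_form \<Omega> B \<longleftrightarrow>
     (\<forall>\<omega> \<in> forms \<Omega>. \<forall>\<omega>' \<in> forms \<Omega>. \<forall>\<eta> \<in> forms \<Omega>.
        B (form_add \<Omega> \<omega> \<omega>') \<eta> = B \<omega> \<eta> + B \<omega>' \<eta> \<and>
        B \<eta> (form_add \<Omega> \<omega> \<omega>') = B \<eta> \<omega> + B \<eta> \<omega>') \<and>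
     (\<forall>c. \<forall>\<omega> \<in> forms \<Omega>. \<forall>\<eta> \<in> forms \<Omega>.
        B (form_scale \<Omega> c \<omega>) \<eta> = cnj c *\<^sub>C B \<omega> \<eta> \<and>
        B \<omega> (form_scale \<Omega> c \<eta>) = c *\<^sub>C B \<omega> \<eta>)"

definition strongly_nondegenerate_right_sesquilinear_form ::
  "('a, 'w) calculus \<Rightarrow> ('w \<Rightarrow> 'w \<Rightarrow> 'a::complex_star_algebra) \<Rightarrow> bool" where
  "strongly_nondegenerate_right_sesquilinear_form \<Omega> B \<longleftrightarrow>
     sesquilinear_form \<Omega> B \<and>
     (\<forall>\<omega> \<in> forms \<Omega>. \<forall>\<eta> \<in> forms \<Omega>. \<forall>f g.
        B (right_mult \<Omega> \<omega> f) (right_mult \<Omega> \<eta> g) = star f * B \<omega> \<eta> * g) \<and>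
     (\<forall>\<omega> \<in> left_inv \<Omega>. \<forall>\<eta> \<in> left_inv \<Omega>. \<exists>c. B \<omega> \<eta> = c *\<^sub>C 1) \<and>
     (\<forall>\<omega> \<in> left_inv \<Omega>. (\<forall>\<eta> \<in> left_inv \<Omega>. B \<omega> \<eta> = 0) \<longrightarrow> \<omega> = form_zero \<Omega>) \<and>
     (\<forall>\<eta> \<in> left_inv \<Omega>. (\<forall>\<omega> \<in> left_inv \<Omega>. B \<omega> \<eta> = 0) \<longrightarrow> \<eta> = form_zero \<Omega>)"

definition is_laplacian ::
  "('a::complex_star_algebra \<Rightarrow> complex) \<Rightarrow> ('a, 'w) calculus \<Rightarrow> ('w \<Rightarrow> 'w \<Rightarrow> 'a) \<Rightarrow> ('a \<Rightarrow> 'a) \<Rightarrow> bool"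
  where
  "is_laplacian h \<Omega> B D \<longleftrightarrow> clinear D \<and>
     (\<forall>f g. h (star f * D g) = h (B (differential \<Omega> f) (differential \<Omega> g)))"

section \<open>The calculus induced by a functional\<close>

definition R_ideal :: "'a::complex_star_algebra hopf \<Rightarrow> ('a \<Rightarrow> complex) \<Rightarrow> 'a set" where
  "R_ideal H \<phi> = {a. counit H a = 0 \<and> (\<forall>b. counit H b = 0 \<longrightarrow> \<phi> (a * b) = 0)}"

text \<open>A quotient \<open>T/N\<close> of subspaces is the set of cosets \<open>t +o N\<close> with \<open>t \<in> T\<close>; addition is the
  Minkowski sum, and a linear \<open>F\<close> with \<open>F ` N \<subseteq> N'\<close> induces \<open>X \<mapsto> F ` X + N'\<close>
  (lemma \<open>induced_map_coset\<close>). The tensor product of a whole type \<open>'b\<close> with such a quotient is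
  realised, by exactness of the tensor product, as
  \<open>'b \<otimes> (T/N) = ('b \<otimes> T)/('b \<otimes> N)\<close>, so that \<open>b \<otimes> (t + N)\<close> is the coset of \<open>b \<otimes> t\<close>.\<close>

definition quotient_space :: "'b::complex_vector set \<Rightarrow> 'b set \<Rightarrow> 'b set set" where
  "quotient_space T N = (\<lambda>t. t +o N) ` T"

definition tensor_sub :: "'c::complex_vector set \<Rightarrow> ('b::complex_vector, 'c) tensor set" where
  "tensor_sub T = cspan {b \<otimes>\<^sub>C t | b t. t \<in> T}"

definition induced_map :: "('b \<Rightarrow> 'c) \<Rightarrow> 'c::complex_vector set \<Rightarrow> 'b set \<Rightarrow> 'c set" where
  "induced_map F N X = F ` X + N"

text \<open>\<open>omega_class H \<phi> t\<close> is the element of \<open>A \<otimes> (ker \<epsilon>/R\<^sub>\<phi>)\<close> obtained from \<open>t \<in> A \<otimes> ker \<epsilon>\<close> by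
  applying \<open>id \<otimes> \<pi>\<close>; in particular \<open>omega_class H \<phi> (b \<otimes> c)\<close> is \<open>b \<otimes> \<pi>(c)\<close>.\<close>

definition omega_class ::
  "'a::complex_star_algebra hopf \<Rightarrow> ('a \<Rightarrow> complex) \<Rightarrow> ('a, 'a) tensor \<Rightarrow> ('a, 'a) tensor set" where
  "omega_class H \<phi> t = t +o tensor_sub (R_ideal H \<phi>)"

text \<open>The right action \<open>(b \<otimes> \<pi>(c)) a = b a\<^sub>1 \<otimes> \<pi>(c a\<^sub>2)\<close> is induced by \<open>t \<mapsto> t \<Delta>(a)\<close>.
  A form \<open>\<omega>\<close> is left invariant if the coaction \<open>\<Delta> \<otimes> id\<close>, with values in
  \<open>A \<otimes> \<Omega> = (A \<otimes> (A \<otimes> ker \<epsilon>))/(A \<otimes> (A \<otimes> R\<^sub>\<phi>))\<close>, sends it to \<open>1 \<otimes> \<omega>\<close>.\<close>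

definition omega ::
  "'a::complex_star_algebra hopf \<Rightarrow> ('a \<Rightarrow> complex) \<Rightarrow> ('a, ('a, 'a) tensor set) calculus" where
  "omega H \<phi> =
    (let N = tensor_sub (R_ideal H \<phi>);
         \<Omega> = quotient_space (tensor_sub {x. counit H x = 0}) N
     in \<lparr> forms = \<Omega>,
          form_zero = N,
          form_add = (+),
          form_scale = (\<lambda>c. induced_map (scaleC c) N),
          left_mult = (\<lambda>a. induced_map (tensor_map ((*) a) id) N),
          right_mult = (\<lambda>X a. induced_map (\<lambda>t. t * comult H a) N X),
          differential = (\<lambda>a. omega_class H \<phi> (tensor_map id (\<lambda>x. x - counit H x *\<^sub>C 1) (comult H a))),
          left_inv = {X \<in> \<Omega>.
            induced_map (\<lambda>t. tensor_assoc (tensor_map (comult H) id t)) (tensor_sub N) X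
              = induced_map (\<lambda>t. 1 \<otimes>\<^sub>C t) (tensor_sub N) X} \<rparr>)"

definition quantum_germs ::
  "'a::complex_star_algebra hopf \<Rightarrow> ('a \<Rightarrow> complex) \<Rightarrow> 'a \<Rightarrow> ('a, 'a) tensor set" where
  "quantum_germs H \<phi> a = omega_class H \<phi> (1 \<otimes>\<^sub>C (a - counit H a *\<^sub>C 1))"

text \<open>The forms \<open>Q\<^sub>\<phi>(x) f\<close> with \<open>x \<in> ker \<epsilon>\<close> span \<open>\<Omega>\<^sub>\<phi>\<close>, so the formula below
  is to be extended sesquilinearly.\<close>

definition given_on_germs ::
  "'a::complex_star_algebra hopf \<Rightarrow> ('a \<Rightarrow> complex)
    \<Rightarrow> (('a, 'a) tensor set \<Rightarrow> ('a, 'a) tensor set \<Rightarrow> 'a) \<Rightarrow> bool" where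
  "given_on_germs H \<phi> B \<longleftrightarrow> sesquilinear_form (omega H \<phi>) B \<and>
     (\<forall>f g x y. counit H x = 0 \<and> counit H y = 0 \<longrightarrow>
        B (right_mult (omega H \<phi>) (quantum_germs H \<phi> x) f)
          (right_mult (omega H \<phi>) (quantum_germs H \<phi> y) g)
        = (- 1 / 2 * \<phi> (star (antipode H x) * antipode H y)) *\<^sub>C (star f * g))"

subsection \<open>The operations on pure tensors\<close>

lemma csubspace_tensor_sub: "csubspace (tensor_sub T)"
  unfolding tensor_sub_def by (rule complex_vector.subspace_span)

lemma induced_map_coset:
  fixes N :: "'b::complex_vector set"
  assumes "\<And>s t. F (s + t) = F s + F t" and "F ` N \<subseteq> N'" and "0 \<in> N" and "csubspace N'"
  shows "induced_map F N' (t +o N) = F t +o N'"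
proof (intro equalityI subsetI)
  fix y assume "y \<in> induced_map F N' (t +o N)"
  then obtain n n' where "n \<in> N" "n' \<in> N'" "y = F t + (F n + n')"
    by (auto simp: induced_map_def set_plus_def elt_set_plus_def assms(1) add.assoc)
  with assms(2) complex_vector.subspace_add[OF assms(4)] show "y \<in> F t +o N'"
    by (auto simp: elt_set_plus_def image_subset_iff)
next
  fix y assume "y \<in> F t +o N'"
  then obtain n' where "n' \<in> N'" "y = F t + n'" by (auto simp: elt_set_plus_def)
  moreover have "t \<in> t +o N" using assms(3) unfolding elt_set_plus_def by (auto intro!: bexI[of _ 0])
  ultimately show "y \<in> induced_map F N' (t +o N)"
    by (auto simp: induced_map_def set_plus_def)
qed

lemma tensor_sub_invariant:
  assumes "clinear F" "\<And>b r. r \<in> R \<Longrightarrow> F (b \<otimes>\<^sub>C r) \<in> N" "csubspace N"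
  shows "F ` tensor_sub R \<subseteq> N"
proof -
  have "tensor_sub R \<subseteq> F -` N"
    unfolding tensor_sub_def using assms
    by (intro complex_vector.span_minimal)
      (auto simp: complex_vector.subspace_def clinear_add clinear_scale clinear_zero)
  then show ?thesis by auto
qed

lemma R_ideal_right:
  assumes "hopf_star_algebra H" "r \<in> R_ideal H \<phi>"
  shows "r * a \<in> R_ideal H \<phi>"
  using assms by (auto simp: R_ideal_def hopf_star_algebra_def mult.assoc)

lemma omega_left_mult:
  "left_mult (omega H \<phi>) a (omega_class H \<phi> (b \<otimes>\<^sub>C c)) = omega_class H \<phi> ((a * b) \<otimes>\<^sub>C c)"
proof -
  have lin: "clinear (tensor_map ((*) a) id)"
    by (intro clinear_tensor_map clinear_mult_left clinear_id)
  have "tensor_map ((*) a) id ` tensor_sub (R_ideal H \<phi>) \<subseteq> tensor_sub (R_ideal H \<phi>)"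
    by (rule tensor_sub_invariant[OF lin _ csubspace_tensor_sub])
      (auto simp: tensor_map_tensor[OF clinear_mult_left clinear_id] tensor_sub_def
        intro!: complex_vector.span_base)
  then show ?thesis
    by (simp add: omega_def Let_def omega_class_def induced_map_coset clinear_add[OF lin]
        csubspace_tensor_sub complex_vector.subspace_0 tensor_map_tensor[OF clinear_mult_left clinear_id])
qed

lemma tensor_in_cspan:
  fixes t :: "('a::complex_vector, 'b::complex_vector) tensor"
  shows "t \<in> cspan {x \<otimes>\<^sub>C y | x y. True}"
proof (induct t rule: tensor.abs_induct)
  fix r :: "'a \<times> 'b \<Rightarrow>\<^sub>0 complex"
  show "abs_tensor r \<in> cspan {x \<otimes>\<^sub>C y | x y. True}"
  proof (induction r rule: Poly_Mapping.update_induct)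
    case const
    then show ?case
      using complex_vector.span_zero by (metis zero_tensor.abs_eq)
  next
    case (update f k c)
    have "Poly_Mapping.update k c f = f + c *\<^sub>C Poly_Mapping.single k 1"
      using update(1) by (intro poly_mapping_eqI)
        (auto simp: lookup_update lookup_add scaleC_poly_mapping.rep_eq lookup_single when_def in_keys_iff)
    moreover have "abs_tensor (Poly_Mapping.single k 1) = fst k \<otimes>\<^sub>C snd k"
      by (simp add: tensor_def)
    ultimately have "abs_tensor (Poly_Mapping.update k c f) = abs_tensor f + c *\<^sub>C (fst k \<otimes>\<^sub>C snd k)"
      by (simp add: plus_tensor.abs_eq[symmetric] scaleC_tensor.abs_eq[symmetric])
    then show ?case
      using update by (auto intro!: complex_vector.span_add complex_vector.span_scale
          intro: complex_vector.span_base)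
  qed
qed

lemma tensor_induct_subspace:
  assumes l: "clinear F" and F: "\<And>x y. F (x \<otimes>\<^sub>C y) \<in> N" and N: "csubspace N"
  shows "F t \<in> N"
proof -
  have "cspan {x \<otimes>\<^sub>C y | x y. True} \<subseteq> F -` N"
    using N F by (intro complex_vector.span_minimal)
      (auto simp: complex_vector.subspace_def clinear_add[OF l] clinear_scale[OF l] clinear_zero[OF l])
  with tensor_in_cspan[of t] show ?thesis by auto
qed

lemma omega_right_mult:
  assumes H: "hopf_star_algebra H"
  shows "right_mult (omega H \<phi>) (omega_class H \<phi> (b \<otimes>\<^sub>C c)) a
    = omega_class H \<phi> (sweedler2 H (\<lambda>x y. (b * x) \<otimes>\<^sub>C (c * y)) a)"
proof -
  let ?N = "tensor_sub (R_ideal H \<phi>) :: ('a, 'a) tensor set"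
  have lin: "clinear (\<lambda>t. t * comult H a)"
    by (rule clinearI) (simp_all add: times_tensor_left_linear)
  have pure: "x \<otimes>\<^sub>C r \<in> ?N" if "r \<in> R_ideal H \<phi>" for x r
    using that by (auto simp: tensor_sub_def intro!: complex_vector.span_base)
  have "(x \<otimes>\<^sub>C r) * s \<in> ?N" if r: "r \<in> R_ideal H \<phi>" for x r s
    unfolding times_tensor_left
    by (rule tensor_induct_subspace[OF clinear_tensor_lift[OF cbilinear_mult_tensor] _ csubspace_tensor_sub])
      (simp add: tensor_lift_tensor[OF cbilinear_mult_tensor] pure R_ideal_right[OF H r])
  then have "(\<lambda>t. t * comult H a) ` ?N \<subseteq> ?N"
    by (intro tensor_sub_invariant[OF lin _ csubspace_tensor_sub])
  then show ?thesis
    by (simp add: omega_def Let_def omega_class_def induced_map_coset clinear_add[OF lin]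
        csubspace_tensor_sub complex_vector.subspace_0 times_tensor_left sweedler2_def)
qed

end

theory Submission
  imports Defs "Jordan_Normal_Form.Spectral_Radius"
begin

text \<open>
  Everything is reduced to the operators \<open>f \<triangleright> a = a\<^sub>1 f(a\<^sub>2)\<close> for functionals \<open>f\<close>. Invariance of the
  Haar state says that \<open>f\<^sup>* \<triangleright>\<close> is adjoint to \<open>f \<triangleright>\<close> for the form \<open>h(a\<^sup>*b)\<close>; hence its radical and
  orthogonal complements are stable, which gives faithfulness and, for a stable subspace of minimal
  dimension not spanned by the \<open>u\<^sup>\<mu>\<^sub>i\<^sub>j\<close>, an irreducible unitary corepresentation contradicting the
  choice of representatives. So the \<open>u\<^sup>\<mu>\<^sub>i\<^sub>j\<close> span, and the equivalence of the two descriptions is a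
  computation on them in one direction and Schur's lemma in the other.

  The form is the descent to \<open>\<Omega>\<^sub>\<phi>\<close> of
  \<open>\<langle>b \<otimes> c, b' \<otimes> c'\<rangle> = - 1/2 (b\<^sup>*b')\<^sub>1 \<phi>(S(c)\<^sup>* (b\<^sup>*b')\<^sub>2 S(c'))\<close>. It vanishes on \<open>A \<otimes> R\<^sub>\<phi>\<close> because
  \<open>S(R\<^sub>\<phi>)\<^sup>* \<subseteq> R\<^sub>\<phi>\<close>, and the Laplacian identity follows from the self-adjointness of \<open>\<phi> \<triangleright>\<close>.
\<close>

section \<open>Linear maps and tensors\<close>

text \<open>The form is prescribed only on the products Q(x) f, which satisfy linear relations, so
  existence read off directly would mean checking all of them. In the model A \<otimes> (ker
  \<epsilon> / R) the factors b and c vary freely; passing to it costs S^-1, which the star supplies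
  as a |-> star (S (star a)). Only the quotient by R is then left to check. There, self-adjointness
  and hermiticity of \<phi> together give \<phi> o S = \<phi>, and this makes R stable under the
  involution r |-> star (S r); the same involution yields nondegeneracy.

  The factor -1/2 is that of a carre du champ: the form satisfies 2 <df, dg> = star f (\<phi>
  \<triangleright> g) + star (\<phi> \<triangleright> f) g - \<phi> \<triangleright> (star f g).
  Under h the first two terms agree, while the third gives \<phi>(1) h(star f g) = 0.

  Faithfulness of h and the Peter-Weyl basis are not among the hypotheses; what is used of them has
  to be derived from invariance and positivity of h.\<close>

lemma clinear_compose: "clinear g \<Longrightarrow> clinear f \<Longrightarrow> clinear (\<lambda>x. g (f x))"
  by (rule clinearI) (simp_all add: clinear_add clinear_scale)

lemma clinear_sum: "clinear g \<Longrightarrow> g (\<Sum>i\<in>J. f i) = (\<Sum>i\<in>J. g (f i))"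
  by (induction J rule: infinite_finite_induct) (simp_all add: clinear_zero clinear_add)

lemma clinear_ident: "clinear (\<lambda>x. x)"
  and clinear_plus: "clinear f \<Longrightarrow> clinear g \<Longrightarrow> clinear (\<lambda>x. f x + g x)"
  and clinear_minus: "clinear f \<Longrightarrow> clinear g \<Longrightarrow> clinear (\<lambda>x. f x - g x)"
  and clinear_scaleC_right: "clinear f \<Longrightarrow> clinear (\<lambda>x. c *\<^sub>C f x)"
  and clinear_scaleC_left: "clinear k \<Longrightarrow> clinear (\<lambda>x. k x *\<^sub>C y)"
  by (rule clinearI; simp add: clinear_add clinear_scale scaleC_add_right scaleC_add_left
      scaleC_scaleC mult.commute complex_vector.scale_right_diff_distrib)+

lemma clinear_mult_const: "clinear f \<Longrightarrow> clinear (\<lambda>x. f x * (c :: 'a::complex_algebra_1))"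
  and clinear_const_mult: "clinear f \<Longrightarrow> clinear (\<lambda>x. (c :: 'a::complex_algebra_1) * f x)"
  by (rule clinearI; simp add: clinear_add clinear_scale algebra_simps mult_scaleC_left
      mult_scaleC_right)+

lemma clinear_cmult_const: "clinear k \<Longrightarrow> clinear (\<lambda>x. k x * (c :: complex))"
  and clinear_const_cmult: "clinear k \<Longrightarrow> clinear (\<lambda>x. (c :: complex) * k x)"
  by (rule clinearI; simp add: clinear_add clinear_scale algebra_simps)+

lemma clinear_tensor_const: "clinear f \<Longrightarrow> clinear (\<lambda>x. f x \<otimes>\<^sub>C y)"
  and clinear_const_tensor: "clinear f \<Longrightarrow> clinear (\<lambda>x. y \<otimes>\<^sub>C f x)"
  by (rule clinearI; simp add: clinear_add clinear_scale tensor_add_left tensor_add_right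
      tensor_scale_left tensor_scale_right)+

lemma clinear_sum_fun: "(\<And>i. i \<in> J \<Longrightarrow> clinear (f i)) \<Longrightarrow> clinear (\<lambda>x. \<Sum>i\<in>J. f i x)"
  by (rule clinearI) (simp_all add: clinear_add clinear_scale sum.distrib
      complex_vector.scale_sum_right[symmetric] cong: sum.cong)

lemma clinear_cnj_cnj:
  assumes "clinear k" shows "clinear (\<lambda>x :: 'a::complex_star_algebra. cnj (k (star x)))"
  by (rule clinearI) (simp_all add: star_add star_scaleC clinear_add[OF assms] clinear_scale[OF assms])

lemmas clinear_intros = clinear_ident clinear_plus clinear_minus clinear_scaleC_right
  clinear_scaleC_left clinear_mult_const clinear_const_mult clinear_cmult_const clinear_const_cmult
  clinear_tensor_const clinear_const_tensor

lemma cbilinear_clinearI: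
  "(\<And>b. clinear (\<lambda>a. f a b)) \<Longrightarrow> (\<And>a. clinear (\<lambda>b. f a b)) \<Longrightarrow> cbilinear f"
  by (simp add: cbilinear_def)

lemma cbilinear_assoc_inner:
  "cbilinear (\<lambda>(a::'a::complex_vector) (b::'b::complex_vector). a \<otimes>\<^sub>C (b \<otimes>\<^sub>C (c::'c::complex_vector)))"
  by (intro cbilinear_clinearI clinear_intros)

lemma cbilinear_assoc:
  "cbilinear (\<lambda>(t :: ('a::complex_vector, 'b::complex_vector) tensor) (c :: 'c::complex_vector).
    tensor_lift (\<lambda>a b. a \<otimes>\<^sub>C (b \<otimes>\<^sub>C c)) t)"
proof (rule cbilinear_clinearI)
  show "clinear (\<lambda>t :: ('a, 'b) tensor. tensor_lift (\<lambda>a b. a \<otimes>\<^sub>C (b \<otimes>\<^sub>C (c::'c))) t)" for c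
    by (rule clinear_tensor_lift[OF cbilinear_assoc_inner])
  show "clinear (\<lambda>c :: 'c. tensor_lift (\<lambda>a b. a \<otimes>\<^sub>C (b \<otimes>\<^sub>C c)) (t :: ('a, 'b) tensor))" for t
    unfolding tensor_lift_def by (intro clinear_sum_fun clinear_intros)
qed

lemma star_zero: "star 0 = (0 :: 'a::complex_star_algebra)"
  using star_add[of 0 "0 :: 'a"] by simp

lemma star_diff: "star (x - y) = star x - star (y :: 'a::complex_star_algebra)"
  using star_add[of "x - y" y] by simp

lemma star_minus: "star (- x) = - star (x :: 'a::complex_star_algebra)"
  using star_diff[of 0 x] by (simp add: star_zero)

lemma star_sum: "star (\<Sum>i\<in>J. f i) = (\<Sum>i\<in>J. star (f i) :: 'a::complex_star_algebra)"
  by (induction J rule: infinite_finite_induct) (simp_all add: star_zero star_add)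

lemma star_one: "star 1 = (1 :: 'a::complex_star_algebra)"
  by (metis mult.left_neutral mult.right_neutral star_mult star_star)

lemma clinear_star_star:
  assumes "clinear f" shows "clinear (\<lambda>x :: 'a::complex_star_algebra. star (f (star x) :: 'a))"
  by (rule clinearI) (simp_all add: star_add star_scaleC clinear_add[OF assms] clinear_scale[OF assms])

lemma sum_scaleC_left: "(\<Sum>i\<in>J. k i *\<^sub>C x) = (\<Sum>i\<in>J. k i) *\<^sub>C (x :: 'a::complex_vector)"
  by (induction J rule: infinite_finite_induct) (simp_all add: scaleC_add_left)

lemma clinear_eq_on_tensors:
  assumes "clinear F" "clinear G" "\<And>x y. F (x \<otimes>\<^sub>C y) = G (x \<otimes>\<^sub>C y)"
  shows "F t = G t"
proof -
  have "F t - G t \<in> {0}"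
    by (rule tensor_induct_subspace[where F = "\<lambda>t. F t - G t"])
      (simp_all add: assms(3) clinear_minus[OF assms(1,2)] complex_vector.subspace_single_0)
  then show ?thesis by simp
qed

lemma tensor_lift_id: "tensor_lift (\<otimes>\<^sub>C) t = (t :: ('a::complex_vector, 'b::complex_vector) tensor)"
proof -
  have bil: "cbilinear ((\<otimes>\<^sub>C) :: 'a \<Rightarrow> 'b \<Rightarrow> _)"
    by (intro cbilinear_clinearI clinear_intros)
  show ?thesis
    by (rule clinear_eq_on_tensors[OF clinear_tensor_lift[OF bil] clinear_ident tensor_lift_tensor[OF bil]])
qed

lemma tensor_as_sum:
  "t = (\<Sum>k\<in>Poly_Mapping.keys (rep_tensor t).
          (Poly_Mapping.lookup (rep_tensor t) k *\<^sub>C fst k) \<otimes>\<^sub>C snd k)"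
  using tensor_lift_id[of t] by (simp add: tensor_lift_def tensor_scale_left)

lemma tensor_lift_sum:
  assumes "cbilinear f" shows "tensor_lift f (\<Sum>i\<in>J. x i \<otimes>\<^sub>C y i) = (\<Sum>i\<in>J. f (x i) (y i))"
  by (simp add: clinear_sum[OF clinear_tensor_lift[OF assms]] tensor_lift_tensor[OF assms])

section \<open>Hamel coordinates and slices of tensors\<close>

definition coordinate :: "'a::complex_vector \<Rightarrow> 'a \<Rightarrow> complex" where
  "coordinate b x = complex_vector.representation (complex_vector.extend_basis {}) x b"

lemma extend_basis_empty:
  "complex_vector.independent (complex_vector.extend_basis ({} :: 'a::complex_vector set))"
  "cspan (complex_vector.extend_basis ({} :: 'a::complex_vector set)) = UNIV"
  by (auto intro!: complex_vector.independent_extend_basis complex_vector.span_extend_basis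
      complex_vector.independent_empty)

lemma clinear_coordinate: "clinear (coordinate b)"
  by (rule clinearI) (simp_all add: coordinate_def complex_vector.representation_add
      complex_vector.representation_scale extend_basis_empty)

text \<open>One finite set of basis vectors, the union of the supports, serves the whole finite
  family, so that its members can be expanded side by side.\<close>

lemma coordinate_expansion:
  fixes x :: "'i \<Rightarrow> 'a::complex_vector"
  assumes "finite J"
  obtains F where "finite F" "\<And>j. j \<in> J \<Longrightarrow> x j = (\<Sum>b\<in>F. coordinate b (x j) *\<^sub>C b)"
proof -
  let ?B = "complex_vector.extend_basis ({} :: 'a set)"
  let ?s = "\<lambda>j. {b. coordinate b (x j) \<noteq> 0}"
  have fin: "finite (?s j)" for j
    unfolding coordinate_def by (rule complex_vector.finite_representation)
  show ?thesis
  proof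
    show "finite (\<Union>j\<in>J. ?s j)" using assms fin by blast
    fix j assume j: "j \<in> J"
    have "x j = (\<Sum>b\<in>?s j. coordinate b (x j) *\<^sub>C b)"
      unfolding coordinate_def
      by (rule complex_vector.sum_nonzero_representation_eq[symmetric]) (simp_all add: extend_basis_empty)
    also have "\<dots> = (\<Sum>b\<in>(\<Union>j\<in>J. ?s j). coordinate b (x j) *\<^sub>C b)"
      using j assms fin by (intro sum.mono_neutral_left) auto
    finally show "x j = (\<Sum>b\<in>(\<Union>j\<in>J. ?s j). coordinate b (x j) *\<^sub>C b)" .
  qed
qed

text \<open>The map id \<otimes> f. On \<Delta> a it is f \<triangleright> a, which links tensors to
  convolution operators.\<close>

definition slice :: "('b::complex_vector \<Rightarrow> complex) \<Rightarrow> ('a::complex_vector, 'b) tensor \<Rightarrow> 'a" where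
  "slice f = tensor_lift (\<lambda>x y. f y *\<^sub>C x)"

lemma cbilinear_slice: "clinear f \<Longrightarrow> cbilinear (\<lambda>x y. f y *\<^sub>C x)"
  by (intro cbilinear_clinearI clinear_intros)

lemma clinear_slice: "clinear f \<Longrightarrow> clinear (slice f)"
  unfolding slice_def by (intro clinear_tensor_lift cbilinear_slice)

lemma slice_tensor: "clinear f \<Longrightarrow> slice f (x \<otimes>\<^sub>C y) = f y *\<^sub>C x"
  unfolding slice_def by (simp add: tensor_lift_tensor cbilinear_slice)

text \<open>Expand the right legs of a representative of t in the Hamel basis and collect: the
  coefficient of b is the slice of t by the coordinate functional of b.\<close>

lemma slice_expansion:
  obtains F where "finite F" "t = (\<Sum>b\<in>F. slice (coordinate b) t \<otimes>\<^sub>C b)"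
proof -
  define J where "J = Poly_Mapping.keys (rep_tensor t)"
  define x where "x k = Poly_Mapping.lookup (rep_tensor t) k *\<^sub>C fst k" for k
  have t: "t = (\<Sum>k\<in>J. x k \<otimes>\<^sub>C snd k)" unfolding J_def x_def by (rule tensor_as_sum)
  have "finite J" by (simp add: J_def)
  then obtain F where F: "finite F" "\<And>k. k \<in> J \<Longrightarrow> snd k = (\<Sum>b\<in>F. coordinate b (snd k) *\<^sub>C b)"
    by (rule coordinate_expansion[where x = snd]) blast
  have "t = (\<Sum>k\<in>J. \<Sum>b\<in>F. (coordinate b (snd k) *\<^sub>C x k) \<otimes>\<^sub>C b)"
    unfolding t
  proof (rule sum.cong[OF refl])
    fix k assume "k \<in> J"
    then have "x k \<otimes>\<^sub>C snd k = x k \<otimes>\<^sub>C (\<Sum>b\<in>F. coordinate b (snd k) *\<^sub>C b)"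
      using F(2) by simp
    then show "x k \<otimes>\<^sub>C snd k = (\<Sum>b\<in>F. (coordinate b (snd k) *\<^sub>C x k) \<otimes>\<^sub>C b)"
      by (simp add: clinear_sum[OF clinear_const_tensor[OF clinear_ident]] tensor_scale_left
          tensor_scale_right)
  qed
  also have "\<dots> = (\<Sum>b\<in>F. (\<Sum>k\<in>J. coordinate b (snd k) *\<^sub>C x k) \<otimes>\<^sub>C b)"
    by (subst sum.swap) (simp add: clinear_sum[OF clinear_tensor_const[OF clinear_ident]])
  also have "\<dots> = (\<Sum>b\<in>F. slice (coordinate b) t \<otimes>\<^sub>C b)"
    by (simp add: t clinear_sum[OF clinear_slice] slice_tensor clinear_coordinate)
  finally show ?thesis using F(1) that by blast
qed

text \<open>Functionals on the right leg separate tensors. An identity for \<Delta> a can thus be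
  checked on the vectors f \<triangleright> a.\<close>

lemma tensor_eq_slicesI:
  assumes "\<And>f. clinear f \<Longrightarrow> slice f s = slice f t" shows "s = t"
proof -
  obtain F where "s - t = (\<Sum>b\<in>F. slice (coordinate b) (s - t) \<otimes>\<^sub>C b)"
    by (rule slice_expansion)
  also have "\<dots> = (\<Sum>b\<in>F. 0 \<otimes>\<^sub>C b)"
    by (simp add: clinear_diff[OF clinear_slice] clinear_coordinate assms)
  also have "\<dots> = 0" by (simp add: clinear_zero[OF clinear_tensor_const[OF clinear_ident]])
  finally show ?thesis by simp
qed

lemma eq_functionalsI:
  assumes "\<And>f :: 'a \<Rightarrow> complex. clinear f \<Longrightarrow> f x = f (y :: 'a::complex_vector)" shows "x = y"
proof -
  obtain F where F: "\<And>j. j \<in> {x, y} \<Longrightarrow> j = (\<Sum>b\<in>F. coordinate b j *\<^sub>C b)"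
    by (rule coordinate_expansion[of "{x, y}" "\<lambda>j. j"]) auto
  have "x = (\<Sum>b\<in>F. coordinate b x *\<^sub>C b)" by (rule F) simp
  also have "\<dots> = (\<Sum>b\<in>F. coordinate b y *\<^sub>C b)" using assms[OF clinear_coordinate] by simp
  also have "\<dots> = y" by (rule F[symmetric]) simp
  finally show ?thesis .
qed

section \<open>Hopf star algebras\<close>

locale star_hopf =
  fixes H :: "'a::complex_star_algebra hopf"
  assumes hopf: "hopf_star_algebra H"
begin

abbreviation "\<Delta> \<equiv> comult H"
abbreviation "\<epsilon> \<equiv> counit H"
abbreviation "\<S> \<equiv> antipode H"

lemma clinear_comult: "clinear \<Delta>" and clinear_counit: "clinear \<epsilon>" and clinear_antipode: "clinear \<S>"
  and comult_mult: "\<Delta> (a * b) = \<Delta> a * \<Delta> b" and comult_one: "\<Delta> 1 = 1 \<otimes>\<^sub>C 1"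
  and comult_star: "\<Delta> (star a) = tensor_star (\<Delta> a)"
  and counit_mult: "\<epsilon> (a * b) = \<epsilon> a * \<epsilon> b" and counit_one: "\<epsilon> 1 = 1"
  and comult_coassoc: "tensor_assoc (tensor_map \<Delta> id (\<Delta> a)) = tensor_map id \<Delta> (\<Delta> a)"
  and comult_counit_left: "tensor_lift (\<lambda>x y. \<epsilon> x *\<^sub>C y) (\<Delta> a) = a"
  and comult_counit_right: "tensor_lift (\<lambda>x y. \<epsilon> y *\<^sub>C x) (\<Delta> a) = a"
  and comult_antipode_left: "tensor_lift (\<lambda>x y. \<S> x * y) (\<Delta> a) = \<epsilon> a *\<^sub>C 1"
  and comult_antipode_right: "tensor_lift (\<lambda>x y. x * \<S> y) (\<Delta> a) = \<epsilon> a *\<^sub>C 1"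
  using hopf unfolding hopf_star_algebra_def by blast+

lemmas hopf_intros = clinear_intros clinear_compose[OF clinear_comult]
  clinear_compose[OF clinear_counit] clinear_compose[OF clinear_antipode]

text \<open>Unlike \<^const>\<open>tensor_lift\<close>, this sum over a fixed representative of \<open>\<Delta> a\<close> commutes
  with every additive map, in particular with the conjugate linear ones.\<close>

definition sw :: "('a \<Rightarrow> 'a \<Rightarrow> 'b::comm_monoid_add) \<Rightarrow> 'a \<Rightarrow> 'b" where
  "sw f a = (\<Sum>k\<in>Poly_Mapping.keys (rep_tensor (\<Delta> a)).
     f (Poly_Mapping.lookup (rep_tensor (\<Delta> a)) k *\<^sub>C fst k) (snd k))"

lemma comult_sw: "\<Delta> a = sw (\<otimes>\<^sub>C) a"
  unfolding sw_def by (rule tensor_as_sum)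

lemma sw_tensor_lift: "cbilinear f \<Longrightarrow> sw f a = tensor_lift f (\<Delta> a)"
  by (simp add: sw_def tensor_lift_def cbilinear_simps)

lemma sw_eqI:
  assumes "cbilinear f" "\<Delta> a = (\<Sum>i\<in>J. x i \<otimes>\<^sub>C y i)"
  shows "sw f a = (\<Sum>i\<in>J. f (x i) (y i))"
  by (simp add: sw_tensor_lift[OF assms(1)] assms(2) tensor_lift_sum[OF assms(1)])

lemma clinear_sw: "cbilinear f \<Longrightarrow> clinear g \<Longrightarrow> clinear (\<lambda>x. sw f (g x))"
  by (simp add: sw_tensor_lift clinear_compose[OF clinear_tensor_lift] clinear_compose[OF clinear_comult])

lemma clinear_sw_param:
  assumes "\<And>p q. clinear (\<lambda>x. g x p q)" shows "clinear (\<lambda>x. sw (g x) b)"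
  unfolding sw_def by (rule clinear_sum_fun) (rule assms)

lemmas sw_intros = cbilinear_clinearI clinear_sw clinear_sw_param hopf_intros

lemma sw_apply: "clinear g \<Longrightarrow> sw (\<lambda>x y. g (f x y)) a = g (sw f a)"
  by (simp add: sw_def clinear_sum)

lemma star_sw: "star (sw f a :: 'a) = sw (\<lambda>x y. star (f x y)) a"
  by (simp add: sw_def star_sum)

lemma sw_swap:
  "sw (\<lambda>x y. sw (\<lambda>p q. f x y p q) b) a = sw (\<lambda>p q. sw (\<lambda>x y. f x y p q) a) b"
  unfolding sw_def by (rule sum.swap)

lemma sw_mult_left: "sw (\<lambda>x y. c * f x y) a = (c :: 'b::semiring_0) * sw f a"
  and sw_mult_right: "sw (\<lambda>x y. f x y * c) a = sw f a * (c :: 'b::semiring_0)"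
  by (simp_all add: sw_def sum_distrib_left sum_distrib_right)

lemma sw_scaleC: "sw (\<lambda>x y. c *\<^sub>C f x y) a = c *\<^sub>C sw f a"
  by (simp add: sw_def complex_vector.scale_sum_right)

lemma sw_scaleC_left: "sw (\<lambda>x y. k x y *\<^sub>C b) a = sw k a *\<^sub>C b"
  by (simp add: sw_def sum_scaleC_left)

lemma sw_comult_mult:
  assumes "cbilinear f"
  shows "sw f (a * b) = sw (\<lambda>x y. sw (\<lambda>p q. f (x * p) (y * q)) b) a"
proof -
  note lin = clinear_sum[OF clinear_tensor_lift[OF assms]]
  have right: "(x \<otimes>\<^sub>C y) * \<Delta> b = sw (\<lambda>p q. (x * p) \<otimes>\<^sub>C (y * q)) b" for x y
    by (simp add: times_tensor_left sw_tensor_lift[OF cbilinear_mult_tensor])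
  have "clinear (\<lambda>t. t * \<Delta> b)"
    by (rule clinearI) (simp_all add: times_tensor_left_linear)
  then have "\<Delta> a * \<Delta> b = sw (\<lambda>x y. (x \<otimes>\<^sub>C y) * \<Delta> b) a"
    by (subst comult_sw) (rule sw_apply[symmetric])
  then have "\<Delta> (a * b) = sw (\<lambda>x y. sw (\<lambda>p q. (x * p) \<otimes>\<^sub>C (y * q)) b) a"
    by (simp add: comult_mult right)
  then show ?thesis
    by (simp add: sw_tensor_lift[OF assms] sw_apply[OF clinear_tensor_lift[OF assms], symmetric]
        tensor_lift_tensor[OF assms])
qed

lemma sw_one: "cbilinear f \<Longrightarrow> sw f 1 = f 1 1"
  by (simp add: sw_tensor_lift comult_one tensor_lift_tensor)

lemma sw_star:
  assumes "cbilinear f"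
  shows "sw f (star a) = sw (\<lambda>x y. f (star x) (star y)) a"
proof -
  have "\<Delta> (star a) = sw (\<lambda>x y. star x \<otimes>\<^sub>C star y) a"
    by (simp add: comult_star tensor_star_def sw_def star_scaleC tensor_scale_left)
  then show ?thesis
    by (simp add: sw_tensor_lift[OF assms] sw_apply[OF clinear_tensor_lift[OF assms], symmetric]
        tensor_lift_tensor[OF assms])
qed

text \<open>Both sides are images of the iterated coproducts under the linear map on triple tensors
  induced by the trilinear f (\<open>?G\<close> in the proof). Linearity in each leg frees the
  nested sums from the chosen representatives.\<close>

lemma sw_coassoc:
  assumes "\<And>y z. clinear (\<lambda>x. f x y z)" "\<And>x z. clinear (\<lambda>y. f x y z)" "\<And>x y. clinear (\<lambda>z. f x y z)"
  shows "sw (\<lambda>x y. sw (\<lambda>p q. f p q y) x) a = sw (\<lambda>x y. sw (\<lambda>p q. f x p q) y) a"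
proof -
  have inner: "cbilinear (\<lambda>p q. f x p q)" for x by (intro cbilinear_clinearI assms)
  have outer: "cbilinear (\<lambda>x t. tensor_lift (f x) t)"
  proof (rule cbilinear_clinearI)
    show "clinear (\<lambda>x. tensor_lift (f x) t)" for t
      unfolding tensor_lift_def by (intro clinear_sum_fun clinear_scaleC_right assms)
    show "clinear (tensor_lift (f x))" for x by (rule clinear_tensor_lift[OF inner])
  qed
  let ?G = "tensor_lift (\<lambda>x t. tensor_lift (f x) t)"
  note G = clinear_tensor_lift[OF outer]
  note mid = cbilinear_assoc_inner and as = cbilinear_assoc
  have left: "\<Delta> x \<otimes>\<^sub>C y = sw (\<lambda>p q. (p \<otimes>\<^sub>C q) \<otimes>\<^sub>C y) x" for x y
    by (subst comult_sw) (rule sw_apply[OF clinear_tensor_const[OF clinear_ident], symmetric])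
  have right: "x \<otimes>\<^sub>C \<Delta> y = sw (\<lambda>p q. x \<otimes>\<^sub>C (p \<otimes>\<^sub>C q)) y" for x y
    by (subst comult_sw) (rule sw_apply[OF clinear_const_tensor[OF clinear_ident], symmetric])
  have "tensor_map \<Delta> id (\<Delta> a) = sw (\<lambda>x y. \<Delta> x \<otimes>\<^sub>C y) a"
    using sw_apply[OF clinear_tensor_map[OF clinear_comult clinear_id], of "(\<otimes>\<^sub>C)" a]
    by (simp add: tensor_map_tensor[OF clinear_comult clinear_id] comult_sw[symmetric])
  also have "\<dots> = sw (\<lambda>x y. sw (\<lambda>p q. (p \<otimes>\<^sub>C q) \<otimes>\<^sub>C y) x) a"
    by (simp only: left)
  finally have "tensor_assoc (tensor_map \<Delta> id (\<Delta> a)) = sw (\<lambda>x y. sw (\<lambda>p q. p \<otimes>\<^sub>C (q \<otimes>\<^sub>C y)) x) a"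
    by (simp add: tensor_assoc_def sw_apply[OF clinear_tensor_lift[OF as], symmetric]
        tensor_lift_tensor[OF as] tensor_lift_tensor[OF mid])
  then have 1: "?G (tensor_assoc (tensor_map \<Delta> id (\<Delta> a))) = sw (\<lambda>x y. sw (\<lambda>p q. f p q y) x) a"
    by (simp add: sw_apply[OF G, symmetric] tensor_lift_tensor[OF outer] tensor_lift_tensor[OF inner])
  have "tensor_map id \<Delta> (\<Delta> a) = sw (\<lambda>x y. x \<otimes>\<^sub>C \<Delta> y) a"
    using sw_apply[OF clinear_tensor_map[OF clinear_id clinear_comult], of "(\<otimes>\<^sub>C)" a]
    by (simp add: tensor_map_tensor[OF clinear_id clinear_comult] comult_sw[symmetric])
  also have "\<dots> = sw (\<lambda>x y. sw (\<lambda>p q. x \<otimes>\<^sub>C (p \<otimes>\<^sub>C q)) y) a"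
    by (simp only: right)
  finally have "?G (tensor_map id \<Delta> (\<Delta> a)) = sw (\<lambda>x y. sw (\<lambda>p q. f x p q) y) a"
    by (simp add: sw_apply[OF G, symmetric] tensor_lift_tensor[OF outer] tensor_lift_tensor[OF inner])
  with 1 show ?thesis by (simp add: comult_coassoc)
qed

lemma sw_counit_left: "clinear g \<Longrightarrow> sw (\<lambda>x y. \<epsilon> x *\<^sub>C g y) a = g a"
proof -
  assume g: "clinear g"
  have "sw (\<lambda>x y. \<epsilon> x *\<^sub>C y) a = a"
    by (subst sw_tensor_lift) (intro sw_intros comult_counit_left)+
  then show ?thesis using sw_apply[OF g, of "\<lambda>x y. \<epsilon> x *\<^sub>C y" a] by (simp add: clinear_scale[OF g])
qed

lemma sw_counit_right: "clinear g \<Longrightarrow> sw (\<lambda>x y. \<epsilon> y *\<^sub>C g x) a = g a"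
proof -
  assume g: "clinear g"
  have "sw (\<lambda>x y. \<epsilon> y *\<^sub>C x) a = a"
    by (subst sw_tensor_lift) (intro sw_intros comult_counit_right)+
  then show ?thesis using sw_apply[OF g, of "\<lambda>x y. \<epsilon> y *\<^sub>C x" a] by (simp add: clinear_scale[OF g])
qed

lemma sw_antipode_left: "sw (\<lambda>x y. \<S> x * y) a = \<epsilon> a *\<^sub>C 1"
  by (subst sw_tensor_lift) (intro sw_intros comult_antipode_left)+

lemma sw_antipode_right: "sw (\<lambda>x y. x * \<S> y) a = \<epsilon> a *\<^sub>C 1"
  by (subst sw_tensor_lift) (intro sw_intros comult_antipode_right)+

section \<open>The antipode, its inverse and the star\<close>

lemma antipode_mult: "\<S> (a * b) = \<S> b * \<S> a"
proof -
  define F where "F x s t p u v = \<S> (x * p) * (s * u) * (\<S> v * \<S> t)" for x s t p u v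
  have lin: "clinear (\<lambda>x. F x s t p u v)" "clinear (\<lambda>s. F x s t p u v)" "clinear (\<lambda>t. F x s t p u v)"
    "clinear (\<lambda>p. F x s t p u v)" "clinear (\<lambda>u. F x s t p u v)" "clinear (\<lambda>v. F x s t p u v)"
    for x s t p u v
    unfolding F_def by (intro sw_intros)+
  \<comment> \<open>\<open>?E\<close> is S(a_1 b_1) a_2 b_2 S(b_3) S(a_3). Contracting the right
    half leaves S(a b), contracting the left half leaves S(b) S(a): this is uniqueness of inverses
    for the convolution product.\<close>
  let ?E = "sw (\<lambda>x y. sw (\<lambda>s t. sw (\<lambda>p q. sw (\<lambda>u v. F x s t p u v) q) b) y) a"
  have right: "sw (\<lambda>u v. F x s t p u v) q = \<epsilon> q *\<^sub>C (\<S> (x * p) * (s * \<S> t))" for x s t p q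
  proof -
    have "sw (\<lambda>u v. F x s t p u v) q = \<S> (x * p) * s * sw (\<lambda>u v. u * \<S> v) q * \<S> t"
      by (simp add: F_def sw_mult_left[symmetric] sw_mult_right[symmetric] mult.assoc)
    then show ?thesis by (simp add: sw_antipode_right mult_scaleC_left mult_scaleC_right mult.assoc)
  qed
  have lin1: "clinear (\<lambda>p. \<S> (x * p) * (s * \<S> t))" for x s t by (intro sw_intros)
  have "sw (\<lambda>s t. \<S> (x * b) * (s * \<S> t)) y = \<epsilon> y *\<^sub>C \<S> (x * b)" for x y
    by (simp add: sw_mult_left sw_antipode_right mult_scaleC_right)
  then have 1: "?E = \<S> (a * b)"
    by (simp add: right sw_counit_right[OF lin1] sw_counit_right[where g = "\<lambda>x. \<S> (x * b)"]
        sw_intros)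
  have left: "sw (\<lambda>x s. sw (\<lambda>p u. F x s t p u v) q) y = (\<epsilon> y * \<epsilon> q) *\<^sub>C (\<S> v * \<S> t)" for t v y q
  proof -
    have "sw (\<lambda>x s. sw (\<lambda>p u. F x s t p u v) q) y = sw (\<lambda>x y. \<S> x * y) (y * q) * (\<S> v * \<S> t)"
      by (subst sw_comult_mult) (auto intro!: sw_intros simp: F_def sw_mult_right)
    then show ?thesis by (simp add: sw_antipode_left counit_mult mult_scaleC_left)
  qed
  have "sw (\<lambda>p q. sw (\<lambda>u v. F x s t p u v) q) b = sw (\<lambda>p q. sw (\<lambda>p' u. F x s t p' u q) p) b" for x s t
    by (rule sw_coassoc[symmetric]) (rule lin)+
  then have "?E = sw (\<lambda>x y. sw (\<lambda>s t. sw (\<lambda>p q. sw (\<lambda>p' u. F x s t p' u q) p) b) y) a"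
    by simp
  also have "\<dots> = sw (\<lambda>y t. sw (\<lambda>x s. sw (\<lambda>p q. sw (\<lambda>p' u. F x s t p' u q) p) b) y) a"
    by (rule sw_coassoc[symmetric]) (intro clinear_sw_param lin)+
  also have "\<dots> = sw (\<lambda>y t. sw (\<lambda>p q. sw (\<lambda>x s. sw (\<lambda>p' u. F x s t p' u q) p) y) b) a"
    by (subst (2) sw_swap) (rule refl)
  also have "\<dots> = sw (\<lambda>y t. sw (\<lambda>p q. (\<epsilon> y * \<epsilon> p) *\<^sub>C (\<S> q * \<S> t)) b) a"
    by (simp add: left)
  also have "\<dots> = sw (\<lambda>y t. \<epsilon> y *\<^sub>C sw (\<lambda>p q. \<epsilon> p *\<^sub>C (\<S> q * \<S> t)) b) a"
    by (simp add: sw_scaleC[symmetric] scaleC_scaleC)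
  also have "\<dots> = \<S> b * \<S> a"
    by (simp add: sw_counit_left[where g = "\<lambda>q. \<S> q * \<S> _"] sw_counit_left[where g = "\<lambda>t. \<S> b * \<S> t"]
        sw_intros)
  finally show ?thesis using 1 by simp
qed

lemma antipode_one: "\<S> 1 = 1"
proof -
  have "sw (\<lambda>x y. \<S> x * y) 1 = \<S> 1 * 1" by (rule sw_one) (intro sw_intros)
  then show ?thesis by (simp add: sw_antipode_left counit_one scaleC_one)
qed

lemma counit_antipode: "\<epsilon> (\<S> a) = \<epsilon> a"
proof -
  have "\<epsilon> (\<S> a) = sw (\<lambda>x y. \<epsilon> y *\<^sub>C \<epsilon> (\<S> x)) a"
    by (rule sw_counit_right[symmetric]) (intro sw_intros)
  also have "\<dots> = sw (\<lambda>x y. \<epsilon> (\<S> x * y)) a" by (simp add: counit_mult mult.commute)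
  also have "\<dots> = \<epsilon> a"
    by (simp add: sw_apply[OF clinear_counit] sw_antipode_left clinear_scale[OF clinear_counit] counit_one)
  finally show ?thesis .
qed

text \<open>The functional e(a) = cnj (\<epsilon> (star a)) is again a left counit, since \<Delta>
  is compatible with the star, and counits are unique: evaluate \<epsilon>(e(a_1) a_2) in both
  ways.\<close>

lemma counit_star: "\<epsilon> (star a) = cnj (\<epsilon> a)"
proof -
  define e where "e a = cnj (\<epsilon> (star a))" for a
  have lin: "clinear e" unfolding e_def by (rule clinear_cnj_cnj[OF clinear_counit])
  have "sw (\<lambda>x y. e x *\<^sub>C y) a = star (sw (\<lambda>x y. \<epsilon> x *\<^sub>C y) (star a))"
    by (subst sw_star) (auto intro!: sw_intros simp: e_def star_sw star_scaleC star_star)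
  also have "\<dots> = a" by (simp add: sw_counit_left[OF clinear_ident] star_star)
  finally have "\<epsilon> a = \<epsilon> (sw (\<lambda>x y. e x *\<^sub>C y) a)" by simp
  also have "\<dots> = sw (\<lambda>x y. \<epsilon> y *\<^sub>C e x) a"
    by (simp add: sw_apply[OF clinear_counit, symmetric] clinear_scale[OF clinear_counit] mult.commute)
  also have "\<dots> = e a" by (rule sw_counit_right[OF lin])
  finally show ?thesis by (simp add: e_def)
qed

definition antipode_inv :: "'a \<Rightarrow> 'a" where
  "antipode_inv a = star (\<S> (star a))"

lemma clinear_antipode_inv: "clinear antipode_inv"
  unfolding antipode_inv_def by (rule clinear_star_star[OF clinear_antipode])

lemma counit_antipode_inv: "\<epsilon> (antipode_inv a) = \<epsilon> a"
  by (simp add: antipode_inv_def counit_star counit_antipode)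

text \<open>The star reverses products but keeps the order of the legs of \<Delta>, so the axiom a_1
  S(a_2) = \<epsilon>(a) 1 reappears with the legs crossed.\<close>

lemma sw_antipode_inv_left: "sw (\<lambda>x y. antipode_inv y * x) a = \<epsilon> a *\<^sub>C 1"
proof -
  have "sw (\<lambda>x y. antipode_inv y * x) a = star (sw (\<lambda>x y. x * \<S> y) (star a))"
    by (subst sw_star) (auto intro!: sw_intros simp: antipode_inv_def star_sw star_mult star_star)
  then show ?thesis by (simp add: sw_antipode_right counit_star star_scaleC star_one)
qed

lemmas antipode_inv_intros = sw_intros clinear_compose[OF clinear_antipode_inv]

text \<open>By antimultiplicativity, the crossed identity makes S o \<open>antipode_inv\<close> a
  right convolution inverse of S. The identity map is a left one, so the two coincide.\<close>

lemma antipode_antipode_inv: "\<S> (antipode_inv a) = a"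
proof -
  have conv: "sw (\<lambda>x y. \<S> x * \<S> (antipode_inv y)) b = \<epsilon> b *\<^sub>C 1" for b
    by (simp add: antipode_mult[symmetric] sw_apply[OF clinear_antipode] sw_antipode_inv_left
        clinear_scale[OF clinear_antipode] antipode_one)
  have "\<S> (antipode_inv a) = sw (\<lambda>x y. \<epsilon> x *\<^sub>C \<S> (antipode_inv y)) a"
    by (rule sw_counit_left[symmetric]) (intro antipode_inv_intros)
  also have "\<dots> = sw (\<lambda>x y. sw (\<lambda>p q. p * \<S> q * \<S> (antipode_inv y)) x) a"
    by (simp add: sw_mult_right sw_antipode_right mult_scaleC_left)
  also have "\<dots> = sw (\<lambda>x y. sw (\<lambda>p q. x * \<S> p * \<S> (antipode_inv q)) y) a"
    by (rule sw_coassoc) (intro antipode_inv_intros)+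
  also have "\<dots> = sw (\<lambda>x y. \<epsilon> y *\<^sub>C x) a"
    by (simp add: mult.assoc sw_mult_left conv mult_scaleC_right)
  also have "\<dots> = a" by (rule sw_counit_right[OF clinear_ident])
  finally show ?thesis .
qed

lemma antipode_star_antipode: "\<S> (star (\<S> a)) = star a"
  using antipode_antipode_inv[of "star a"] by (simp add: antipode_inv_def star_star)

lemma antipode_inv_star: "antipode_inv (star a) = star (\<S> a)"
  by (simp add: antipode_inv_def star_star)

section \<open>The operators f \<triangleright> a\<close>

lemma convolve_sw: "clinear f \<Longrightarrow> convolve H f a = sw (\<lambda>x y. f y *\<^sub>C x) a"
  by (simp add: convolve_def sweedler2_def sw_tensor_lift[OF cbilinear_slice])

lemma convolve_slice: "convolve H f a = slice f (\<Delta> a)"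
  by (simp add: convolve_def sweedler2_def slice_def)

lemma clinear_convolve: "clinear f \<Longrightarrow> clinear (convolve H f)"
  unfolding convolve_slice[abs_def] by (rule clinear_compose[OF clinear_slice clinear_comult])

lemma convolve_counit: "convolve H \<epsilon> a = a"
  by (simp add: convolve_sw clinear_counit sw_counit_right[OF clinear_ident])

lemma counit_convolve: "clinear f \<Longrightarrow> \<epsilon> (convolve H f a) = f a"
proof -
  assume f: "clinear f"
  have "\<epsilon> (convolve H f a) = sw (\<lambda>x y. \<epsilon> x *\<^sub>C f y) a"
    by (simp add: convolve_sw[OF f] sw_apply[OF clinear_counit, symmetric] clinear_scale[OF clinear_counit]
        mult.commute)
  then show ?thesis by (simp only: sw_counit_left[OF f])
qed

text \<open>Coassociativity makes f |-> f \<triangleright> multiplicative for the product of the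
  dual algebra. Closure of orbits and the coproduct of matrix coefficients both rest on
  this.\<close>

lemma convolve_convolve:
  assumes f: "clinear f" and g: "clinear g"
  shows "convolve H f (convolve H g a) = convolve H (\<lambda>a. sw (\<lambda>x y. f x * g y) a) a"
proof -
  have fg: "clinear (\<lambda>a. sw (\<lambda>x y. f x * g y) a)"
    by (intro sw_intros f g)
  have "convolve H f (g y *\<^sub>C x) = sw (\<lambda>p q. (f q * g y) *\<^sub>C p) x" for x y
    unfolding clinear_scale[OF clinear_convolve[OF f]]
    by (simp add: convolve_sw[OF f] sw_scaleC[symmetric] scaleC_scaleC mult.commute)
  then have "convolve H f (convolve H g a) = sw (\<lambda>x y. sw (\<lambda>p q. (f q * g y) *\<^sub>C p) x) a"
    by (simp add: convolve_sw[OF g] sw_apply[OF clinear_convolve[OF f], symmetric])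
  also have "\<dots> = sw (\<lambda>x y. sw (\<lambda>p q. (f p * g q) *\<^sub>C x) y) a"
    by (rule sw_coassoc) (intro sw_intros f g)+
  also have "\<dots> = convolve H (\<lambda>a. sw (\<lambda>x y. f x * g y) a) a"
    by (simp add: convolve_sw[OF fg] sw_scaleC_left)
  finally show ?thesis .
qed

lemma clinear_dual_star: "clinear f \<Longrightarrow> clinear (dual_star H f)"
  by (rule clinearI) (simp_all add: dual_star_def clinear_add clinear_scale clinear_add[OF clinear_antipode]
      clinear_scale[OF clinear_antipode] star_add star_scaleC)

end

section \<open>The Haar state\<close>

locale haar_hopf = star_hopf +
  fixes h :: "'a \<Rightarrow> complex"
  assumes haar: "haar_state H h"
begin

lemma clinear_haar: "clinear h" and haar_one: "h 1 = 1"
  and haar_real: "h (star a * a) \<in> \<real>" and haar_nonneg: "0 \<le> Re (h (star a * a))"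
  and haar_left: "tensor_lift (\<lambda>x y. h x *\<^sub>C y) (\<Delta> a) = h a *\<^sub>C 1"
  using haar unfolding haar_state_def by blast+

lemmas haar_intros = antipode_inv_intros clinear_compose[OF clinear_haar]

lemma sw_haar_left: "sw (\<lambda>x y. h x *\<^sub>C y) a = h a *\<^sub>C 1"
  by (subst sw_tensor_lift) (intro haar_intros haar_left)+

text \<open>Invariance applied to b_1 x and multiplied by S^-1(b_2) gives h(b_1 x_1) S^-1(b_3) b_2
  x_2, and the crossed identity cancels b_3 against b_2. This is the strong form of
  invariance.\<close>

lemma haar_shift: "sw (\<lambda>s t. h (b * s) *\<^sub>C t) x = sw (\<lambda>p q. h (p * x) *\<^sub>C antipode_inv q) b"
proof -
  define F where "F p q r = sw (\<lambda>s t. h (p * s) *\<^sub>C (antipode_inv r * (q * t))) x" for p q r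
  have inner: "h (p * x) *\<^sub>C antipode_inv y = sw (\<lambda>p q. F p q y) p" for p y
  proof -
    have "h (p * x) *\<^sub>C antipode_inv y = antipode_inv y * sw (\<lambda>x y. h x *\<^sub>C y) (p * x)"
      by (simp add: sw_haar_left mult_scaleC_right)
    also have "\<dots> = antipode_inv y * sw (\<lambda>p q. sw (\<lambda>s t. h (p * s) *\<^sub>C (q * t)) x) p"
      by (subst sw_comult_mult) (intro haar_intros refl)+
    also have "\<dots> = sw (\<lambda>p q. F p q y) p"
      by (simp add: F_def sw_mult_left[symmetric] mult_scaleC_right)
    finally show ?thesis .
  qed
  have "sw (\<lambda>p q. h (p * x) *\<^sub>C antipode_inv q) b = sw (\<lambda>x y. sw (\<lambda>p q. F p q y) x) b"
    by (simp only: inner)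
  also have "\<dots> = sw (\<lambda>x y. sw (\<lambda>p q. F x p q) y) b"
    unfolding F_def by (rule sw_coassoc) (intro haar_intros)+
  also have "\<dots> = sw (\<lambda>p y. \<epsilon> y *\<^sub>C sw (\<lambda>s t. h (p * s) *\<^sub>C t) x) b"
  proof -
    have "sw (\<lambda>q r. F p q r) y = \<epsilon> y *\<^sub>C sw (\<lambda>s t. h (p * s) *\<^sub>C t) x" for p y
    proof -
      have "sw (\<lambda>q r. F p q r) y
        = sw (\<lambda>s t. sw (\<lambda>q r. h (p * s) *\<^sub>C (antipode_inv r * (q * t))) y) x"
        unfolding F_def by (rule sw_swap)
      also have "\<dots> = sw (\<lambda>s t. \<epsilon> y *\<^sub>C (h (p * s) *\<^sub>C t)) x"
        by (simp add: sw_scaleC mult.assoc[symmetric] sw_mult_right sw_antipode_inv_left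
            mult_scaleC_left scaleC_scaleC mult.commute)
      also have "\<dots> = \<epsilon> y *\<^sub>C sw (\<lambda>s t. h (p * s) *\<^sub>C t) x" by (rule sw_scaleC)
      finally show ?thesis .
    qed
    then show ?thesis by simp
  qed
  also have "\<dots> = sw (\<lambda>s t. h (b * s) *\<^sub>C t) x"
    by (rule sw_counit_right) (intro haar_intros)
  finally show ?thesis by (rule sym)
qed

text \<open>Strong invariance at b = star w, with f applied to the free leg: S^-1 of star w_2 is
  star (S w_2), where f takes the conjugate of the value of \<open>dual_star H f\<close> at
  w_2.\<close>

lemma haar_convolve_adjoint:
  assumes f: "clinear f"
  shows "h (star w * convolve H f x) = h (star (convolve H (dual_star H f) w) * x)"
proof -
  have "h (star w * convolve H f x) = sw (\<lambda>s t. f (h (star w * s) *\<^sub>C t)) x"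
    by (simp add: convolve_sw[OF f] sw_mult_left[symmetric] mult_scaleC_right
        sw_apply[OF clinear_haar, symmetric] clinear_scale[OF clinear_haar] clinear_scale[OF f] mult.commute)
  also have "\<dots> = f (sw (\<lambda>p q. h (p * x) *\<^sub>C antipode_inv q) (star w))"
    by (simp add: sw_apply[OF f] haar_shift)
  also have "\<dots> = f (sw (\<lambda>p q. h (star p * x) *\<^sub>C star (\<S> q)) w)"
    by (subst sw_star) (auto intro!: haar_intros simp: antipode_inv_star)
  also have "\<dots> = h (star (convolve H (dual_star H f) w) * x)"
    by (simp add: sw_apply[OF f, symmetric] clinear_scale[OF f] convolve_sw[OF clinear_dual_star[OF f]]
        star_sw star_scaleC dual_star_def sw_mult_right[symmetric] mult_scaleC_left
        sw_apply[OF clinear_haar, symmetric] clinear_scale[OF clinear_haar] mult.commute)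
  finally show ?thesis .
qed

end

context haar_hopf
begin

section \<open>Faithfulness of the Haar state\<close>

lemma haar_hermitian: "h (star x * y) = cnj (h (star y * x))"
proof -
  have expand: "h (star (x + c *\<^sub>C y) * (x + c *\<^sub>C y))
    = h (star x * x) + c * h (star x * y) + cnj c * h (star y * x) + c * cnj c * h (star y * y)" for c
    by (simp add: star_add star_scaleC distrib_left distrib_right mult_scaleC_left mult_scaleC_right
        clinear_add[OF clinear_haar] clinear_scale[OF clinear_haar] scaleC_scaleC)
  have "Im (h (star z * z)) = 0" for z using haar_real[of z] by (simp add: complex_is_Real_iff)
  note real = this
  \<comment> \<open>Polarisation: c = 1 compares the imaginary parts, c = \<i> below compares the
    real parts.\<close>
  have "Im (h (star x * y)) = - Im (h (star y * x))"
    using real[of "x + 1 *\<^sub>C y"] unfolding expand by (simp add: real)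
  moreover have "Re (h (star x * y)) = Re (h (star y * x))"
    using real[of "x + \<i> *\<^sub>C y"] unfolding expand by (simp add: real)
  ultimately show ?thesis by (simp add: complex_eq_iff)
qed

lemma haar_cauchy_schwarz_zero:
  assumes "h (star a * a) = 0" shows "h (star x * a) = 0"
proof (rule ccontr)
  assume "h (star x * a) \<noteq> 0"
  define c where "c = h (star a * x)"
  have xa: "h (star x * a) = cnj c" unfolding c_def by (rule haar_hermitian)
  define r where "r = (cmod c)\<^sup>2"
  have r: "r > 0" using \<open>h (star x * a) \<noteq> 0\<close> by (simp add: r_def xa)
  \<comment> \<open>Since a is null, moving x along a changes the square norm only linearly. This s
    makes 2 s r exceed h(star x x) by 1, so the square norm would drop to -1.\<close>
  define s where "s = (Re (h (star x * x)) + 1) / (2 * r)"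
  have "h (star (x + t *\<^sub>C a) * (x + t *\<^sub>C a)) = h (star x * x) + t * cnj c + cnj t * c" for t
    by (simp add: star_add star_scaleC distrib_left distrib_right mult_scaleC_left mult_scaleC_right
        clinear_add[OF clinear_haar] clinear_scale[OF clinear_haar] scaleC_scaleC assms xa c_def)
  from this[of "- (complex_of_real s * c)"]
  have "h (star (x + (- (complex_of_real s * c)) *\<^sub>C a) * (x + (- (complex_of_real s * c)) *\<^sub>C a))
      = h (star x * x) - 2 * of_real s * (c * cnj c)"
    by (simp add: algebra_simps)
  also have "c * cnj c = of_real r" by (simp add: r_def complex_norm_square[symmetric])
  finally have "0 \<le> Re (h (star x * x) - 2 * of_real s * of_real r)"
    using haar_nonneg[of "x + (- (complex_of_real s * c)) *\<^sub>C a"] by simp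
  then have "0 \<le> Re (h (star x * x)) - 2 * s * r" by simp
  also have "2 * s * r = Re (h (star x * x)) + 1" using r by (simp add: s_def)
  finally show False by simp
qed

text \<open>Writing \<open>\<Delta> a\<close> with left legs \<open>f \<triangleright> a\<close>, which are again in the radical of the form,
  the identity \<open>S\<^sup>-\<^sup>1(a\<^sub>2) a\<^sub>1 = \<epsilon>(a) 1\<close> shows that \<open>\<epsilon>\<close> vanishes on the radical.\<close>

lemma haar_faithful:
  assumes "h (star a * a) = 0" shows "a = 0"
proof -
  have eps: "\<epsilon> b = 0" if b: "\<And>x. h (x * b) = 0" for b
  proof -
    have null: "h (x * convolve H f b) = 0" if "clinear f" for f x
      using haar_convolve_adjoint[OF that, of "star x" b] b by (simp add: star_star)
    obtain F where "\<Delta> b = (\<Sum>c\<in>F. slice (coordinate c) (\<Delta> b) \<otimes>\<^sub>C c)"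
      by (rule slice_expansion)
    then have \<Delta>: "\<Delta> b = (\<Sum>c\<in>F. convolve H (coordinate c) b \<otimes>\<^sub>C c)"
      by (simp only: convolve_slice)
    have "\<epsilon> b = h (sw (\<lambda>x y. antipode_inv y * x) b)"
      by (simp add: sw_antipode_inv_left clinear_scale[OF clinear_haar] haar_one)
    also have "\<dots> = sw (\<lambda>x y. h (antipode_inv y * x)) b" by (simp add: sw_apply[OF clinear_haar])
    also have "\<dots> = (\<Sum>c\<in>F. h (antipode_inv c * convolve H (coordinate c) b))"
      by (rule sw_eqI[OF _ \<Delta>]) (intro haar_intros)
    also have "\<dots> = 0" by (simp add: null clinear_coordinate)
    finally show ?thesis .
  qed
  have null: "h (x * a) = 0" for x
    using haar_cauchy_schwarz_zero[OF assms, of "star x"] by (simp add: star_star)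
  show ?thesis
  proof (rule eq_functionalsI)
    fix f :: "'a \<Rightarrow> complex" assume f: "clinear f"
    \<comment> \<open>The radical is stable, so \<epsilon> vanishes on f \<triangleright> a as well;
      but that value is f(a), for an arbitrary functional f.\<close>
    have "h (x * convolve H f a) = 0" for x
      using haar_convolve_adjoint[OF f, of "star x" a] null by (simp add: star_star)
    from eps[OF this] show "f a = f 0" by (simp add: counit_convolve[OF f] clinear_zero[OF f])
  qed
qed

section \<open>Orthonormal bases for the Haar form\<close>

definition orthonormal :: "(nat \<Rightarrow> 'a) \<Rightarrow> nat \<Rightarrow> bool" where
  "orthonormal e n \<longleftrightarrow> (\<forall>i<n. \<forall>j<n. h (star (e i) * e j) = (if i = j then 1 else 0))"

lemma clinear_haar_left: "clinear (\<lambda>x. h (b * x))"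
  by (intro haar_intros)

lemma haar_sum_right: "h (b * (\<Sum>i\<in>J. c i *\<^sub>C x i)) = (\<Sum>i\<in>J. c i * h (b * x i))"
  by (simp add: clinear_sum[OF clinear_haar_left] clinear_scale[OF clinear_haar_left])

lemma orthonormal_coefficient:
  assumes "orthonormal e n" "i < n" shows "h (star (e i) * (\<Sum>j<n. c j *\<^sub>C e j)) = c i"
proof -
  have "h (star (e i) * (\<Sum>j<n. c j *\<^sub>C e j)) = (\<Sum>j<n. c j * (if i = j then 1 else 0))"
    unfolding haar_sum_right using assms by (intro sum.cong) (auto simp: orthonormal_def)
  also have "\<dots> = c i" using assms(2) by (simp add: if_distrib[of "(*) _"] cong: if_cong)
  finally show ?thesis .
qed

lemma orthonormal_expansion:
  assumes e: "orthonormal e n" and x: "x \<in> cspan (e ` {..<n})"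
  shows "x = (\<Sum>i<n. h (star (e i) * x) *\<^sub>C e i)"
proof -
  have "cspan (e ` {..<n}) \<subseteq> {x. x = (\<Sum>i<n. h (star (e i) * x) *\<^sub>C e i)}"
  proof (rule complex_vector.span_minimal)
    show "e ` {..<n} \<subseteq> {x. x = (\<Sum>i<n. h (star (e i) * x) *\<^sub>C e i)}"
    proof clarify
      fix j assume "j < n"
      then have "(\<Sum>i<n. h (star (e i) * e j) *\<^sub>C e i) = (\<Sum>i<n. if i = j then e i else 0)"
        using e by (intro sum.cong) (auto simp: orthonormal_def scaleC_one)
      with \<open>j < n\<close> show "e j = (\<Sum>i<n. h (star (e i) * e j) *\<^sub>C e i)" by simp
    qed
    have lin: "clinear (\<lambda>x. (\<Sum>i<n. h (star (e i) * x) *\<^sub>C e i))"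
      by (intro clinear_sum_fun haar_intros)
    show "csubspace {x. x = (\<Sum>i<n. h (star (e i) * x) *\<^sub>C e i)}"
      using clinear_add[OF lin] clinear_scale[OF lin] clinear_zero[OF lin]
      by (auto simp: complex_vector.subspace_def)
  qed
  with x show ?thesis by blast
qed

text \<open>Gram-Schmidt. A vector with zero residue is dropped, so e may be shorter than B; any
  other residue has positive square norm by faithfulness and can be normalised.\<close>

lemma orthonormal_extend:
  assumes "finite B"
  shows "\<exists>e n. orthonormal e n \<and> (\<forall>i<n. e i \<in> cspan B) \<and> B \<subseteq> cspan (e ` {..<n})"
  using assms
proof (induction B)
  case empty
  show ?case by (intro exI[of _ "\<lambda>_. 0"] exI[of _ 0]) (simp add: orthonormal_def)
next
  case (insert b B)
  then obtain e n where e: "orthonormal e n" "\<And>i. i < n \<Longrightarrow> e i \<in> cspan B" "B \<subseteq> cspan (e ` {..<n})"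
    by blast
  have mono: "cspan B \<subseteq> cspan (insert b B)" by (rule complex_vector.span_mono) blast
  define p where "p = (\<Sum>i<n. h (star (e i) * b) *\<^sub>C e i)"
  have p: "p \<in> cspan (e ` {..<n})"
    unfolding p_def by (intro complex_vector.span_sum complex_vector.span_scale complex_vector.span_base) auto
  define b' where "b' = b - p"
  show ?case
  proof (cases "b' = 0")
    case True
    then have "b \<in> cspan (e ` {..<n})" using p by (simp add: b'_def)
    with e mono show ?thesis by blast
  next
    case False
    define r where "r = Re (h (star b' * b'))"
    have r: "h (star b' * b') = complex_of_real r"
      using haar_real[of b'] by (simp add: r_def complex_is_Real_iff complex_eq_iff)
    have "r \<noteq> 0" using haar_faithful[of b'] False by (auto simp: r)
    then have "r > 0" using haar_nonneg[of b'] by (simp add: r_def)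
    define c where "c = complex_of_real (1 / sqrt r)"
    have c: "cnj c = c" "c * (c * of_real r) = 1" "c \<noteq> 0"
      using \<open>r > 0\<close> by (simp_all add: c_def of_real_mult[symmetric] del: of_real_mult of_real_divide)
    define e' where "e' = e(n := c *\<^sub>C b')"
    have orth: "h (star (e i) * b') = 0" if "i < n" for i
      using orthonormal_coefficient[OF e(1) that, of "\<lambda>i. h (star (e i) * b)"]
      by (simp add: b'_def p_def[symmetric] clinear_diff[OF clinear_haar_left])
    then have orth': "h (star b' * e i) = 0" if "i < n" for i
      using that haar_hermitian[of b' "e i"] by simp
    have "orthonormal e' (Suc n)"
      using e(1) orth orth' c
      by (auto simp: orthonormal_def e'_def less_Suc_eq star_scaleC mult_scaleC_left mult_scaleC_right
          scaleC_scaleC clinear_scale[OF clinear_haar] r)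
    moreover have "e' i \<in> cspan (insert b B)" if "i < Suc n" for i
    proof -
      have "p \<in> cspan (insert b B)"
        unfolding p_def using e(2) mono
        by (intro complex_vector.span_sum complex_vector.span_scale) auto
      then have "b' \<in> cspan (insert b B)"
        unfolding b'_def by (intro complex_vector.span_diff) (auto intro: complex_vector.span_base)
      with that e(2) mono show ?thesis
        by (auto simp: e'_def less_Suc_eq intro: complex_vector.span_scale)
    qed
    moreover have "insert b B \<subseteq> cspan (e' ` {..<Suc n})"
    proof -
      have "e ` {..<n} \<subseteq> e' ` {..<Suc n}"
        by (auto simp: e'_def image_iff less_Suc_eq intro!: bexI)
      then have sub: "cspan (e ` {..<n}) \<subseteq> cspan (e' ` {..<Suc n})" by (rule complex_vector.span_mono)
      have "b' = (1 / c) *\<^sub>C e' n" using c by (simp add: e'_def scaleC_scaleC scaleC_one)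
      also have "\<dots> \<in> cspan (e' ` {..<Suc n})"
        by (intro complex_vector.span_scale complex_vector.span_base) auto
      finally have "b' + p \<in> cspan (e' ` {..<Suc n})"
        using p sub by (intro complex_vector.span_add) auto
      with e(3) sub show ?thesis by (auto simp: b'_def)
    qed
    ultimately show ?thesis by blast
  qed
qed

lemma orthonormal_basis:
  assumes V: "csubspace V" and B: "finite B" "V \<subseteq> cspan B"
  obtains e n where "orthonormal e n" "\<And>i. i < n \<Longrightarrow> e i \<in> V"
    "\<And>x. x \<in> V \<Longrightarrow> x = (\<Sum>i<n. h (star (e i) * x) *\<^sub>C e i)"
proof -
  obtain C where C: "C \<subseteq> V" "complex_vector.independent C" "V \<subseteq> cspan C"
    by (rule complex_vector.maximal_independent_subset[of V]) blast
  have "finite C" using complex_vector.independent_span_bound[OF B(1) C(2)] C(1) B(2) by blast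
  then obtain e n where e: "orthonormal e n" "\<And>i. i < n \<Longrightarrow> e i \<in> cspan C" "C \<subseteq> cspan (e ` {..<n})"
    using orthonormal_extend by blast
  have CV: "cspan C \<subseteq> V" using C(1) V by (rule complex_vector.span_minimal)
  have "V \<subseteq> cspan (e ` {..<n})"
    using C(3) e(3) complex_vector.span_minimal[OF e(3)] by (auto intro: complex_vector.subspace_span)
  with e CV show ?thesis by (intro that[of e n]) (auto intro: orthonormal_expansion)
qed

text \<open>The size of a finite spanning set serves as induction measure in place of a dimension. A
  basis C of U together with a vector of V outside U is independent in the span of B, so C has
  strictly fewer elements than B.\<close>

lemma proper_subspace_smaller_span:
  fixes U :: "'b::complex_vector set"
  assumes U: "csubspace U" and B: "finite B" "V \<subseteq> cspan B" and sub: "U \<subset> V"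
  obtains C where "finite C" "card C < card B" "U \<subseteq> cspan C"
proof -
  obtain C where C: "C \<subseteq> U" "complex_vector.independent C" "U \<subseteq> cspan C"
    by (rule complex_vector.maximal_independent_subset[of U]) blast
  obtain v where v: "v \<in> V" "v \<notin> U" using sub by blast
  have "v \<notin> cspan C" using v(2) complex_vector.span_minimal[OF C(1) U] by blast
  then have ind: "complex_vector.independent (insert v C)"
    using C(2) by (rule complex_vector.independent_insertI)
  have "insert v C \<subseteq> cspan B" using C(1) sub v(1) B(2) by blast
  from complex_vector.independent_span_bound[OF B(1) ind this]
  have fin: "finite (insert v C)" and card: "card (insert v C) \<le> card B" by auto
  moreover have "v \<notin> C" using \<open>v \<notin> cspan C\<close> complex_vector.span_base by blast
  ultimately show ?thesis using C(3) by (intro that[of C]) auto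
qed

end

section \<open>The Peter--Weyl decomposition\<close>

lemma adjoint_mult_entry:
  assumes "v \<in> carrier_mat n n" "i < n" "j < n"
  shows "(adjoint_mat v * v) $$ (i, j) = (\<Sum>k<n. star (v $$ (k, i)) * v $$ (k, j))"
    and "(v * adjoint_mat v) $$ (i, j) = (\<Sum>k<n. v $$ (i, k) * star (v $$ (j, k)))"
  using assms by (auto simp: adjoint_mat_def scalar_prod_def atLeast0LessThan intro!: sum.cong)

context star_hopf
begin

text \<open>The antipode axiom makes the matrix S(v) a right inverse of v, and \<open>iso\<close>
  makes the adjoint of v a left inverse; hence the two agree.\<close>

lemma corepresentation_antipode:
  assumes v: "corepresentation H v" "v \<in> carrier_mat n n"
    and iso: "\<And>i j. i < n \<Longrightarrow> j < n \<Longrightarrow>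
      (\<Sum>k<n. star (v $$ (k, i)) * v $$ (k, j)) = (if i = j then 1 else 0)"
    and ij: "i < n" "j < n"
  shows "\<S> (v $$ (i, j)) = star (v $$ (j, i))"
proof -
  have dim: "dim_row v = n" using v(2) by simp
  have \<Delta>: "\<Delta> (v $$ (i, j)) = (\<Sum>k<n. v $$ (i, k) \<otimes>\<^sub>C v $$ (k, j))"
    and \<epsilon>: "\<epsilon> (v $$ (i, j)) = (if i = j then 1 else 0)" if "i < n" "j < n" for i j
    using v(1) that dim by (auto simp: corepresentation_def)
  have right: "(\<Sum>k<n. v $$ (l, k) * \<S> (v $$ (k, j))) = (if l = j then 1 else 0)" if "l < n" for l
  proof -
    have "(\<Sum>k<n. v $$ (l, k) * \<S> (v $$ (k, j))) = sw (\<lambda>x y. x * \<S> y) (v $$ (l, j))"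
      by (rule sw_eqI[symmetric]) (use \<Delta>[OF that ij(2)] in \<open>auto intro!: sw_intros\<close>)
    then show ?thesis using \<epsilon>[OF that ij(2)] by (simp add: sw_antipode_right scaleC_one)
  qed
  have "\<S> (v $$ (i, j)) = (\<Sum>k<n. (if i = k then 1 else 0) * \<S> (v $$ (k, j)))"
    using ij(1) by (simp add: if_distrib[of "\<lambda>x. x * _"] cong: if_cong)
  also have "\<dots> = (\<Sum>k<n. (\<Sum>l<n. star (v $$ (l, i)) * v $$ (l, k)) * \<S> (v $$ (k, j)))"
    using ij(1) by (intro sum.cong) (simp_all add: iso)
  also have "\<dots> = (\<Sum>l<n. star (v $$ (l, i)) * (\<Sum>k<n. v $$ (l, k) * \<S> (v $$ (k, j))))"
    by (simp add: sum_distrib_left sum_distrib_right mult.assoc) (rule sum.swap)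
  also have "\<dots> = (\<Sum>l<n. star (v $$ (l, i)) * (if l = j then 1 else 0))"
    by (intro sum.cong) (simp_all add: right)
  also have "\<dots> = star (v $$ (j, i))"
    using ij(2) by (simp add: if_distrib[of "(*) _"] cong: if_cong)
  finally show ?thesis .
qed

text \<open>Over a noncommutative algebra a left inverse need not be a right inverse. Here it is
  one, because the adjoint equals S(v), which inverts v on the right.\<close>

lemma unitary_corepresentationI:
  assumes v: "corepresentation H v" "v \<in> carrier_mat n n"
    and iso: "\<And>i j. i < n \<Longrightarrow> j < n \<Longrightarrow>
      (\<Sum>k<n. star (v $$ (k, i)) * v $$ (k, j)) = (if i = j then 1 else 0)"
  shows "unitary_corepresentation H v"
proof -
  have dim: "dim_row v = n" "dim_col v = n" using v(2) by auto
  have adj: "adjoint_mat v \<in> carrier_mat n n" using v(2) by (auto simp: adjoint_mat_def)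
  have "(\<Sum>k<n. v $$ (i, k) * star (v $$ (j, k))) = (if i = j then 1 else 0)" if "i < n" "j < n" for i j
  proof -
    have "(\<Sum>k<n. v $$ (i, k) * star (v $$ (j, k))) = (\<Sum>k<n. v $$ (i, k) * \<S> (v $$ (k, j)))"
      using that by (intro sum.cong) (simp_all add: corepresentation_antipode[OF v iso])
    also have "\<dots> = sw (\<lambda>x y. x * \<S> y) (v $$ (i, j))"
      by (rule sw_eqI[symmetric])
        (use v(1) that dim in \<open>auto simp: corepresentation_def intro!: sw_intros\<close>)
    also have "\<dots> = (if i = j then 1 else 0)"
      using v(1) that dim by (simp add: sw_antipode_right corepresentation_def scaleC_one)
    finally show ?thesis .
  qed
  then show ?thesis
    unfolding unitary_corepresentation_def dim using v adj
    by (auto intro!: eq_matI simp: adjoint_mult_entry[OF v(2)] iso simp del: index_mult_mat(1))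
qed

lemma unitary_corepresentationD:
  assumes u: "unitary_corepresentation H u" and n: "n = dim_row u" and ij: "i < n" "j < n"
  shows "\<Delta> (u $$ (i, j)) = (\<Sum>k<n. u $$ (i, k) \<otimes>\<^sub>C u $$ (k, j))"
    and "\<epsilon> (u $$ (i, j)) = (if i = j then 1 else 0)"
    and "(\<Sum>k<n. star (u $$ (k, i)) * u $$ (k, j)) = (if i = j then 1 else 0)"
    and "(\<Sum>k<n. u $$ (i, k) * star (u $$ (j, k))) = (if i = j then 1 else 0)"
    and "\<S> (u $$ (i, j)) = star (u $$ (j, i))"
proof -
  have c: "corepresentation H u" and mult: "adjoint_mat u * u = 1\<^sub>m n" "u * adjoint_mat u = 1\<^sub>m n"
    using u n by (auto simp: unitary_corepresentation_def)
  have carrier: "u \<in> carrier_mat n n" using c n by (auto simp: corepresentation_def)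
  show "\<Delta> (u $$ (i, j)) = (\<Sum>k<n. u $$ (i, k) \<otimes>\<^sub>C u $$ (k, j))"
    "\<epsilon> (u $$ (i, j)) = (if i = j then 1 else 0)"
    using c n ij by (auto simp: corepresentation_def)
  have iso: "(\<Sum>k<n. star (u $$ (k, i)) * u $$ (k, j)) = (if i = j then 1 else 0)"
    if "i < n" "j < n" for i j
    using adjoint_mult_entry(1)[OF carrier that] that by (simp add: mult)
  then show "(\<Sum>k<n. star (u $$ (k, i)) * u $$ (k, j)) = (if i = j then 1 else 0)" using ij .
  show "(\<Sum>k<n. u $$ (i, k) * star (u $$ (j, k))) = (if i = j then 1 else 0)"
    using adjoint_mult_entry(2)[OF carrier ij] ij by (simp add: mult)
  show "\<S> (u $$ (i, j)) = star (u $$ (j, i))"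
    by (rule corepresentation_antipode[OF c carrier iso ij])
qed

text \<open>A subspace stable under all operators \<open>f \<triangleright>\<close> is a right subcomodule of \<open>A\<close>.\<close>

definition stable :: "'a set \<Rightarrow> bool" where
  "stable V \<longleftrightarrow> csubspace V \<and> (\<forall>(f :: 'a \<Rightarrow> complex) x. clinear f \<longrightarrow> x \<in> V \<longrightarrow> convolve H f x \<in> V)"

text \<open>\<open>tensor_star\<close> is computed on one chosen representative; an arbitrary
  decomposition of \<Delta> a is reached through slices, which do not see the
  representative.\<close>

lemma comult_star_sum:
  assumes "\<Delta> a = (\<Sum>i\<in>J. x i \<otimes>\<^sub>C y i)"
  shows "\<Delta> (star a) = (\<Sum>i\<in>J. star (x i) \<otimes>\<^sub>C star (y i))"
proof (rule tensor_eq_slicesI)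
  fix f :: "'a \<Rightarrow> complex" assume f: "clinear f"
  have "slice f (\<Delta> (star a)) = sw (\<lambda>x y. f (star y) *\<^sub>C star x) a"
    unfolding convolve_slice[symmetric] convolve_sw[OF f]
    by (rule sw_star) (intro sw_intros f)
  also have "\<dots> = star (sw (\<lambda>x y. cnj (f (star y)) *\<^sub>C x) a)"
    by (simp add: star_sw star_scaleC)
  also have "sw (\<lambda>x y. cnj (f (star y)) *\<^sub>C x) a = (\<Sum>i\<in>J. cnj (f (star (y i))) *\<^sub>C x i)"
    by (rule sw_eqI[OF _ assms]) (intro sw_intros clinear_cnj_cnj f)
  also have "star \<dots> = slice f (\<Sum>i\<in>J. star (x i) \<otimes>\<^sub>C star (y i))"
    by (simp add: star_sum star_scaleC clinear_sum[OF clinear_slice[OF f]] slice_tensor[OF f])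
  finally show "slice f (\<Delta> (star a)) = slice f (\<Sum>i\<in>J. star (x i) \<otimes>\<^sub>C star (y i))" .
qed

text \<open>Local finiteness of comodules: every f \<triangleright> a is a combination of the left
  legs of one finite representative of \<Delta> a. Stability is closure of the functionals under the
  product of the dual, and f = \<epsilon> returns a.\<close>

lemma stable_orbit:
  fixes a :: 'a
  defines "V \<equiv> {convolve H f a | f. clinear f}"
  shows "stable V" "a \<in> V" "\<exists>B. finite B \<and> V \<subseteq> cspan B"
proof -
  have add: "convolve H f a + convolve H g a = convolve H (\<lambda>x. f x + g x) a"
    if "clinear f" "clinear g" for f g
    using that by (simp add: convolve_sw clinear_plus) (simp add: sw_def scaleC_add_left sum.distrib)
  have scale: "c *\<^sub>C convolve H f a = convolve H (\<lambda>x. c * f x) a" if "clinear f" for f c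
    using that by (simp add: convolve_sw clinear_const_cmult sw_scaleC[symmetric] scaleC_scaleC)
  have zero: "convolve H (\<lambda>_. 0) a = 0"
    by (subst convolve_sw) (auto intro: clinearI simp: sw_def)
  show "stable V"
    unfolding stable_def complex_vector.subspace_def
  proof (intro conjI allI ballI impI)
    have "clinear (\<lambda>_ :: 'a. 0 :: complex)" by (rule clinearI) simp_all
    then show "0 \<in> V" unfolding V_def by (metis (mono_tags, lifting) mem_Collect_eq zero)
  next
    fix x y assume "x \<in> V" "y \<in> V"
    then show "x + y \<in> V" unfolding V_def using add clinear_plus by blast
  next
    fix c x assume "x \<in> V"
    then show "c *\<^sub>C x \<in> V" unfolding V_def using scale clinear_const_cmult by blast
  next
    fix f :: "'a \<Rightarrow> complex" and x assume f: "clinear f" and "x \<in> V"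
    then obtain g where g: "clinear g" "x = convolve H g a" unfolding V_def by blast
    have "clinear (\<lambda>a. sw (\<lambda>x y. f x * g y) a)" by (intro sw_intros f g(1))
    then show "convolve H f x \<in> V"
      unfolding V_def g(2) convolve_convolve[OF f g(1)] by blast
  qed
  show "a \<in> V" unfolding V_def using convolve_counit[of a] clinear_counit by (metis (mono_tags, lifting) mem_Collect_eq)
  show "\<exists>B. finite B \<and> V \<subseteq> cspan B"
  proof (intro exI conjI)
    let ?t = "rep_tensor (\<Delta> a)"
    let ?B = "(\<lambda>k. Poly_Mapping.lookup ?t k *\<^sub>C fst k) ` Poly_Mapping.keys ?t"
    show "finite ?B" by simp
    have "convolve H f a \<in> cspan ?B" if "clinear f" for f
      unfolding convolve_sw[OF that] sw_def
      by (intro complex_vector.span_sum complex_vector.span_scale complex_vector.span_base imageI)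
    then show "V \<subseteq> cspan ?B" unfolding V_def by blast
  qed
qed

end

context haar_hopf
begin

lemma stable_orthogonal:
  assumes V: "stable V" and W: "stable W"
  shows "stable {x \<in> V. \<forall>w\<in>W. h (star w * x) = 0}"
  unfolding stable_def
proof (intro conjI allI impI)
  show "csubspace {x \<in> V. \<forall>w\<in>W. h (star w * x) = 0}"
    using V by (auto simp: stable_def complex_vector.subspace_def clinear_add[OF clinear_haar_left]
        clinear_scale[OF clinear_haar_left] clinear_zero[OF clinear_haar])
  fix f :: "'a \<Rightarrow> complex" and x assume f: "clinear f" and x: "x \<in> {x \<in> V. \<forall>w\<in>W. h (star w * x) = 0}"
  then show "convolve H f x \<in> {x \<in> V. \<forall>w\<in>W. h (star w * x) = 0}"
    using V W clinear_dual_star[OF f] by (auto simp: stable_def haar_convolve_adjoint)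
qed

end

section \<open>The corepresentation carried by an irreducible stable subspace\<close>

locale irreducible_comodule = haar_hopf +
  fixes V :: "'a set" and e :: "nat \<Rightarrow> 'a" and n :: nat
  assumes V: "stable V"
    and irreducible: "\<And>W. stable W \<Longrightarrow> W \<subseteq> V \<Longrightarrow> W = {0} \<or> W = V"
    and nontrivial: "V \<noteq> {0}"
    and orthonormal: "orthonormal e n"
    and e_mem: "\<And>i. i < n \<Longrightarrow> e i \<in> V"
    and e_expansion: "\<And>x. x \<in> V \<Longrightarrow> x = (\<Sum>i<n. h (star (e i) * x) *\<^sub>C e i)"
begin

text \<open>The matrix of the coaction on V: pairing the left leg of \<Delta>(e_j) with e_i leaves
  v_ij, so that \<Delta>(e_j) is the sum of the e_i \<otimes> v_ij
  (\<open>comult_e\<close>).\<close>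

definition v :: "'a mat" where
  "v = mat n n (\<lambda>(i, j). sw (\<lambda>x y. h (star (e i) * x) *\<^sub>C y) (e j))"

lemma v_carrier: "v \<in> carrier_mat n n"
  by (simp add: v_def)

lemma v_functional:
  assumes "clinear f" "i < n" "j < n"
  shows "h (star (e i) * convolve H f (e j)) = f (v $$ (i, j))"
  using assms by (simp add: v_def convolve_sw sw_mult_left[symmetric] mult_scaleC_right
      sw_apply[OF clinear_haar, symmetric] clinear_scale[OF clinear_haar]
      sw_apply[OF assms(1), symmetric] clinear_scale[OF assms(1)] mult.commute)

lemma convolve_e:
  assumes f: "clinear f" and j: "j < n"
  shows "convolve H f (e j) = (\<Sum>i<n. f (v $$ (i, j)) *\<^sub>C e i)"
proof -
  have "convolve H f (e j) \<in> V" using V f e_mem[OF j] by (simp add: stable_def)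
  from e_expansion[OF this] show ?thesis
    by (rule trans) (use assms in \<open>auto intro!: sum.cong simp: v_functional\<close>)
qed

lemma comult_e:
  assumes "j < n" shows "\<Delta> (e j) = (\<Sum>i<n. e i \<otimes>\<^sub>C v $$ (i, j))"
proof (rule tensor_eq_slicesI)
  fix f :: "'a \<Rightarrow> complex" assume "clinear f"
  then show "slice f (\<Delta> (e j)) = slice f (\<Sum>i<n. e i \<otimes>\<^sub>C v $$ (i, j))"
    using convolve_e[OF _ assms, of f]
    by (simp add: convolve_slice clinear_sum[OF clinear_slice] slice_tensor)
qed

text \<open>By \<open>convolve_e\<close> the operator f \<triangleright> on V has the matrix
  f(v_ij). Composing operators is convolving functionals, so the product of the matrices of g and f
  is the coproduct formula, tested by g on the left leg and f on the right.\<close>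

lemma corepresentation_v: "corepresentation H v"
proof -
  have comult: "\<Delta> (v $$ (i, j)) = (\<Sum>k<n. v $$ (i, k) \<otimes>\<^sub>C v $$ (k, j))" if ij: "i < n" "j < n" for i j
  proof (rule tensor_eq_slicesI)
    fix f :: "'a \<Rightarrow> complex" assume f: "clinear f"
    have "convolve H f (v $$ (i, j)) = (\<Sum>k<n. f (v $$ (k, j)) *\<^sub>C v $$ (i, k))"
    proof (rule eq_functionalsI)
      fix g :: "'a \<Rightarrow> complex" assume g: "clinear g"
      have gf: "clinear (\<lambda>a. sw (\<lambda>x y. g x * f y) a)" by (intro sw_intros f g)
      have "g (convolve H f (v $$ (i, j))) = sw (\<lambda>x y. g x * f y) (v $$ (i, j))"
        by (simp add: convolve_sw[OF f] sw_apply[OF g, symmetric] clinear_scale[OF g] mult.commute)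
      also have "\<dots> = h (star (e i) * convolve H g (convolve H f (e j)))"
        unfolding convolve_convolve[OF g f] by (rule v_functional[OF gf ij, symmetric])
      also have "convolve H g (convolve H f (e j)) = (\<Sum>k<n. f (v $$ (k, j)) *\<^sub>C convolve H g (e k))"
        by (simp add: convolve_e[OF f ij(2)] clinear_sum[OF clinear_convolve[OF g]]
            clinear_scale[OF clinear_convolve[OF g]])
      also have "h (star (e i) * \<dots>) = (\<Sum>k<n. f (v $$ (k, j)) * g (v $$ (i, k)))"
        unfolding haar_sum_right using ij(1) by (intro sum.cong) (simp_all add: v_functional[OF g])
      also have "\<dots> = g (\<Sum>k<n. f (v $$ (k, j)) *\<^sub>C v $$ (i, k))"
        by (simp add: clinear_sum[OF g] clinear_scale[OF g])
      finally show "g (convolve H f (v $$ (i, j))) = g (\<Sum>k<n. f (v $$ (k, j)) *\<^sub>C v $$ (i, k))" .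
    qed
    then show "slice f (\<Delta> (v $$ (i, j))) = slice f (\<Sum>k<n. v $$ (i, k) \<otimes>\<^sub>C v $$ (k, j))"
      by (simp add: convolve_slice clinear_sum[OF clinear_slice[OF f]] slice_tensor[OF f])
  qed
  have counit: "\<epsilon> (v $$ (i, j)) = (if i = j then 1 else 0)" if ij: "i < n" "j < n" for i j
    using v_functional[OF clinear_counit ij] orthonormal ij by (simp add: convolve_counit orthonormal_def)
  show ?thesis
    using v_carrier comult counit by (auto simp: corepresentation_def)
qed

text \<open>Apply invariance of h to star e_i e_j: orthonormality of the left legs collapses the
  double sum to an entry of the adjoint of v times v.\<close>

lemma unitary_v: "unitary_corepresentation H v"
proof (rule unitary_corepresentationI[OF corepresentation_v v_carrier])
  fix i j assume ij: "i < n" "j < n"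
  have "h (star (e i) * e j) *\<^sub>C 1 = sw (\<lambda>x y. h x *\<^sub>C y) (star (e i) * e j)"
    by (simp add: sw_haar_left)
  also have "\<dots> = sw (\<lambda>x y. sw (\<lambda>p q. h (x * p) *\<^sub>C (y * q)) (e j)) (star (e i))"
    by (rule sw_comult_mult) (intro haar_intros)
  also have "\<dots> = (\<Sum>k<n. sw (\<lambda>p q. h (star (e k) * p) *\<^sub>C (star (v $$ (k, i)) * q)) (e j))"
    by (rule sw_eqI[OF _ comult_star_sum[OF comult_e[OF ij(1)]]]) (intro haar_intros)
  also have "\<dots> = (\<Sum>k<n. \<Sum>l<n. h (star (e k) * e l) *\<^sub>C (star (v $$ (k, i)) * v $$ (l, j)))"
    by (intro sum.cong refl sw_eqI[OF _ comult_e[OF ij(2)]] haar_intros)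
  also have "\<dots> = (\<Sum>k<n. \<Sum>l<n. if k = l then star (v $$ (k, i)) * v $$ (l, j) else 0)"
    using orthonormal by (intro sum.cong) (auto simp: orthonormal_def scaleC_one)
  also have "\<dots> = (\<Sum>k<n. star (v $$ (k, i)) * v $$ (k, j))"
    by (intro sum.cong) simp_all
  finally show "(\<Sum>k<n. star (v $$ (k, i)) * v $$ (k, j)) = (if i = j then 1 else 0)"
    using orthonormal ij by (simp add: orthonormal_def scaleC_one split: if_splits)
qed

lemma irreducible_v: "irreducible_corepresentation H v"
  unfolding irreducible_corepresentation_def
proof (intro conjI allI impI)
  have dim: "dim_row v = n" using v_carrier by simp
  show "corepresentation H v" by (rule corepresentation_v)
  show "0 < dim_row v"
  proof (rule ccontr)
    assume "\<not> 0 < dim_row v"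
    then have "n = 0" using dim by simp
    then have "V \<subseteq> {0}" using e_expansion by auto
    then show False using nontrivial V complex_vector.subspace_0 by (fastforce simp: stable_def)
  qed
  fix W assume inv: "invariant_subspace v W"
  then have W: "W \<subseteq> carrier_vec n" "0\<^sub>v n \<in> W" "\<And>x y. x \<in> W \<Longrightarrow> y \<in> W \<Longrightarrow> x + y \<in> W"
    "\<And>c x. x \<in> W \<Longrightarrow> c \<cdot>\<^sub>v x \<in> W"
    by (auto simp: invariant_subspace_def dim)
  \<comment> \<open>Coordinates identify column vectors with V. Under \<open>\<Phi>\<close> an
    invariant subspace becomes a stable one, to which the irreducibility of V applies.\<close>
  define \<Phi> where "\<Phi> w = (\<Sum>i<n. (w $ i) *\<^sub>C e i)" for w :: "complex vec"
  have coef: "h (star (e i) * \<Phi> w) = w $ i" if "i < n" for w i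
    unfolding \<Phi>_def by (rule orthonormal_coefficient[OF orthonormal that])
  have inj: "w = w'" if "\<Phi> w = \<Phi> w'" "w \<in> carrier_vec n" "w' \<in> carrier_vec n" for w w'
    using that coef by (intro eq_vecI) (metis carrier_vecD, auto)
  have \<Phi>_add: "\<Phi> (x + y) = \<Phi> x + \<Phi> y" if "x \<in> carrier_vec n" "y \<in> carrier_vec n" for x y
    using that by (simp add: \<Phi>_def scaleC_add_left sum.distrib)
  have \<Phi>_scale: "\<Phi> (c \<cdot>\<^sub>v x) = c *\<^sub>C \<Phi> x" if "x \<in> carrier_vec n" for c x
    using that by (simp add: \<Phi>_def complex_vector.scale_sum_right scaleC_scaleC)
  have \<Phi>_zero: "\<Phi> (0\<^sub>v n) = 0" by (simp add: \<Phi>_def)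
  have \<Phi>_V: "\<Phi> w \<in> V" for w
    unfolding \<Phi>_def using V e_mem
    by (intro complex_vector.subspace_sum complex_vector.subspace_scale) (auto simp: stable_def)
  have sub: "csubspace (\<Phi> ` W)"
    unfolding complex_vector.subspace_def
  proof (intro conjI ballI allI)
    show "0 \<in> \<Phi> ` W" using W(2) \<Phi>_zero by force
    show "x + y \<in> \<Phi> ` W" if "x \<in> \<Phi> ` W" "y \<in> \<Phi> ` W" for x y
    proof -
      obtain a b where "a \<in> W" "b \<in> W" "x = \<Phi> a" "y = \<Phi> b" using \<open>x \<in> \<Phi> ` W\<close> \<open>y \<in> \<Phi> ` W\<close> by blast
      then have "x + y = \<Phi> (a + b)" using W(1) by (subst \<Phi>_add) auto
      with W(3) \<open>a \<in> W\<close> \<open>b \<in> W\<close> show ?thesis by blast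
    qed
    show "c *\<^sub>C x \<in> \<Phi> ` W" if "x \<in> \<Phi> ` W" for c x
    proof -
      obtain a where "a \<in> W" "x = \<Phi> a" using \<open>x \<in> \<Phi> ` W\<close> by blast
      then have "c *\<^sub>C x = \<Phi> (c \<cdot>\<^sub>v a)" using W(1) by (subst \<Phi>_scale) auto
      with W(4) \<open>a \<in> W\<close> show ?thesis by blast
    qed
  qed
  have "stable (\<Phi> ` W)"
    unfolding stable_def
  proof (intro conjI allI impI sub)
    fix f :: "'a \<Rightarrow> complex" and x assume f: "clinear f" and "x \<in> \<Phi> ` W"
    then obtain w where w: "w \<in> W" "x = \<Phi> w" by blast
    \<comment> \<open>The functional f hits only the coefficients a_l, so f \<triangleright>
      \<Phi>(w) is a combination of the \<Phi>(y_l) and stays in the image of W.\<close>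
    obtain m and y :: "nat \<Rightarrow> complex vec" and a :: "nat \<Rightarrow> 'a" where y: "\<And>l. l < m \<Longrightarrow> y l \<in> W"
      and eq: "\<And>i. i < n \<Longrightarrow> (\<Sum>j<n. (w $ j) *\<^sub>C v $$ (i, j)) = (\<Sum>l<m. (y l $ i) *\<^sub>C a l)"
      using inv w(1) unfolding invariant_subspace_def dim by blast
    have "convolve H f x = (\<Sum>j<n. \<Sum>i<n. (w $ j * f (v $$ (i, j))) *\<^sub>C e i)"
      unfolding w(2) \<Phi>_def
      by (simp add: clinear_sum[OF clinear_convolve[OF f]] clinear_scale[OF clinear_convolve[OF f]]
          convolve_e[OF f] complex_vector.scale_sum_right scaleC_scaleC)
    also have "\<dots> = (\<Sum>i<n. f (\<Sum>j<n. (w $ j) *\<^sub>C v $$ (i, j)) *\<^sub>C e i)"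
      by (subst sum.swap) (simp add: clinear_sum[OF f] clinear_scale[OF f] sum_scaleC_left[symmetric])
    also have "\<dots> = (\<Sum>i<n. f (\<Sum>l<m. (y l $ i) *\<^sub>C a l) *\<^sub>C e i)"
      by (intro sum.cong) (simp_all add: eq)
    also have "\<dots> = (\<Sum>l<m. f (a l) *\<^sub>C \<Phi> (y l))"
      by (simp add: clinear_sum[OF f] clinear_scale[OF f] sum_scaleC_left[symmetric] \<Phi>_def
          complex_vector.scale_sum_right scaleC_scaleC mult.commute) (rule sum.swap)
    also have "\<dots> \<in> \<Phi> ` W"
      using sub y by (intro complex_vector.subspace_sum complex_vector.subspace_scale) auto
    finally show "convolve H f x \<in> \<Phi> ` W" .
  qed
  then consider "\<Phi> ` W = {0}" | "\<Phi> ` W = V" using irreducible[of "\<Phi> ` W"] \<Phi>_V by blast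
  then have "W = {0\<^sub>v n} \<or> W = carrier_vec n"
  proof cases
    case 1
    then have "w = 0\<^sub>v n" if "w \<in> W" for w
      using that W(1) by (intro inj) (auto simp: \<Phi>_zero)
    then show ?thesis using W(2) by blast
  next
    case 2
    have "w \<in> W" if w: "w \<in> carrier_vec n" for w
    proof -
      from \<Phi>_V[of w] 2 obtain w' where w': "w' \<in> W" "\<Phi> w = \<Phi> w'" by blast
      with W(1) w have "w = w'" by (intro inj) auto
      with w' show ?thesis by simp
    qed
    then show ?thesis using W(1) by blast
  qed
  then show "W = {0\<^sub>v (dim_row v)} \<or> W = carrier_vec (dim_row v)" by (simp add: dim)
qed

text \<open>The counit on the left leg of \<Delta>(e_j) writes e_j as the sum of the \<epsilon>(e_i)
  v_ij, so V lies in the span of its own matrix coefficients.\<close>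

lemma V_subset:
  assumes M: "csubspace M" and entries: "\<And>i j. i < n \<Longrightarrow> j < n \<Longrightarrow> v $$ (i, j) \<in> M"
  shows "V \<subseteq> M"
proof
  fix x assume "x \<in> V"
  then have "x = (\<Sum>i<n. h (star (e i) * x) *\<^sub>C e i)" by (rule e_expansion)
  also have "\<dots> \<in> M"
  proof (intro complex_vector.subspace_sum[OF M] complex_vector.subspace_scale[OF M])
    fix j assume "j \<in> {..<n}"
    then have j: "j < n" by simp
    have "e j = sw (\<lambda>x y. \<epsilon> x *\<^sub>C y) (e j)" by (rule sw_counit_left[OF clinear_ident, symmetric])
    also have "\<dots> = (\<Sum>i<n. \<epsilon> (e i) *\<^sub>C v $$ (i, j))"
      by (rule sw_eqI[OF _ comult_e[OF j]]) (intro sw_intros)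
    also have "\<dots> \<in> M"
      using entries j by (intro complex_vector.subspace_sum[OF M] complex_vector.subspace_scale[OF M]) auto
    finally show "e j \<in> M" .
  qed
  finally show "x \<in> M" .
qed

end

section \<open>Spanning by the coefficients of the representatives\<close>

lemma invertible_mat_left_inverse:
  assumes "invertible_mat T" "T \<in> carrier_mat n n"
  obtains U where "U \<in> carrier_mat n n" "U * T = 1\<^sub>m n"
proof -
  obtain U where "inverts_mat T U" "inverts_mat U T"
    using assms(1) by (auto simp: invertible_mat_def)
  then have U: "T * U = 1\<^sub>m n" "U * T = 1\<^sub>m (dim_row U)"
    using assms(2) by (auto simp: inverts_mat_def)
  have "dim_col U = n" using arg_cong[OF U(1), of dim_col] by simp
  moreover have "dim_row U = n" using arg_cong[OF U(2), of dim_col] assms(2) by simp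
  ultimately show ?thesis using U by (intro that[of U]) auto
qed

text \<open>Entrywise v = T^-1 u T with scalar matrices, so every entry of v is a combination of
  entries of u.\<close>

lemma equivalent_corepresentations_span:
  fixes v u :: "'a::complex_star_algebra mat"
  assumes eq: "equivalent_corepresentations v u" and M: "csubspace M"
    and v: "v \<in> carrier_mat n n" and u: "square_mat u"
    and entries: "\<And>i j. i < n \<Longrightarrow> j < n \<Longrightarrow> u $$ (i, j) \<in> M" and ij: "i < n" "j < n"
  shows "v $$ (i, j) \<in> M"
proof -
  let ?c = "map_mat (\<lambda>c. c *\<^sub>C (1 :: 'a))"
  obtain T where T: "T \<in> carrier_mat n n" "invertible_mat T" "?c T * v = u * ?c T"
    using eq v by (auto simp: equivalent_corepresentations_def)
  have uc: "u \<in> carrier_mat n n" using eq u v by (auto simp: equivalent_corepresentations_def)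
  obtain U where U: "U \<in> carrier_mat n n" "U * T = 1\<^sub>m n"
    using invertible_mat_left_inverse[OF T(2,1)] .
  have entry: "(\<Sum>l<n. T $$ (k, l) *\<^sub>C v $$ (l, j)) = (\<Sum>l<n. T $$ (l, j) *\<^sub>C u $$ (k, l))" if "k < n" for k
    using arg_cong[OF T(3), of "\<lambda>m. m $$ (k, j)"] that ij T(1) v uc
    by (simp add: scalar_prod_def atLeast0LessThan mult_scaleC_left mult_scaleC_right)
  have UT: "(\<Sum>k<n. U $$ (i, k) * T $$ (k, l)) = (if i = l then 1 else 0)" if "l < n" for l
    using arg_cong[OF U(2), of "\<lambda>m. m $$ (i, l)"] that ij T(1) U(1)
    by (simp add: scalar_prod_def atLeast0LessThan)
  have "v $$ (i, j) = (\<Sum>l<n. (\<Sum>k<n. U $$ (i, k) * T $$ (k, l)) *\<^sub>C v $$ (l, j))"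
    using ij by (simp add: UT if_distrib[of "\<lambda>x. x *\<^sub>C _"] scaleC_one cong: if_cong)
  also have "\<dots> = (\<Sum>k<n. U $$ (i, k) *\<^sub>C (\<Sum>l<n. T $$ (k, l) *\<^sub>C v $$ (l, j)))"
    by (simp add: sum_scaleC_left[symmetric] complex_vector.scale_sum_right scaleC_scaleC) (rule sum.swap)
  also have "\<dots> = (\<Sum>k<n. U $$ (i, k) *\<^sub>C (\<Sum>l<n. T $$ (l, j) *\<^sub>C u $$ (k, l)))"
    by (simp add: entry)
  also have "\<dots> \<in> M"
    using entries by (intro complex_vector.subspace_sum[OF M] complex_vector.subspace_scale[OF M]) auto
  finally show ?thesis .
qed

context haar_hopf
begin

text \<open>Complete reducibility, by induction on the size of a spanning set. If a proper nonzero
  stable W exists, V is the sum of W and its Haar orthogonal complement, which is proper by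
  faithfulness; both have smaller spanning sets. Otherwise V carries an irreducible unitary
  corepresentation and lies in the span of its entries.\<close>

lemma stable_subset_of_irreducibles:
  assumes M: "csubspace M"
    and irr: "\<And>v i j. unitary_corepresentation H v \<Longrightarrow> irreducible_corepresentation H v \<Longrightarrow>
      i < dim_row v \<Longrightarrow> j < dim_row v \<Longrightarrow> v $$ (i, j) \<in> M"
  shows "stable V \<Longrightarrow> finite B \<Longrightarrow> V \<subseteq> cspan B \<Longrightarrow> V \<subseteq> M"
proof (induction "card B" arbitrary: B V rule: less_induct)
  case less
  note V = less.prems(1) and B = less.prems(2,3)
  have subV: "csubspace V" using V by (simp add: stable_def)
  have smaller: "W \<subseteq> M" if W: "stable W" "W \<subset> V" for W
  proof -
    obtain C where "finite C" "card C < card B" "W \<subseteq> cspan C"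
      using proper_subspace_smaller_span[OF _ B W(2)] W(1) by (auto simp: stable_def)
    then show ?thesis using less.hyps W(1) by blast
  qed
  show ?case
  proof (cases "\<exists>W. stable W \<and> W \<subset> V \<and> W \<noteq> {0}")
    case True
    then obtain W where W: "stable W" "W \<subset> V" "W \<noteq> {0}" by blast
    have subW: "csubspace W" using W(1) by (simp add: stable_def)
    define W' where "W' = {x \<in> V. \<forall>w\<in>W. h (star w * x) = 0}"
    have "stable W'" unfolding W'_def using V W(1) by (rule stable_orthogonal)
    moreover have "W' \<subset> V"
    proof -
      obtain w where w: "w \<in> W" "w \<noteq> 0" using W(3) complex_vector.subspace_0[OF subW] by blast
      then have "w \<notin> W'" using haar_faithful by (auto simp: W'_def)
      then show ?thesis using w W(2) by (auto simp: W'_def)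
    qed
    ultimately have "W' \<subseteq> M" by (rule smaller)
    moreover have "W \<subseteq> M" by (rule smaller[OF W(1,2)])
    moreover have "\<exists>w\<in>W. x - w \<in> W'" if x: "x \<in> V" for x
    proof -
      obtain e n where e: "orthonormal e n" "\<And>i. i < n \<Longrightarrow> e i \<in> W"
        "\<And>x. x \<in> W \<Longrightarrow> x = (\<Sum>i<n. h (star (e i) * x) *\<^sub>C e i)"
        using orthonormal_basis[OF subW B(1)] B(2) W(2) by (metis psubset_imp_subset subset_trans)
      \<comment> \<open>The orthogonal projection of x to W; the remainder x - w lies in
        \<open>W'\<close>.\<close>
      define w where "w = (\<Sum>i<n. h (star (e i) * x) *\<^sub>C e i)"
      have w: "w \<in> W" unfolding w_def using e(2)
        by (intro complex_vector.subspace_sum[OF subW] complex_vector.subspace_scale[OF subW]) auto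
      have orth: "h (star (e i) * (x - w)) = 0" if "i < n" for i
        using orthonormal_coefficient[OF e(1) that, of "\<lambda>i. h (star (e i) * x)"]
        by (simp add: w_def[symmetric] clinear_diff[OF clinear_haar_left])
      have "h (star y * (x - w)) = 0" if "y \<in> W" for y
      proof -
        have "h (star (x - w) * y) = h (star (x - w) * (\<Sum>i<n. h (star (e i) * y) *\<^sub>C e i))"
          by (rule arg_cong[OF e(3)[OF that]])
        also have "\<dots> = (\<Sum>i<n. h (star (e i) * y) * h (star (x - w) * e i))"
          by (rule haar_sum_right)
        also have "\<dots> = 0"
          using orth haar_hermitian[of "x - w"] by (intro sum.neutral) simp
        finally show ?thesis using haar_hermitian[of y "x - w"] by simp
      qed
      moreover have "x - w \<in> V" using x w W(2) by (intro complex_vector.subspace_diff[OF subV]) auto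
      ultimately show ?thesis using w by (auto simp: W'_def)
    qed
    ultimately show ?thesis
      using complex_vector.subspace_add[OF M] by (metis (no_types, lifting) diff_add_cancel subset_iff)
  next
    case False
    show ?thesis
    proof (cases "V = {0}")
      case True
      then show ?thesis using complex_vector.subspace_0[OF M] by simp
    next
      case nontrivial: False
      obtain e n where e: "orthonormal e n" "\<And>i. i < n \<Longrightarrow> e i \<in> V"
        "\<And>x. x \<in> V \<Longrightarrow> x = (\<Sum>i<n. h (star (e i) * x) *\<^sub>C e i)"
        using orthonormal_basis[OF subV B] by blast
      interpret irreducible_comodule H h V e n
        by unfold_locales (use V False nontrivial e in auto)
      show ?thesis
        using irr[OF unitary_v irreducible_v] v_carrier by (intro V_subset[OF M]) auto
    qed
  qed
qed

text \<open>Each a sits in its own orbit, which is stable and finite-dimensional, hence in the span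
  of the entries of all irreducible unitaries; each of these is equivalent to a
  representative.\<close>

lemma peter_weyl_span:
  assumes u: "irreducible_representatives H Irr u"
  shows "cspan {u \<mu> $$ (i, j) | \<mu> i j. \<mu> \<in> Irr \<and> i < dim_row (u \<mu>) \<and> j < dim_row (u \<mu>)} = UNIV"
    (is "cspan ?U = UNIV")
proof -
  have "a \<in> cspan ?U" for a
  proof -
    have "v $$ (i, j) \<in> cspan ?U"
      if v: "unitary_corepresentation H v" "irreducible_corepresentation H v"
        and ij: "i < dim_row v" "j < dim_row v" for v i j
    proof -
      obtain \<mu> where \<mu>: "\<mu> \<in> Irr" "equivalent_corepresentations v (u \<mu>)"
        using u v unfolding irreducible_representatives_def by blast
      have dim: "dim_row (u \<mu>) = dim_row v" using \<mu>(2) by (simp add: equivalent_corepresentations_def)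
      have "square_mat (u \<mu>)" "square_mat v" using u \<mu>(1) v(1)
        by (auto simp: irreducible_representatives_def unitary_corepresentation_def corepresentation_def)
      then show ?thesis
        using \<mu>(1) dim ij
        by (intro equivalent_corepresentations_span[OF \<mu>(2) complex_vector.subspace_span, of "dim_row v"])
          (auto intro!: complex_vector.span_base exI)
    qed
    note irr = this
    obtain B where "finite B" "{convolve H f a | f. clinear f} \<subseteq> cspan B"
      using stable_orbit(3) by blast
    with stable_subset_of_irreducibles[OF complex_vector.subspace_span irr stable_orbit(1)]
    show ?thesis using stable_orbit(2)[of a] by blast
  qed
  then show ?thesis by blast
qed

end

section \<open>Convolution operators diagonal over the Peter--Weyl decomposition\<close>

text \<open>By \<open>comm\<close> the matrix \<Phi> commutes with u, so an eigenspace W of \<Phi>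
  is invariant. It is nonzero, hence everything, and the unit vectors in it read off the columns of
  \<Phi>.\<close>

lemma schur_commuting_scalar:
  fixes u :: "'a::complex_star_algebra mat" and \<Phi> :: "complex mat"
  assumes u: "irreducible_corepresentation H u" and n: "n = dim_row u" and \<Phi>: "\<Phi> \<in> carrier_mat n n"
    and comm: "\<And>i j. i < n \<Longrightarrow> j < n \<Longrightarrow>
      (\<Sum>k<n. \<Phi> $$ (i, k) *\<^sub>C u $$ (k, j)) = (\<Sum>k<n. \<Phi> $$ (k, j) *\<^sub>C u $$ (i, k))"
  obtains c where "\<And>i j. i < n \<Longrightarrow> j < n \<Longrightarrow> \<Phi> $$ (i, j) = (if i = j then c else 0)"
proof -
  have "n \<noteq> 0" using u n by (simp add: irreducible_corepresentation_def)
  then obtain c w0 where w0: "w0 \<in> carrier_vec n" "w0 \<noteq> 0\<^sub>v n" "\<Phi> *\<^sub>v w0 = c \<cdot>\<^sub>v w0"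
    using spectrum_non_empty[OF \<Phi>] \<Phi> by (auto simp: spectrum_def eigenvalue_def eigenvector_def)
  define W where "W = {w \<in> carrier_vec n. \<forall>i<n. (\<Sum>k<n. \<Phi> $$ (i, k) * w $ k) = c * w $ i}"
  have "(\<Sum>k<n. \<Phi> $$ (i, k) * w0 $ k) = c * w0 $ i" if "i < n" for i
    using arg_cong[OF w0(3), of "\<lambda>v. v $ i"] that w0(1) \<Phi> by (simp add: scalar_prod_def atLeast0LessThan)
  then have w0W: "w0 \<in> W" using w0(1) by (simp add: W_def)
  have "invariant_subspace u W"
    unfolding invariant_subspace_def n[symmetric]
  proof (intro conjI ballI allI)
    show "W \<subseteq> carrier_vec n" by (auto simp: W_def)
    show "0\<^sub>v n \<in> W" by (simp add: W_def)
    show "v + w \<in> W" if "v \<in> W" "w \<in> W" for v w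
    proof -
      have "dim_vec w = n" using that(2) by (auto simp: W_def)
      with that show ?thesis by (auto simp: W_def distrib_left sum.distrib)
    qed
    show "a \<cdot>\<^sub>v w \<in> W" if "w \<in> W" for a w
    proof -
      have "(\<Sum>k<n. \<Phi> $$ (i, k) * (a * w $ k)) = a * (\<Sum>k<n. \<Phi> $$ (i, k) * w $ k)" for i
        by (simp add: sum_distrib_left mult.left_commute)
      moreover have "dim_vec w = n" using that by (auto simp: W_def)
      ultimately show ?thesis using that by (auto simp: W_def)
    qed
    fix w assume w: "w \<in> W"
    define y where "y i = (\<Sum>j<n. (w $ j) *\<^sub>C u $$ (i, j))" for i
    have eigen: "(\<Sum>k<n. \<Phi> $$ (i, k) *\<^sub>C y k) = c *\<^sub>C y i" if "i < n" for i
    proof -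
      have "(\<Sum>k<n. \<Phi> $$ (i, k) *\<^sub>C y k) = (\<Sum>j<n. w $ j *\<^sub>C (\<Sum>k<n. \<Phi> $$ (i, k) *\<^sub>C u $$ (k, j)))"
        by (simp add: y_def complex_vector.scale_sum_right scaleC_scaleC mult.commute) (rule sum.swap)
      also have "\<dots> = (\<Sum>j<n. w $ j *\<^sub>C (\<Sum>k<n. \<Phi> $$ (k, j) *\<^sub>C u $$ (i, k)))"
        using that by (simp add: comm)
      also have "\<dots> = (\<Sum>k<n. (\<Sum>j<n. \<Phi> $$ (k, j) * w $ j) *\<^sub>C u $$ (i, k))"
        by (simp add: sum_scaleC_left[symmetric] complex_vector.scale_sum_right scaleC_scaleC mult.commute)
          (rule sum.swap)
      also have "\<dots> = c *\<^sub>C y i"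
        using w by (simp add: W_def y_def complex_vector.scale_sum_right scaleC_scaleC)
      finally show ?thesis .
    qed
    \<comment> \<open>The vector y has entries in A. Its coordinate vectors for the Hamel basis are
      complex; coordinates being linear, each satisfies the eigenvalue equation. They lie in W and
      witness that the coaction sends w into W \<otimes> A.\<close>
    obtain F where F: "finite F" "\<And>i. i \<in> {..<n} \<Longrightarrow> y i = (\<Sum>b\<in>F. coordinate b (y i) *\<^sub>C b)"
      using coordinate_expansion[of "{..<n}" y] by auto
    obtain g where g: "bij_betw g {0..<card F} F" using ex_bij_betw_nat_finite[OF F(1)] by blast
    define x where "x l = vec n (\<lambda>i. coordinate (g l) (y i))" for l
    have "x l \<in> W" for l
    proof -
      have "(\<Sum>k<n. \<Phi> $$ (i, k) * coordinate (g l) (y k)) = c * coordinate (g l) (y i)" if "i < n" for i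
        using arg_cong[OF eigen[OF that], of "coordinate (g l)"]
        by (simp add: clinear_sum[OF clinear_coordinate] clinear_scale[OF clinear_coordinate])
      then show ?thesis by (simp add: W_def x_def)
    qed
    moreover have "(\<Sum>j<n. (w $ j) *\<^sub>C u $$ (i, j)) = (\<Sum>l<card F. (x l $ i) *\<^sub>C g l)" if "i < n" for i
    proof -
      have "y i = (\<Sum>b\<in>F. coordinate b (y i) *\<^sub>C b)" using F(2) that by simp
      also have "\<dots> = (\<Sum>l<card F. coordinate (g l) (y i) *\<^sub>C g l)"
        using sum.reindex_bij_betw[OF g, of "\<lambda>b. coordinate b (y i) *\<^sub>C b"] by (simp add: atLeast0LessThan)
      finally show ?thesis using that by (simp add: y_def x_def)
    qed
    ultimately show "\<exists>m (x :: nat \<Rightarrow> complex vec) (a :: nat \<Rightarrow> 'a). (\<forall>l<m. x l \<in> W) \<and>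
        (\<forall>i<n. (\<Sum>j<n. (w $ j) *\<^sub>C u $$ (i, j)) = (\<Sum>l<m. (x l $ i) *\<^sub>C a l))"
      by (intro exI[of _ "card F"] exI[of _ x] exI[of _ g]) simp
  qed
  then have "W = {0\<^sub>v n} \<or> W = carrier_vec n"
    using u n by (simp add: irreducible_corepresentation_def)
  then have "W = carrier_vec n" using w0W w0(2) by blast
  then have "unit_vec n j \<in> W" for j by simp
  then have unit: "(\<Sum>k<n. \<Phi> $$ (i, k) * unit_vec n j $ k) = c * unit_vec n j $ i" if "i < n" for i j
    using that unfolding W_def by blast
  have "\<Phi> $$ (i, j) = (if i = j then c else 0)" if "i < n" "j < n" for i j
  proof -
    have "(\<Sum>k<n. \<Phi> $$ (i, k) * unit_vec n j $ k) = (\<Sum>k<n. if k = j then \<Phi> $$ (i, k) else 0)"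
      using that by (intro sum.cong) auto
    with unit[OF that(1), of j] that show ?thesis by (simp split: if_splits)
  qed
  then show ?thesis by (rule that)
qed

context star_hopf
begin

lemma ad_functional_sw:
  assumes \<phi>: "clinear \<phi>"
  shows "tensor_lift (\<lambda>x y. \<phi> x *\<^sub>C y) (ad H a) = sw (\<lambda>t z. sw (\<lambda>x y. \<phi> y *\<^sub>C (\<S> x * z)) t) a"
proof -
  have inner: "cbilinear (\<lambda>x y. y \<otimes>\<^sub>C (\<S> x * z))" for z by (intro sw_intros)
  have outer: "cbilinear (\<lambda>t z. tensor_lift (\<lambda>x y. y \<otimes>\<^sub>C (\<S> x * z)) t)"
  proof (rule cbilinear_clinearI)
    show "clinear (\<lambda>t. tensor_lift (\<lambda>x y. y \<otimes>\<^sub>C (\<S> x * z)) t)" for z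
      by (rule clinear_tensor_lift[OF inner])
    show "clinear (\<lambda>z. tensor_lift (\<lambda>x y. y \<otimes>\<^sub>C (\<S> x * z)) t)" for t
      unfolding tensor_lift_def by (intro clinear_sum_fun hopf_intros)
  qed
  have \<phi>': "cbilinear (\<lambda>x y :: 'a. \<phi> x *\<^sub>C y)" by (intro cbilinear_clinearI clinear_intros \<phi>)
  have "tensor_map \<Delta> id (\<Delta> a) = sw (\<lambda>x z. \<Delta> x \<otimes>\<^sub>C z) a"
    using sw_apply[OF clinear_tensor_map[OF clinear_comult clinear_id], of "(\<otimes>\<^sub>C)" a]
    by (simp add: tensor_map_tensor[OF clinear_comult clinear_id] comult_sw[symmetric])
  then have "ad H a = sw (\<lambda>t z. sw (\<lambda>x y. y \<otimes>\<^sub>C (\<S> x * z)) t) a"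
    by (simp add: ad_def sweedler3_def sw_apply[OF clinear_tensor_lift[OF outer], symmetric]
        tensor_lift_tensor[OF outer] sw_tensor_lift[OF inner])
  then show ?thesis
    by (simp add: sw_apply[OF clinear_tensor_lift[OF \<phi>'], symmetric] tensor_lift_tensor[OF \<phi>'])
qed

lemma antipode_invariant_functional:
  assumes "self_adjoint_functional H \<phi>" "hermitian_functional \<phi>"
  shows "\<phi> (\<S> a) = \<phi> a"
proof -
  have "\<phi> a = cnj (\<phi> (star (\<S> a)))"
    using assms(1) unfolding self_adjoint_functional_def dual_star_def by (rule fun_cong)
  also have "\<dots> = \<phi> (\<S> a)" using assms(2) by (simp add: hermitian_functional_def)
  finally show ?thesis by (rule sym)
qed

end

locale peter_weyl = haar_hopf +
  fixes Irr :: "'i set" and u :: "'i \<Rightarrow> 'a mat"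
  assumes representatives: "irreducible_representatives H Irr u"
begin

abbreviation "deg \<mu> \<equiv> dim_row (u \<mu>)"

lemma unitary_u: "\<mu> \<in> Irr \<Longrightarrow> unitary_corepresentation H (u \<mu>)"
  and irreducible_u: "\<mu> \<in> Irr \<Longrightarrow> irreducible_corepresentation H (u \<mu>)"
  using representatives by (auto simp: irreducible_representatives_def)

lemmas u_simps = unitary_corepresentationD[OF unitary_u refl]

lemma clinear_eq_on_coefficients:
  assumes F: "clinear F" and G: "clinear G"
    and eq: "\<And>\<mu> i j. \<mu> \<in> Irr \<Longrightarrow> i < deg \<mu> \<Longrightarrow> j < deg \<mu> \<Longrightarrow> F (u \<mu> $$ (i, j)) = G (u \<mu> $$ (i, j))"
  shows "F a = G a"
proof -
  have "cspan {u \<mu> $$ (i, j) | \<mu> i j. \<mu> \<in> Irr \<and> i < deg \<mu> \<and> j < deg \<mu>} \<subseteq> {a. F a = G a}"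
    using eq by (intro complex_vector.span_minimal)
      (auto simp: complex_vector.subspace_def clinear_add[OF F] clinear_add[OF G] clinear_scale[OF F]
        clinear_scale[OF G] clinear_zero[OF F] clinear_zero[OF G])
  then show ?thesis unfolding peter_weyl_span[OF representatives] by blast
qed

lemma convolve_u:
  assumes "clinear \<phi>" "\<mu> \<in> Irr" "i < deg \<mu>" "j < deg \<mu>"
  shows "convolve H \<phi> (u \<mu> $$ (i, j)) = (\<Sum>k<deg \<mu>. \<phi> (u \<mu> $$ (k, j)) *\<^sub>C u \<mu> $$ (i, k))"
  unfolding convolve_sw[OF assms(1)]
  by (rule sw_eqI[OF _ u_simps(1)[OF assms(2-)]]) (intro sw_intros assms)

lemma ad_functional_u:
  assumes "clinear \<phi>" "\<mu> \<in> Irr" "i < deg \<mu>" "j < deg \<mu>"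
  shows "tensor_lift (\<lambda>x y. \<phi> x *\<^sub>C y) (ad H (u \<mu> $$ (i, j)))
    = (\<Sum>k<deg \<mu>. \<Sum>l<deg \<mu>. \<phi> (u \<mu> $$ (l, k)) *\<^sub>C (\<S> (u \<mu> $$ (i, l)) * u \<mu> $$ (k, j)))"
proof -
  have "tensor_lift (\<lambda>x y. \<phi> x *\<^sub>C y) (ad H (u \<mu> $$ (i, j)))
    = (\<Sum>k<deg \<mu>. sw (\<lambda>x y. \<phi> y *\<^sub>C (\<S> x * u \<mu> $$ (k, j))) (u \<mu> $$ (i, k)))"
    unfolding ad_functional_sw[OF assms(1)]
    by (rule sw_eqI[OF _ u_simps(1)[OF assms(2-)]]) (intro sw_intros assms)
  also have "\<dots> = (\<Sum>k<deg \<mu>. \<Sum>l<deg \<mu>. \<phi> (u \<mu> $$ (l, k)) *\<^sub>C (\<S> (u \<mu> $$ (i, l)) * u \<mu> $$ (k, j)))"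
    using assms by (intro sum.cong refl sw_eqI[OF _ u_simps(1)] sw_intros) auto
  finally show ?thesis .
qed

text \<open>On coefficients \<phi>(u_ij) is C(\<mu>) if i = j and 0 otherwise. As star (S u_ij) =
  u_ji, real eigenvalues give self-adjointness; a scalar matrix passes through the adjoint coaction,
  where S(u) u = 1; commutation with S gives \<phi> o S = \<phi>, hence hermiticity.\<close>

lemma diagonal_functional:
  assumes L: "clinear L" and C: "diagonalizes_with_real_eigenvalues Irr u L"
    and S: "\<And>a. L (\<S> a) = \<S> (L a)" and one: "L 1 = 0" and \<phi>_def: "\<phi> = \<epsilon> \<circ> L"
  shows "clinear \<phi>" "self_adjoint_functional H \<phi>" "ad_invariant_functional H \<phi>"
    "hermitian_functional \<phi>" "\<phi> 1 = 0" "L = convolve H \<phi>"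
proof -
  obtain C :: "'i \<Rightarrow> real" where C: "\<And>\<mu> i j. \<mu> \<in> Irr \<Longrightarrow> i < deg \<mu> \<Longrightarrow> j < deg \<mu> \<Longrightarrow>
      L (u \<mu> $$ (i, j)) = complex_of_real (C \<mu>) *\<^sub>C u \<mu> $$ (i, j)"
    using C unfolding diagonalizes_with_real_eigenvalues_def by blast
  show lin: "clinear \<phi>"
    unfolding \<phi>_def comp_def by (rule clinear_compose[OF clinear_counit L])
  have \<phi>_u: "\<phi> (u \<mu> $$ (i, j)) = (if i = j then complex_of_real (C \<mu>) else 0)"
    if "\<mu> \<in> Irr" "i < deg \<mu>" "j < deg \<mu>" for \<mu> i j
    using that by (simp add: \<phi>_def C clinear_scale[OF clinear_counit] u_simps)
  show sa: "self_adjoint_functional H \<phi>"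
    unfolding self_adjoint_functional_def
  proof (rule ext, rule clinear_eq_on_coefficients[OF lin clinear_dual_star[OF lin]])
    fix \<mu> i j assume "\<mu> \<in> Irr" "i < deg \<mu>" "j < deg \<mu>"
    then show "\<phi> (u \<mu> $$ (i, j)) = dual_star H \<phi> (u \<mu> $$ (i, j))"
      by (simp add: dual_star_def u_simps star_star \<phi>_u)
  qed
  show "ad_invariant_functional H \<phi>"
    unfolding ad_invariant_functional_def
  proof (rule allI, rule clinear_eq_on_coefficients[where
        F = "\<lambda>a. tensor_lift (\<lambda>x y. \<phi> x *\<^sub>C y) (ad H a)" and G = "\<lambda>a. \<phi> a *\<^sub>C 1"])
    show "clinear (\<lambda>a. tensor_lift (\<lambda>x y. \<phi> x *\<^sub>C y) (ad H a))"
      unfolding ad_functional_sw[OF lin] by (intro sw_intros lin)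
    show "clinear (\<lambda>a. \<phi> a *\<^sub>C 1)" by (intro clinear_intros lin)
    fix \<mu> i j assume \<mu>: "\<mu> \<in> Irr" "i < deg \<mu>" "j < deg \<mu>"
    have "tensor_lift (\<lambda>x y. \<phi> x *\<^sub>C y) (ad H (u \<mu> $$ (i, j)))
      = (\<Sum>k<deg \<mu>. \<Sum>l<deg \<mu>. if l = k then complex_of_real (C \<mu>) *\<^sub>C (\<S> (u \<mu> $$ (i, l)) * u \<mu> $$ (k, j)) else 0)"
      unfolding ad_functional_u[OF lin \<mu>] using \<mu>(1) by (intro sum.cong) (auto simp: \<phi>_u)
    also have "\<dots> = complex_of_real (C \<mu>) *\<^sub>C (\<Sum>k<deg \<mu>. \<S> (u \<mu> $$ (i, k)) * u \<mu> $$ (k, j))"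
      unfolding complex_vector.scale_sum_right by (intro sum.cong) simp_all
    also have "(\<Sum>k<deg \<mu>. \<S> (u \<mu> $$ (i, k)) * u \<mu> $$ (k, j)) = (if i = j then 1 else 0)"
      using \<mu> by (simp add: u_simps)
    finally show "tensor_lift (\<lambda>x y. \<phi> x *\<^sub>C y) (ad H (u \<mu> $$ (i, j))) = \<phi> (u \<mu> $$ (i, j)) *\<^sub>C 1"
      by (simp add: \<phi>_u \<mu>)
  qed
  show "hermitian_functional \<phi>"
    unfolding hermitian_functional_def
  proof
    fix b
    \<comment> \<open>Every b is S(a), so the value at star b is \<phi>(star (S a)), the conjugate
      of the dual star of \<phi> at a.\<close>
    define a where "a = antipode_inv b"
    have b: "b = \<S> a" by (simp add: a_def antipode_antipode_inv)
    have "\<phi> (star b) = cnj (dual_star H \<phi> a)" by (simp add: dual_star_def b)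
    also have "\<dots> = cnj (\<phi> a)" using sa unfolding self_adjoint_functional_def by (metis (lifting))
    also have "\<phi> a = \<phi> b" by (simp add: \<phi>_def b S counit_antipode)
    finally show "\<phi> (star b) = cnj (\<phi> b)" .
  qed
  show "\<phi> 1 = 0" by (simp add: \<phi>_def one clinear_zero[OF clinear_counit])
  show "L = convolve H \<phi>"
  proof (rule ext, rule clinear_eq_on_coefficients[OF L clinear_convolve[OF lin]])
    fix \<mu> i j assume \<mu>: "\<mu> \<in> Irr" "i < deg \<mu>" "j < deg \<mu>"
    have "convolve H \<phi> (u \<mu> $$ (i, j)) = (\<Sum>k<deg \<mu>. if k = j then complex_of_real (C \<mu>) *\<^sub>C u \<mu> $$ (i, k) else 0)"
      unfolding convolve_u[OF lin \<mu>] using \<mu> by (intro sum.cong) (auto simp: \<phi>_u)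
    then show "L (u \<mu> $$ (i, j)) = convolve H \<phi> (u \<mu> $$ (i, j))" using \<mu> by (simp add: C)
  qed
qed

text \<open>Multiply the invariance identity for u_ij by u_mi on the left and sum over i: unitarity
  cancels u_mi against S(u_il). What remains says that the matrix of \<phi> commutes with u, so
  Schur's lemma applies.\<close>

lemma ad_invariant_scalar:
  assumes \<phi>: "clinear \<phi>" "ad_invariant_functional H \<phi>" and \<mu>: "\<mu> \<in> Irr"
  obtains c where "\<And>i j. i < deg \<mu> \<Longrightarrow> j < deg \<mu> \<Longrightarrow> \<phi> (u \<mu> $$ (i, j)) = (if i = j then c else 0)"
proof -
  let ?n = "deg \<mu>"
  let ?\<Phi> = "mat ?n ?n (\<lambda>(i, j). \<phi> (u \<mu> $$ (i, j)))"
  have "(\<Sum>k<?n. \<phi> (u \<mu> $$ (m, k)) *\<^sub>C u \<mu> $$ (k, j)) = (\<Sum>k<?n. \<phi> (u \<mu> $$ (k, j)) *\<^sub>C u \<mu> $$ (m, k))"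
    if mj: "m < ?n" "j < ?n" for m j
  proof -
    let ?s = "\<lambda>i l k. \<phi> (u \<mu> $$ (l, k)) *\<^sub>C (u \<mu> $$ (m, i) * star (u \<mu> $$ (l, i)) * u \<mu> $$ (k, j))"
    have "(\<Sum>i<?n. \<phi> (u \<mu> $$ (i, j)) *\<^sub>C u \<mu> $$ (m, i))
      = (\<Sum>i<?n. u \<mu> $$ (m, i) * tensor_lift (\<lambda>x y. \<phi> x *\<^sub>C y) (ad H (u \<mu> $$ (i, j))))"
      using \<phi>(2) by (simp add: ad_invariant_functional_def mult_scaleC_right)
    also have "\<dots> = (\<Sum>i<?n. \<Sum>k<?n. \<Sum>l<?n. ?s i l k)"
      using mj \<mu> by (intro sum.cong)
        (simp_all add: ad_functional_u[OF \<phi>(1)] sum_distrib_left mult_scaleC_right u_simps mult.assoc)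
    also have "\<dots> = (\<Sum>k<?n. \<Sum>i<?n. \<Sum>l<?n. ?s i l k)" by (rule sum.swap)
    also have "\<dots> = (\<Sum>k<?n. \<Sum>l<?n. \<Sum>i<?n. ?s i l k)" by (intro sum.cong refl sum.swap)
    also have "\<dots> = (\<Sum>k<?n. \<Sum>l<?n. if m = l then \<phi> (u \<mu> $$ (l, k)) *\<^sub>C u \<mu> $$ (k, j) else 0)"
    proof (intro sum.cong refl)
      fix k l assume "l \<in> {..<?n}"
      then show "(\<Sum>i<?n. ?s i l k) = (if m = l then \<phi> (u \<mu> $$ (l, k)) *\<^sub>C u \<mu> $$ (k, j) else 0)"
        using mj(1) \<mu> by (simp add: complex_vector.scale_sum_right[symmetric] sum_distrib_right[symmetric] u_simps)
    qed
    also have "\<dots> = (\<Sum>k<?n. \<phi> (u \<mu> $$ (m, k)) *\<^sub>C u \<mu> $$ (k, j))"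
      using mj(1) by simp
    finally show ?thesis by (rule sym)
  qed
  then have "(\<Sum>k<?n. ?\<Phi> $$ (i, k) *\<^sub>C u \<mu> $$ (k, j)) = (\<Sum>k<?n. ?\<Phi> $$ (k, j) *\<^sub>C u \<mu> $$ (i, k))"
    if "i < ?n" "j < ?n" for i j
    using that by simp
  from schur_commuting_scalar[OF irreducible_u[OF \<mu>] refl _ this]
  obtain c where "\<And>i j. i < ?n \<Longrightarrow> j < ?n \<Longrightarrow> ?\<Phi> $$ (i, j) = (if i = j then c else 0)" by auto
  then show ?thesis by (intro that[of c]) simp
qed

lemma convolution_diagonal:
  assumes \<phi>: "clinear \<phi>" "self_adjoint_functional H \<phi>" "ad_invariant_functional H \<phi>"
    "hermitian_functional \<phi>" "\<phi> 1 = 0"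
  shows "diagonalizes_with_real_eigenvalues Irr u (convolve H \<phi>)"
    and "convolve H \<phi> (\<S> a) = \<S> (convolve H \<phi> a)"
    and "convolve H \<phi> 1 = 0" and "\<phi> = \<epsilon> \<circ> convolve H \<phi>"
proof -
  have "\<exists>r. \<forall>i<deg \<mu>. \<forall>j<deg \<mu>. \<phi> (u \<mu> $$ (i, j)) = (if i = j then complex_of_real r else 0)"
    if \<mu>: "\<mu> \<in> Irr" for \<mu>
  proof -
    obtain c where c: "\<And>i j. i < deg \<mu> \<Longrightarrow> j < deg \<mu> \<Longrightarrow> \<phi> (u \<mu> $$ (i, j)) = (if i = j then c else 0)"
      by (rule ad_invariant_scalar[OF \<phi>(1,3) \<mu>]) blast
    \<comment> \<open>The diagonal entry (0, 0) therefore exists, and self-adjointness there equates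
      c with its conjugate.\<close>
    have pos: "0 < deg \<mu>" using irreducible_u[OF \<mu>] by (simp add: irreducible_corepresentation_def)
    have "c = dual_star H \<phi> (u \<mu> $$ (0, 0))"
      using c[OF pos pos] \<phi>(2) unfolding self_adjoint_functional_def by metis
    also have "\<dots> = cnj c"
      using pos \<mu> by (simp add: dual_star_def u_simps star_star c)
    finally have "c = complex_of_real (Re c)" by (simp add: complex_eq_iff)
    with c show ?thesis by (intro exI[of _ "Re c"]) auto
  qed
  then obtain r where r: "\<And>\<mu> i j. \<mu> \<in> Irr \<Longrightarrow> i < deg \<mu> \<Longrightarrow> j < deg \<mu> \<Longrightarrow>
      \<phi> (u \<mu> $$ (i, j)) = (if i = j then complex_of_real (r \<mu>) else 0)"
    by metis
  have conv: "convolve H \<phi> (u \<mu> $$ (i, j)) = complex_of_real (r \<mu>) *\<^sub>C u \<mu> $$ (i, j)"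
    if \<mu>: "\<mu> \<in> Irr" "i < deg \<mu>" "j < deg \<mu>" for \<mu> i j
  proof -
    have "convolve H \<phi> (u \<mu> $$ (i, j)) = (\<Sum>k<deg \<mu>. if k = j then complex_of_real (r \<mu>) *\<^sub>C u \<mu> $$ (i, k) else 0)"
      unfolding convolve_u[OF \<phi>(1) \<mu>] using \<mu> by (intro sum.cong) (auto simp: r)
    then show ?thesis using \<mu> by simp
  qed
  then show "diagonalizes_with_real_eigenvalues Irr u (convolve H \<phi>)"
    unfolding diagonalizes_with_real_eigenvalues_def by blast
  show "convolve H \<phi> (\<S> a) = \<S> (convolve H \<phi> a)"
  proof (rule clinear_eq_on_coefficients[where
        F = "\<lambda>a. convolve H \<phi> (\<S> a)" and G = "\<lambda>a. \<S> (convolve H \<phi> a)"])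
    show "clinear (\<lambda>a. convolve H \<phi> (\<S> a))"
      by (rule clinear_compose[OF clinear_convolve[OF \<phi>(1)] clinear_antipode])
    show "clinear (\<lambda>a. \<S> (convolve H \<phi> a))"
      by (rule clinear_compose[OF clinear_antipode clinear_convolve[OF \<phi>(1)]])
    fix \<mu> i j assume \<mu>: "\<mu> \<in> Irr" "i < deg \<mu>" "j < deg \<mu>"
    \<comment> \<open>This is S(u_ij). Hermiticity and the reality of r(\<mu>) give \<phi> the same
      scalar values on the starred coefficients.\<close>
    have "convolve H \<phi> (star (u \<mu> $$ (j, i)))
      = (\<Sum>k<deg \<mu>. \<phi> (star (u \<mu> $$ (k, i))) *\<^sub>C star (u \<mu> $$ (j, k)))"
      unfolding convolve_sw[OF \<phi>(1)]
      by (rule sw_eqI[OF _ comult_star_sum[OF u_simps(1)[OF \<mu>(1,3,2)]]]) (intro sw_intros \<phi>(1))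
    also have "\<dots> = (\<Sum>k<deg \<mu>. if k = i then complex_of_real (r \<mu>) *\<^sub>C star (u \<mu> $$ (j, k)) else 0)"
      using \<phi>(4) \<mu> by (intro sum.cong) (auto simp: hermitian_functional_def r)
    finally show "convolve H \<phi> (\<S> (u \<mu> $$ (i, j))) = \<S> (convolve H \<phi> (u \<mu> $$ (i, j)))"
      using \<mu> by (simp add: conv clinear_scale[OF clinear_antipode] u_simps)
  qed
  have "convolve H \<phi> 1 = \<phi> 1 *\<^sub>C 1"
    unfolding convolve_sw[OF \<phi>(1)] by (rule sw_one) (intro sw_intros \<phi>(1))
  then show "convolve H \<phi> 1 = 0" by (simp add: \<phi>(5))
  show "\<phi> = \<epsilon> \<circ> convolve H \<phi>" by (auto simp: counit_convolve[OF \<phi>(1)])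
qed

end

section \<open>The form on the induced calculus\<close>

lemma coset_eq_iff:
  fixes N :: "'b::complex_vector set"
  assumes N: "csubspace N"
  shows "s +o N = t +o N \<longleftrightarrow> s - t \<in> N"
proof
  assume "s +o N = t +o N"
  moreover have "s \<in> s +o N"
    using complex_vector.subspace_0[OF N] by (auto simp: elt_set_plus_def intro!: bexI[of _ 0])
  ultimately show "s - t \<in> N" by (auto simp: elt_set_plus_def)
next
  assume st: "s - t \<in> N"
  show "s +o N = t +o N"
  proof (intro equalityI subsetI)
    fix x assume "x \<in> s +o N"
    then obtain n where "n \<in> N" "x = t + ((s - t) + n)" by (auto simp: elt_set_plus_def)
    moreover from this have "(s - t) + n \<in> N" by (intro complex_vector.subspace_add[OF N st])
    ultimately show "x \<in> t +o N" unfolding elt_set_plus_def by blast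
  next
    fix x assume "x \<in> t +o N"
    then obtain n where "n \<in> N" "x = s + (n - (s - t))" by (auto simp: elt_set_plus_def)
    moreover from this have "n - (s - t) \<in> N" by (intro complex_vector.subspace_diff[OF N _ st])
    ultimately show "x \<in> s +o N" unfolding elt_set_plus_def by blast
  qed
qed

lemma tensor_sub_pure: "t \<in> T \<Longrightarrow> b \<otimes>\<^sub>C t \<in> tensor_sub T"
  unfolding tensor_sub_def by (rule complex_vector.span_base) blast

lemma tensor_sub_mono: "T \<subseteq> T' \<Longrightarrow> tensor_sub T \<subseteq> tensor_sub T'"
  unfolding tensor_sub_def by (rule complex_vector.span_mono) blast

lemma tensor_sub_induct:
  assumes "t \<in> tensor_sub T" "csubspace U" "\<And>b c. c \<in> T \<Longrightarrow> b \<otimes>\<^sub>C c \<in> U"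
  shows "t \<in> U"
  using assms complex_vector.span_minimal[of "{b \<otimes>\<^sub>C c | b c. c \<in> T}" U] unfolding tensor_sub_def by blast

lemma csubspace_kernel: "clinear f \<Longrightarrow> csubspace {x. f x = 0}"
  by (auto simp: complex_vector.subspace_def clinear_add clinear_scale clinear_zero)

section \<open>The kernel on A \<otimes> A\<close>

locale laplacian_functional = haar_hopf +
  fixes \<phi> :: "'a \<Rightarrow> complex"
  assumes clinear_phi: "clinear \<phi>" and self_adjoint: "self_adjoint_functional H \<phi>"
    and hermitian: "hermitian_functional \<phi>" and phi_one: "\<phi> 1 = 0"
begin

lemma phi_star: "\<phi> (star a) = cnj (\<phi> a)"
  using hermitian by (simp add: hermitian_functional_def)

lemma phi_antipode: "\<phi> (\<S> a) = \<phi> a"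
  by (rule antipode_invariant_functional[OF self_adjoint hermitian])

lemma dual_star_phi: "dual_star H \<phi> = \<phi>"
  using self_adjoint by (simp add: self_adjoint_functional_def)

lemmas phi_intros = antipode_inv_intros clinear_compose[OF clinear_phi]

text \<open>The kernel comes from inserting \<open>b \<otimes> \<pi>(c) = Q(c S\<^sup>-\<^sup>1(b\<^sub>2)) b\<^sub>1\<close> into the formula on germs.\<close>

definition twist :: "'a \<Rightarrow> 'a \<Rightarrow> 'a \<Rightarrow> 'a" where
  "twist c c' z = sw (\<lambda>x y. (- (1 / 2) * \<phi> (star (\<S> c) * y * \<S> c')) *\<^sub>C x) z"

text \<open>With x = c S^-1(b_2) one has S(x) = b_2 S(c). The second legs of the two arguments meet
  as star b_2 b'_2 inside \<phi>, so only the coproduct of star b b' enters.\<close>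

definition kern :: "'a \<Rightarrow> 'a \<Rightarrow> 'a \<Rightarrow> 'a \<Rightarrow> 'a" where
  "kern b c b' c' = twist c c' (star b * b')"

lemma star_twist: "star (twist c c' z) = twist c' c (star z)"
proof -
  have eq: "\<phi> (star (\<S> c') * star y * \<S> c) = cnj (\<phi> (star (\<S> c) * y * \<S> c'))" for y
    by (simp add: phi_star[symmetric] star_mult star_star mult.assoc)
  have "twist c' c (star z) = sw (\<lambda>x y. (- (1 / 2) * \<phi> (star (\<S> c') * star y * \<S> c)) *\<^sub>C star x) z"
    unfolding twist_def by (rule sw_star) (intro phi_intros)
  then show ?thesis 
    by (simp only: eq twist_def star_sw star_scaleC complex_cnj_mult complex_cnj_minus
        complex_cnj_divide complex_cnj_one complex_cnj_numeral)
qed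

lemma star_kern: "star (kern b c b' c') = kern b' c' b c"
  by (simp add: kern_def star_twist star_mult star_star)

lemma cbilinear_kern: "cbilinear (kern b c)"
  unfolding kern_def twist_def by (intro phi_intros)

text \<open>\<open>tensor_lift\<close> extends linear dependence only. The first variable is
  conjugate linear, so the star of the value is lifted and the star undone at the end.\<close>

definition G :: "('a, 'a) tensor \<Rightarrow> ('a, 'a) tensor \<Rightarrow> 'a" where
  "G s t = star (tensor_lift (\<lambda>b c. star (tensor_lift (kern b c) t)) s)"

lemma cbilinear_star_kern: "cbilinear (\<lambda>b c. star (tensor_lift (kern b c) t))"
proof -
  have lin: "clinear (\<lambda>b. kern b' c' b c)" "clinear (\<lambda>c. kern b' c' b c)" for b c b' c'
    using cbilinear_kern by (auto simp: cbilinear_def)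
  show ?thesis
    unfolding tensor_lift_def star_sum star_scaleC star_kern
    by (intro cbilinear_clinearI clinear_sum_fun clinear_scaleC_right lin)
qed

lemma G_tensor: "G (b \<otimes>\<^sub>C c) (b' \<otimes>\<^sub>C c') = kern b c b' c'"
proof -
  have "G (b \<otimes>\<^sub>C c) (b' \<otimes>\<^sub>C c') = star (star (tensor_lift (kern b c) (b' \<otimes>\<^sub>C c')))"
    unfolding G_def by (rule arg_cong[OF tensor_lift_tensor[OF cbilinear_star_kern]])
  then show ?thesis by (simp add: star_star tensor_lift_tensor[OF cbilinear_kern])
qed

lemma clinear_G: "clinear (G s)"
proof -
  have "G s t = (\<Sum>k\<in>Poly_Mapping.keys (rep_tensor s). cnj (Poly_Mapping.lookup (rep_tensor s) k) *\<^sub>C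
      tensor_lift (kern (fst k) (snd k)) t)" for t
    unfolding G_def tensor_lift_def[of "\<lambda>b c. star (tensor_lift (kern b c) t)"]
    by (simp add: star_sum star_scaleC star_star)
  then have "G s = (\<lambda>t. \<Sum>k\<in>Poly_Mapping.keys (rep_tensor s). cnj (Poly_Mapping.lookup (rep_tensor s) k) *\<^sub>C
      tensor_lift (kern (fst k) (snd k)) t)" by blast
  then show ?thesis
    by (simp only:) (intro clinear_sum_fun clinear_scaleC_right clinear_tensor_lift cbilinear_kern)
qed

lemma clinear_star_G: "clinear (\<lambda>s. star (G s t))"
  by (simp add: G_def star_star clinear_tensor_lift[OF cbilinear_star_kern])

text \<open>Hermitian symmetry of the kernel extends to all tensors; facts about one variable of
  \<open>G\<close> transfer to the other through it.\<close>

lemma star_G: "star (G s t) = G t s"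
proof -
  have 1: "star (G s (b \<otimes>\<^sub>C c)) = G (b \<otimes>\<^sub>C c) s" for s b c
    by (rule clinear_eq_on_tensors[OF clinear_star_G clinear_G]) (simp add: G_tensor star_kern)
  have "G s t = star (G t s)"
    by (rule clinear_eq_on_tensors[OF clinear_G clinear_star_G]) (simp add: 1[symmetric] star_star)
  then show ?thesis by (simp add: star_star)
qed

lemma G_scale_left: "G (c *\<^sub>C s) t = cnj c *\<^sub>C G s t"
  and G_add_left: "G (s + s') t = G s t + G s' t"
  and G_diff_left: "G (s - s') t = G s t - G s' t"
  by (simp_all add: star_G[of t, symmetric] clinear_scale[OF clinear_G] clinear_add[OF clinear_G]
      clinear_diff[OF clinear_G] star_scaleC star_add star_diff)

lemma clinear_mult_comult: "clinear (\<lambda>t. t * \<Delta> a)"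
  by (rule clinearI) (simp_all add: times_tensor_left_linear)

lemma tensor_mult_comult: "(b \<otimes>\<^sub>C c) * \<Delta> a = sw (\<lambda>x y. (b * x) \<otimes>\<^sub>C (c * y)) a"
  by (simp add: times_tensor_left sw_tensor_lift[OF cbilinear_mult_tensor])

text \<open>The kernel at z a_1 and c' a_2 has z_2 a_2 S(a_3) S(c') inside \<phi> and z_1 a_1
  outside; a_2 S(a_3) collapses and leaves a as a right factor. This is right linearity of the
  form.\<close>

lemma twist_comult: "sw (\<lambda>x y. twist c (c' * y) (z * x)) a = twist c c' z * a"
proof -
  define F where "F r s q = sw (\<lambda>x y. (- (1 / 2) * \<phi> (star (\<S> c) * (y * s) * (\<S> q * \<S> c'))) *\<^sub>C (x * r)) z"
    for r s q
  have "twist c (c' * q) (z * p) = sw (\<lambda>r s. F r s q) p" for p q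
  proof -
    have "twist c (c' * q) (z * p) = sw (\<lambda>x y. sw (\<lambda>r s.
        (- (1 / 2) * \<phi> (star (\<S> c) * (y * s) * \<S> (c' * q))) *\<^sub>C (x * r)) p) z"
      unfolding twist_def by (rule sw_comult_mult) (intro phi_intros)
    also have "\<dots> = sw (\<lambda>r s. F r s q) p"
      unfolding F_def antipode_mult by (rule sw_swap)
    finally show ?thesis .
  qed
  then have "sw (\<lambda>x y. twist c (c' * y) (z * x)) a = sw (\<lambda>p q. sw (\<lambda>r s. F r s q) p) a"
    by simp
  also have "\<dots> = sw (\<lambda>r q. sw (\<lambda>s q. F r s q) q) a"
    unfolding F_def by (rule sw_coassoc) (intro phi_intros)+
  also have "\<dots> = sw (\<lambda>r q. \<epsilon> q *\<^sub>C (twist c c' z * r)) a"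
  proof -
    have "sw (\<lambda>s q. F r s q) q = \<epsilon> q *\<^sub>C (twist c c' z * r)" for r q
    proof -
      have "clinear (\<lambda>m. (- (1 / 2) * \<phi> (star (\<S> c) * y * m * \<S> c')) *\<^sub>C (x * r))" for x y
        by (intro phi_intros)
      note inner = sw_apply[OF this, where f = "\<lambda>s q. s * \<S> q" and a = q]
      have "sw (\<lambda>s q. F r s q) q = sw (\<lambda>x y. sw (\<lambda>s q.
          (- (1 / 2) * \<phi> (star (\<S> c) * (y * s) * (\<S> q * \<S> c'))) *\<^sub>C (x * r)) q) z"
        unfolding F_def by (rule sw_swap)
      also have "\<dots> = sw (\<lambda>x y. \<epsilon> q *\<^sub>C ((- (1 / 2) * \<phi> (star (\<S> c) * y * \<S> c')) *\<^sub>C x * r)) z"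
        using inner by (simp add: mult.assoc sw_antipode_right mult_scaleC_left mult_scaleC_right
            clinear_scale[OF clinear_phi] scaleC_scaleC mult.left_commute)
      also have "\<dots> = \<epsilon> q *\<^sub>C (twist c c' z * r)"
        by (simp only: sw_scaleC sw_mult_right twist_def)
      finally show ?thesis .
    qed
    then show ?thesis by simp
  qed
  also have "\<dots> = twist c c' z * a"
    by (rule sw_counit_right) (intro phi_intros)
  finally show ?thesis .
qed

lemma G_right_mult: "G s (t * \<Delta> a) = G s t * a"
proof (rule clinear_eq_on_tensors[where F = "\<lambda>t. G s (t * \<Delta> a)" and G = "\<lambda>t. G s t * a"])
  show "clinear (\<lambda>t. G s (t * \<Delta> a))" by (rule clinear_compose[OF clinear_G clinear_mult_comult])
  show "clinear (\<lambda>t. G s t * a)" by (rule clinear_mult_const[OF clinear_G])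
  fix b' c'
  have "star (G s ((b' \<otimes>\<^sub>C c') * \<Delta> a)) = star a * star (G s (b' \<otimes>\<^sub>C c'))"
  proof (rule clinear_eq_on_tensors[where F = "\<lambda>s. star (G s ((b' \<otimes>\<^sub>C c') * \<Delta> a))"
        and G = "\<lambda>s. star a * star (G s (b' \<otimes>\<^sub>C c'))"])
    show "clinear (\<lambda>s. star a * star (G s (b' \<otimes>\<^sub>C c')))"
      by (rule clinear_const_mult[OF clinear_star_G])
    fix b c
    have "G (b \<otimes>\<^sub>C c) ((b' \<otimes>\<^sub>C c') * \<Delta> a) = G (b \<otimes>\<^sub>C c) (b' \<otimes>\<^sub>C c') * a"
      by (simp add: tensor_mult_comult sw_apply[OF clinear_G, symmetric] G_tensor kern_def
          mult.assoc[symmetric] twist_comult)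
    then show "star (G (b \<otimes>\<^sub>C c) ((b' \<otimes>\<^sub>C c') * \<Delta> a)) = star a * star (G (b \<otimes>\<^sub>C c) (b' \<otimes>\<^sub>C c'))"
      by (simp add: star_mult)
  qed (rule clinear_star_G)
  then show "G s ((b' \<otimes>\<^sub>C c') * \<Delta> a) = G s (b' \<otimes>\<^sub>C c') * a"
    by (metis star_mult star_star)
qed

lemma G_left_mult: "G (s * \<Delta> a) t = star a * G s t"
  by (metis G_right_mult star_G star_mult)

lemma twist_one: "twist c c' 1 = (- (1 / 2) * \<phi> (star (\<S> c) * \<S> c')) *\<^sub>C 1"
proof -
  have "twist c c' 1 = (- (1 / 2) * \<phi> (star (\<S> c) * 1 * \<S> c')) *\<^sub>C 1"
    unfolding twist_def by (rule sw_one) (intro phi_intros)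
  then show ?thesis by simp
qed

lemma G_invariant: "G (1 \<otimes>\<^sub>C c) (1 \<otimes>\<^sub>C c') = (- (1 / 2) * \<phi> (star (\<S> c) * \<S> c')) *\<^sub>C 1"
  by (simp add: G_tensor kern_def star_one twist_one)

section \<open>Descent to the quotient by R\<close>

abbreviation "K \<equiv> {x. \<epsilon> x = 0}"
abbreviation "R \<equiv> R_ideal H \<phi>"

lemma csubspace_K: "csubspace K"
  by (rule csubspace_kernel[OF clinear_counit])

lemma csubspace_R: "csubspace R"
  by (auto simp: R_ideal_def complex_vector.subspace_def clinear_add[OF clinear_counit]
      clinear_scale[OF clinear_counit] clinear_zero[OF clinear_counit] distrib_right mult_scaleC_left
      clinear_add[OF clinear_phi] clinear_scale[OF clinear_phi] clinear_zero[OF clinear_phi])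

lemma R_subset_K: "R \<subseteq> K"
  by (auto simp: R_ideal_def)

lemma K_right: "c \<in> K \<Longrightarrow> c * a \<in> K"
  by (simp add: counit_mult)

text \<open>For b in ker \<epsilon>, star (S r) b = star (S (r star (S b))). Hermiticity and \<phi>
  o S = \<phi> turn its value into the conjugate of \<phi>(r star (S b)), and star (S b) is again in
  ker \<epsilon>.\<close>

lemma R_star_antipode: "r \<in> R \<Longrightarrow> star (\<S> r) \<in> R"
proof -
  assume r: "r \<in> R"
  have "\<phi> (star (\<S> r) * b) = 0" if b: "\<epsilon> b = 0" for b
  proof -
    have "star (\<S> r) * b = star (\<S> (r * star (\<S> b)))"
      by (simp add: antipode_mult antipode_star_antipode star_mult star_star)
    also have "\<phi> \<dots> = cnj (\<phi> (r * star (\<S> b)))" by (simp add: phi_star phi_antipode)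
    also have "\<phi> (r * star (\<S> b)) = 0"
      using r b by (simp add: R_ideal_def counit_star counit_antipode)
    finally show ?thesis by simp
  qed
  with r show ?thesis by (simp add: R_ideal_def counit_star counit_antipode)
qed

lemma tensor_sub_right_mult:
  assumes "\<And>c a. c \<in> T \<Longrightarrow> c * a \<in> T" "t \<in> tensor_sub T"
  shows "t * \<Delta> a \<in> tensor_sub T"
proof -
  have "(b \<otimes>\<^sub>C c) * \<Delta> a \<in> tensor_sub T" if "c \<in> T" for b c
    unfolding tensor_mult_comult sw_def using assms(1)[OF that]
    by (intro complex_vector.subspace_sum csubspace_tensor_sub tensor_sub_pure)
  then have "(\<lambda>t. t * \<Delta> a) ` tensor_sub T \<subseteq> tensor_sub T"
    by (rule tensor_sub_invariant[OF clinear_mult_comult _ csubspace_tensor_sub])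
  with assms(2) show ?thesis by blast
qed

lemma K_right_mult: "t \<in> tensor_sub K \<Longrightarrow> t * \<Delta> a \<in> tensor_sub K"
  by (rule tensor_sub_right_mult[OF K_right])

text \<open>In each term \<phi> is applied to star (S r) times y S(c): the first factor lies in R,
  the second in ker \<epsilon>.\<close>

lemma G_null_left:
  assumes "s \<in> tensor_sub R" "t \<in> tensor_sub K" shows "G s t = 0"
proof -
  have "star (G s t) = 0"
  proof -
    have "s \<in> {s. star (G s t) = 0}"
    proof (rule tensor_sub_induct[OF assms(1) csubspace_kernel[OF clinear_star_G]])
      fix b r assume r: "r \<in> R"
      have "t \<in> {t. G (b \<otimes>\<^sub>C r) t = 0}"
      proof (rule tensor_sub_induct[OF assms(2) csubspace_kernel[OF clinear_G]])
        fix b' c assume "c \<in> K"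
        then have "\<phi> (star (\<S> r) * (y * \<S> c)) = 0" for y
          using R_star_antipode[OF r] by (simp add: R_ideal_def counit_mult counit_antipode)
        then show "b' \<otimes>\<^sub>C c \<in> {t. G (b \<otimes>\<^sub>C r) t = 0}"
          by (simp add: G_tensor kern_def twist_def mult.assoc sw_def)
      qed
      then show "b \<otimes>\<^sub>C r \<in> {s. star (G s t) = 0}" by (simp add: star_zero)
    qed
    then show ?thesis by simp
  qed
  then show ?thesis by (metis star_star star_zero)
qed

lemma G_null_right: "s \<in> tensor_sub K \<Longrightarrow> t \<in> tensor_sub R \<Longrightarrow> G s t = 0"
  by (metis G_null_left star_G star_zero)

lemmas N_subset = tensor_sub_mono[OF R_subset_K]
lemmas N_subspace = csubspace_tensor_sub[of R]

lemma omega_class_eq_iff: "omega_class H \<phi> s = omega_class H \<phi> t \<longleftrightarrow> s - t \<in> tensor_sub R"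
  unfolding omega_class_def by (rule coset_eq_iff[OF N_subspace])

text \<open>Evaluates \<open>G\<close> on chosen representatives; by \<open>form_class\<close> the
  choice does not matter on classes of elements of A \<otimes> ker \<epsilon>.\<close>

definition form :: "('a, 'a) tensor set \<Rightarrow> ('a, 'a) tensor set \<Rightarrow> 'a" where
  "form X Y = G (SOME s. s \<in> X) (SOME t. t \<in> Y)"

lemma some_representative:
  assumes "s \<in> tensor_sub K"
  shows "(SOME t. t \<in> omega_class H \<phi> s) - s \<in> tensor_sub R"
    and "(SOME t. t \<in> omega_class H \<phi> s) \<in> tensor_sub K"
proof -
  let ?t = "SOME t. t \<in> omega_class H \<phi> s"
  have "s \<in> omega_class H \<phi> s"
    using complex_vector.subspace_0[OF N_subspace]
    by (auto simp: omega_class_def elt_set_plus_def intro!: bexI[of _ 0])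
  then have "?t \<in> omega_class H \<phi> s" by (rule someI)
  then show diff: "?t - s \<in> tensor_sub R" by (auto simp: omega_class_def elt_set_plus_def)
  then have "(?t - s) + s \<in> tensor_sub K"
    using N_subset assms by (intro complex_vector.subspace_add[OF csubspace_tensor_sub]) auto
  then show "?t \<in> tensor_sub K" by simp
qed

lemma form_class:
  assumes s: "s \<in> tensor_sub K" and t: "t \<in> tensor_sub K"
  shows "form (omega_class H \<phi> s) (omega_class H \<phi> t) = G s t"
proof -
  let ?s = "SOME x. x \<in> omega_class H \<phi> s" and ?t = "SOME x. x \<in> omega_class H \<phi> t"
  have "G ?s ?t - G s ?t = 0"
    using G_null_left[OF some_representative(1)[OF s] some_representative(2)[OF t]]
    by (simp add: G_diff_left)
  moreover have "G s ?t - G s t = 0"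
    using G_null_right[OF s some_representative(1)[OF t]] by (simp add: clinear_diff[OF clinear_G])
  ultimately show ?thesis by (simp add: form_def)
qed

section \<open>The operations of the calculus on classes\<close>

lemma forms_omega: "forms (omega H \<phi>) = omega_class H \<phi> ` tensor_sub K"
  by (simp add: omega_def Let_def quotient_space_def omega_class_def)

lemma form_zero_omega: "form_zero (omega H \<phi>) = omega_class H \<phi> 0"
  by (simp add: omega_def Let_def omega_class_def elt_set_plus_def)

lemma form_add_omega:
  "form_add (omega H \<phi>) (omega_class H \<phi> s) (omega_class H \<phi> t) = omega_class H \<phi> (s + t)"
proof -
  have "tensor_sub R + tensor_sub R = (tensor_sub R :: ('a, 'a) tensor set)"
  proof
    show "tensor_sub R + tensor_sub R \<subseteq> (tensor_sub R :: ('a, 'a) tensor set)"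
      using complex_vector.subspace_add[OF N_subspace] by (auto simp: set_plus_def)
    show "tensor_sub R \<subseteq> tensor_sub R + (tensor_sub R :: ('a, 'a) tensor set)"
      using complex_vector.subspace_0[OF N_subspace] by (auto simp: set_plus_def intro: bexI[of _ 0])
  qed
  then show ?thesis by (simp add: omega_def Let_def omega_class_def set_plus_rearrange)
qed

lemma form_scale_omega:
  "form_scale (omega H \<phi>) c (omega_class H \<phi> s) = omega_class H \<phi> (c *\<^sub>C s)"
proof -
  have "induced_map (scaleC c) (tensor_sub R) (s +o tensor_sub R) = c *\<^sub>C s +o tensor_sub R"
    using complex_vector.subspace_scale[OF N_subspace]
    by (intro induced_map_coset scaleC_add_right N_subspace complex_vector.subspace_0) auto
  then show ?thesis by (simp add: omega_def Let_def omega_class_def)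
qed

lemma right_mult_omega:
  "right_mult (omega H \<phi>) (omega_class H \<phi> s) a = omega_class H \<phi> (s * \<Delta> a)"
proof -
  have "(\<lambda>t. t * \<Delta> a) ` tensor_sub R \<subseteq> tensor_sub R"
    using tensor_sub_right_mult[of R] R_ideal_right[OF hopf] by blast
  then show ?thesis
    by (simp add: omega_def Let_def omega_class_def induced_map_coset clinear_add[OF clinear_mult_comult]
        csubspace_tensor_sub complex_vector.subspace_0)
qed

lemma differential_omega: "differential (omega H \<phi>) a = omega_class H \<phi> (\<Delta> a - a \<otimes>\<^sub>C 1)"
  and differential_mem: "\<Delta> a - a \<otimes>\<^sub>C 1 \<in> tensor_sub K"
proof -
  have lin: "clinear (\<lambda>x. x - \<epsilon> x *\<^sub>C 1)" by (intro sw_intros)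
  have map: "tensor_map id (\<lambda>x. x - \<epsilon> x *\<^sub>C 1) (\<Delta> a) = sw (\<lambda>x y. x \<otimes>\<^sub>C (y - \<epsilon> y *\<^sub>C 1)) a"
    using sw_apply[OF clinear_tensor_map[OF clinear_id lin], of "(\<otimes>\<^sub>C)" a]
    by (simp add: tensor_map_tensor[OF clinear_id lin] comult_sw[symmetric])
  have "sw (\<lambda>x y. x \<otimes>\<^sub>C (y - \<epsilon> y *\<^sub>C 1)) a = sw (\<otimes>\<^sub>C) a - sw (\<lambda>x y. (\<epsilon> y *\<^sub>C x) \<otimes>\<^sub>C 1) a"
    by (simp add: sw_def clinear_diff[OF clinear_const_tensor[OF clinear_ident]] tensor_scale_left
        tensor_scale_right sum_subtractf)
  also have "sw (\<otimes>\<^sub>C) a = \<Delta> a" by (rule comult_sw[symmetric])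
  also have "sw (\<lambda>x y. (\<epsilon> y *\<^sub>C x) \<otimes>\<^sub>C 1) a = a \<otimes>\<^sub>C 1"
    by (simp add: sw_apply[OF clinear_tensor_const[OF clinear_ident]] sw_counit_right[OF clinear_ident])
  finally have eq: "sw (\<lambda>x y. x \<otimes>\<^sub>C (y - \<epsilon> y *\<^sub>C 1)) a = \<Delta> a - a \<otimes>\<^sub>C 1" .
  show "differential (omega H \<phi>) a = omega_class H \<phi> (\<Delta> a - a \<otimes>\<^sub>C 1)"
    by (simp add: omega_def Let_def map eq)
  show "\<Delta> a - a \<otimes>\<^sub>C 1 \<in> tensor_sub K"
    unfolding eq[symmetric] sw_def
    by (intro complex_vector.subspace_sum csubspace_tensor_sub tensor_sub_pure)
      (simp add: clinear_diff[OF clinear_counit] clinear_scale[OF clinear_counit] counit_one)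
qed

lemma sesquilinear_form_form: "sesquilinear_form (omega H \<phi>) form"
  unfolding sesquilinear_form_def forms_omega
  by (auto simp: form_add_omega form_scale_omega form_class G_add_left G_scale_left
      clinear_add[OF clinear_G] clinear_scale[OF clinear_G]
      complex_vector.subspace_add[OF csubspace_tensor_sub] complex_vector.subspace_scale[OF csubspace_tensor_sub])

lemma form_right_mult:
  assumes "\<omega> \<in> forms (omega H \<phi>)" "\<eta> \<in> forms (omega H \<phi>)"
  shows "form (right_mult (omega H \<phi>) \<omega> f) (right_mult (omega H \<phi>) \<eta> g) = star f * form \<omega> \<eta> * g"
  using assms unfolding forms_omega
  by (auto simp: right_mult_omega form_class K_right_mult G_left_mult G_right_mult mult.assoc)

lemma quantum_germs_kernel: "\<epsilon> x = 0 \<Longrightarrow> quantum_germs H \<phi> x = omega_class H \<phi> (1 \<otimes>\<^sub>C x)"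
  by (simp add: quantum_germs_def)

lemma given_on_germs_form: "given_on_germs H \<phi> form"
  unfolding given_on_germs_def
proof (intro conjI allI impI sesquilinear_form_form, elim conjE)
  fix f g x y assume x: "\<epsilon> x = 0" and y: "\<epsilon> y = 0"
  have mem: "omega_class H \<phi> (1 \<otimes>\<^sub>C x) \<in> forms (omega H \<phi>)" "omega_class H \<phi> (1 \<otimes>\<^sub>C y) \<in> forms (omega H \<phi>)"
    using x y by (auto simp: forms_omega tensor_sub_pure)
  show "form (right_mult (omega H \<phi>) (quantum_germs H \<phi> x) f) (right_mult (omega H \<phi>) (quantum_germs H \<phi> y) g)
    = (- 1 / 2 * \<phi> (star (\<S> x) * \<S> y)) *\<^sub>C (star f * g)"
    unfolding quantum_germs_kernel[OF x] quantum_germs_kernel[OF y] form_right_mult[OF mem]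
    by (simp add: form_class tensor_sub_pure x y G_invariant mult_scaleC_left mult_scaleC_right)
qed

section \<open>Germs span, and the form is unique\<close>

lemma tensor_sub_K_span:
  "tensor_sub K \<subseteq> cspan {(1 \<otimes>\<^sub>C x) * \<Delta> f | x f. \<epsilon> x = 0}"
proof
  fix t :: "('a, 'a) tensor" assume "t \<in> tensor_sub K"
  then show "t \<in> cspan {(1 \<otimes>\<^sub>C x) * \<Delta> f | x f. \<epsilon> x = 0}"
  proof (rule tensor_sub_induct)
    fix b c assume c: "c \<in> K"
    \<comment> \<open>This inverts right multiplication: b \<otimes> c is the sum of (1 \<otimes> c
      S^-1(b_2)) \<Delta>(b_1), because S^-1(b_3) b_2 cancels.\<close>
    have "sw (\<lambda>x y. (1 \<otimes>\<^sub>C (c * antipode_inv y)) * \<Delta> x) b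
        = sw (\<lambda>x y. sw (\<lambda>p q. p \<otimes>\<^sub>C (c * antipode_inv y * q)) x) b"
      by (simp add: tensor_mult_comult)
    also have "\<dots> = sw (\<lambda>p y. sw (\<lambda>q r. p \<otimes>\<^sub>C (c * antipode_inv r * q)) y) b"
      by (rule sw_coassoc) (intro antipode_inv_intros)+
    also have "\<dots> = sw (\<lambda>p y. \<epsilon> y *\<^sub>C (p \<otimes>\<^sub>C c)) b"
    proof -
      have "sw (\<lambda>q r. p \<otimes>\<^sub>C (c * antipode_inv r * q)) y = \<epsilon> y *\<^sub>C (p \<otimes>\<^sub>C c)" for p y
        by (simp add: sw_apply[OF clinear_const_tensor[OF clinear_ident]] mult.assoc sw_mult_left
            sw_antipode_inv_left mult_scaleC_right tensor_scale_right)
      then have "(\<lambda>p y. sw (\<lambda>q r. p \<otimes>\<^sub>C (c * antipode_inv r * q)) y) = (\<lambda>p y. \<epsilon> y *\<^sub>C (p \<otimes>\<^sub>C c))"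
        by (intro ext)
      then show ?thesis by (rule arg_cong[where f = "\<lambda>f. sw f b"])
    qed
    also have "\<dots> = b \<otimes>\<^sub>C c" by (rule sw_counit_right) (intro antipode_inv_intros)
    finally have eq: "b \<otimes>\<^sub>C c = sw (\<lambda>x y. (1 \<otimes>\<^sub>C (c * antipode_inv y)) * \<Delta> x) b" by (rule sym)
    have "\<epsilon> (c * antipode_inv y) = 0" for y using c by (simp add: counit_mult)
    then have "(1 \<otimes>\<^sub>C (c * antipode_inv y)) * \<Delta> x \<in> cspan {(1 \<otimes>\<^sub>C x) * \<Delta> f | x f. \<epsilon> x = 0}" for x y
      by (intro complex_vector.span_base) blast
    then show "b \<otimes>\<^sub>C c \<in> cspan {(1 \<otimes>\<^sub>C x) * \<Delta> f | x f. \<epsilon> x = 0}"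
      unfolding eq sw_def by (intro complex_vector.span_sum)
  qed (rule complex_vector.subspace_span)
qed

lemma omega_germ: "\<epsilon> x = 0 \<Longrightarrow>
    omega_class H \<phi> ((1 \<otimes>\<^sub>C x) * \<Delta> f) = right_mult (omega H \<phi>) (quantum_germs H \<phi> x) f"
  and germ_mem: "\<epsilon> x = 0 \<Longrightarrow> (1 \<otimes>\<^sub>C x) * \<Delta> f \<in> tensor_sub K"
  by (simp_all add: quantum_germs_kernel right_mult_omega K_right_mult tensor_sub_pure)

text \<open>Both forms agree on products of germs with functions, and these span. Agreement is
  extended in the second variable against a fixed product, then in the first.\<close>

lemma given_on_germs_unique:
  assumes B: "given_on_germs H \<phi> B" and B': "given_on_germs H \<phi> B'"
    and s: "s \<in> tensor_sub K" and t: "t \<in> tensor_sub K"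
  shows "B (omega_class H \<phi> s) (omega_class H \<phi> t) = B' (omega_class H \<phi> s) (omega_class H \<phi> t)"
proof -
  let ?c = "omega_class H \<phi>"
  have add: "C (?c (s + s')) (?c t) = C (?c s) (?c t) + C (?c s') (?c t)"
      "C (?c t) (?c (s + s')) = C (?c t) (?c s) + C (?c t) (?c s')"
    and scale: "C (?c (k *\<^sub>C s)) (?c t) = cnj k *\<^sub>C C (?c s) (?c t)"
      "C (?c t) (?c (k *\<^sub>C s)) = k *\<^sub>C C (?c t) (?c s)"
    if "given_on_germs H \<phi> C" "s \<in> tensor_sub K" "s' \<in> tensor_sub K" "t \<in> tensor_sub K"
    for C :: "('a, 'a) tensor set \<Rightarrow> ('a, 'a) tensor set \<Rightarrow> 'a" and s s' t k
    using that unfolding given_on_germs_def sesquilinear_form_def forms_omega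
      form_add_omega[symmetric] form_scale_omega[symmetric] by blast+
  note T = csubspace_tensor_sub[of K]
  have zero: "C (?c 0) (?c t) = 0" "C (?c t) (?c 0) = 0"
    if "given_on_germs H \<phi> C" "t \<in> tensor_sub K"
    for C :: "('a, 'a) tensor set \<Rightarrow> ('a, 'a) tensor set \<Rightarrow> 'a" and t
    using scale[OF that(1) complex_vector.subspace_0[OF T] complex_vector.subspace_0[OF T] that(2), of 0]
    by simp_all
  note closed = complex_vector.subspace_0[OF T] complex_vector.subspace_add[OF T]
    complex_vector.subspace_scale[OF T]
  let ?E = "\<lambda>s. {t \<in> tensor_sub K. B (?c s) (?c t) = B' (?c s) (?c t)}"
  have right: "t \<in> ?E s" if s: "s \<in> tensor_sub K"
    and gen: "\<And>x f. \<epsilon> x = 0 \<Longrightarrow> (1 \<otimes>\<^sub>C x) * \<Delta> f \<in> ?E s" and t: "t \<in> tensor_sub K" for s t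
  proof -
    have "csubspace (?E s)"
      unfolding complex_vector.subspace_def using s
      by (auto simp: closed add[OF B] add[OF B'] scale[OF B] scale[OF B'] zero[OF B] zero[OF B'])
    moreover have "{(1 \<otimes>\<^sub>C x) * \<Delta> f | x f. \<epsilon> x = 0} \<subseteq> ?E s" using gen by blast
    ultimately have "cspan {(1 \<otimes>\<^sub>C x) * \<Delta> f | x f. \<epsilon> x = 0} \<subseteq> ?E s"
      by (intro complex_vector.span_minimal)
    with tensor_sub_K_span t show ?thesis by blast
  qed
  let ?F = "{s \<in> tensor_sub K. B (?c s) (?c t) = B' (?c s) (?c t)}"
  have "csubspace ?F"
    unfolding complex_vector.subspace_def using t
    by (auto simp: closed add[OF B] add[OF B'] scale[OF B] scale[OF B'] zero[OF B] zero[OF B'])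
  moreover have "(1 \<otimes>\<^sub>C x) * \<Delta> f \<in> ?F" if x: "\<epsilon> x = 0" for x f
  proof -
    have "(1 \<otimes>\<^sub>C y) * \<Delta> g \<in> ?E ((1 \<otimes>\<^sub>C x) * \<Delta> f)" if "\<epsilon> y = 0" for y g
      using B B' x that germ_mem[OF that] by (simp add: omega_germ given_on_germs_def)
    from right[OF germ_mem[OF x] this t] show ?thesis by (simp add: germ_mem[OF x])
  qed
  ultimately have "cspan {(1 \<otimes>\<^sub>C x) * \<Delta> f | x f. \<epsilon> x = 0} \<subseteq> ?F"
    by (intro complex_vector.span_minimal) auto
  with tensor_sub_K_span s show ?thesis by blast
qed

section \<open>Left invariant forms and nondegeneracy\<close>

lemma left_inv_omega: "left_inv (omega H \<phi>) = {omega_class H \<phi> (1 \<otimes>\<^sub>C c) | c. \<epsilon> c = 0}"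
proof -
  let ?N = "tensor_sub R :: ('a, 'a) tensor set"
  let ?M = "tensor_sub ?N :: ('a, ('a, 'a) tensor) tensor set"
  \<comment> \<open>Left invariance says that F t - 1 \<otimes> t lies in A \<otimes> (A \<otimes>
    R). Applying id \<otimes> e, with e = \<epsilon> \<otimes> id, recovers t from F t, so t agrees
    with 1 \<otimes> e t modulo A \<otimes> R.\<close>
  define F where "F t = tensor_assoc (tensor_map \<Delta> id t)" for t :: "('a, 'a) tensor"
  define e where "e = tensor_lift (\<lambda>x y :: 'a. \<epsilon> x *\<^sub>C y)"
  note mid = cbilinear_assoc_inner and as = cbilinear_assoc
  have linF: "clinear F"
    unfolding F_def tensor_assoc_def
    by (rule clinear_compose[OF clinear_tensor_lift[OF as] clinear_tensor_map[OF clinear_comult clinear_id]])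
  have F: "F (b \<otimes>\<^sub>C c) = sw (\<lambda>p q. p \<otimes>\<^sub>C (q \<otimes>\<^sub>C c)) b" for b c
    by (simp add: F_def tensor_assoc_def tensor_map_tensor[OF clinear_comult clinear_id]
        tensor_lift_tensor[OF as] sw_tensor_lift[OF mid])
  have bil_e: "cbilinear (\<lambda>x y :: 'a. \<epsilon> x *\<^sub>C y)" by (intro sw_intros)
  have lin_e: "clinear e" unfolding e_def by (rule clinear_tensor_lift[OF bil_e])
  have e: "e (b \<otimes>\<^sub>C c) = \<epsilon> b *\<^sub>C c" for b c by (simp add: e_def tensor_lift_tensor[OF bil_e])
  have e_mem: "e t \<in> U" if "csubspace U" "t \<in> tensor_sub U" for t U
    using tensor_sub_invariant[OF lin_e _ that(1), of U] that complex_vector.subspace_scale[OF that(1)]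
    by (auto simp: e)
  have linE: "clinear (tensor_map id e)" by (rule clinear_tensor_map[OF clinear_id lin_e])
  have E: "tensor_map id e (b \<otimes>\<^sub>C t) = b \<otimes>\<^sub>C e t" for b :: 'a and t
    by (simp add: tensor_map_tensor[OF clinear_id lin_e])
  have E_F: "tensor_map id e (F t) = t" for t
  proof (rule clinear_eq_on_tensors[OF clinear_compose[OF linE linF] clinear_ident])
    fix b c
    have "tensor_map id e (F (b \<otimes>\<^sub>C c)) = sw (\<lambda>p q. \<epsilon> q *\<^sub>C (p \<otimes>\<^sub>C c)) b"
      by (simp add: F sw_apply[OF linE, symmetric] E e tensor_scale_right)
    also have "\<dots> = b \<otimes>\<^sub>C c" by (rule sw_counit_right) (intro sw_intros)
    finally show "tensor_map id e (F (b \<otimes>\<^sub>C c)) = b \<otimes>\<^sub>C c" .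
  qed
  have E_M: "tensor_map id e ` ?M \<subseteq> ?N"
    by (rule tensor_sub_invariant[OF linE _ N_subspace])
      (simp add: E tensor_sub_pure e_mem[OF csubspace_R])
  have "F ` ?N \<subseteq> ?M"
    by (rule tensor_sub_invariant[OF linF _ csubspace_tensor_sub])
      (auto simp: F sw_def intro!: complex_vector.subspace_sum csubspace_tensor_sub tensor_sub_pure)
  then have cosetF: "induced_map F ?M (omega_class H \<phi> t) = F t +o ?M" for t
    unfolding omega_class_def
    by (intro induced_map_coset csubspace_tensor_sub complex_vector.subspace_0[OF N_subspace])
      (simp_all add: clinear_add[OF linF])
  have coset1: "induced_map (\<lambda>t. 1 \<otimes>\<^sub>C t) ?M (omega_class H \<phi> t) = (1 \<otimes>\<^sub>C t) +o ?M" for t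
    unfolding omega_class_def
    by (intro induced_map_coset csubspace_tensor_sub complex_vector.subspace_0[OF N_subspace])
      (auto simp: tensor_add_right tensor_sub_pure)
  have inv: "omega_class H \<phi> t \<in> left_inv (omega H \<phi>) \<longleftrightarrow> F t - 1 \<otimes>\<^sub>C t \<in> ?M"
    if "t \<in> tensor_sub K" for t
    using that cosetF coset1 coset_eq_iff[OF csubspace_tensor_sub[of ?N]]
    by (simp add: omega_def Let_def F_def[abs_def, symmetric] quotient_space_def omega_class_def)
  show ?thesis
  proof (intro equalityI subsetI)
    fix X assume X: "X \<in> left_inv (omega H \<phi>)"
    then have "X \<in> forms (omega H \<phi>)" by (simp add: omega_def Let_def)
    then obtain t where t: "t \<in> tensor_sub K" "X = omega_class H \<phi> t" by (auto simp: forms_omega)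
    have "F t - 1 \<otimes>\<^sub>C t \<in> ?M" using X inv t by simp
    then have "tensor_map id e (F t - 1 \<otimes>\<^sub>C t) \<in> ?N" using E_M by blast
    then have "t - 1 \<otimes>\<^sub>C e t \<in> ?N" by (simp add: clinear_diff[OF linE] E_F E)
    then have "X = omega_class H \<phi> (1 \<otimes>\<^sub>C e t)" by (simp add: t(2) omega_class_eq_iff)
    moreover have "\<epsilon> (e t) = 0" using e_mem[OF csubspace_K t(1)] by simp
    ultimately show "X \<in> {omega_class H \<phi> (1 \<otimes>\<^sub>C c) | c. \<epsilon> c = 0}" by blast
  next
    fix X assume "X \<in> {omega_class H \<phi> (1 \<otimes>\<^sub>C c) | c. \<epsilon> c = 0}"
    then obtain c where c: "\<epsilon> c = 0" "X = omega_class H \<phi> (1 \<otimes>\<^sub>C c)" by blast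
    have "F (1 \<otimes>\<^sub>C c) = 1 \<otimes>\<^sub>C (1 \<otimes>\<^sub>C c)"
      unfolding F by (rule sw_one) (intro sw_intros)
    then show "X \<in> left_inv (omega H \<phi>)"
      using c by (simp add: inv tensor_sub_pure complex_vector.subspace_0[OF csubspace_tensor_sub])
  qed
qed

text \<open>S maps ker \<epsilon> onto itself, so the hypothesis puts star (S c) into R; applying
  the involution r |-> star (S r) once more puts c itself into R.\<close>

lemma invariant_form_nondegenerate:
  assumes c: "\<epsilon> c = 0" and null: "\<And>c'. \<epsilon> c' = 0 \<Longrightarrow> \<phi> (star (\<S> c) * \<S> c') = 0"
  shows "omega_class H \<phi> (1 \<otimes>\<^sub>C c) = form_zero (omega H \<phi>)"
proof -
  have "\<phi> (star (\<S> c) * b) = 0" if "\<epsilon> b = 0" for b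
    using null[of "antipode_inv b"] that by (simp add: antipode_antipode_inv counit_antipode_inv)
  then have "star (\<S> c) \<in> R" using c by (simp add: R_ideal_def counit_star counit_antipode)
  from R_star_antipode[OF this] have "c \<in> R" by (simp add: antipode_star_antipode star_star)
  then show ?thesis by (simp add: form_zero_omega omega_class_eq_iff tensor_sub_pure)
qed

text \<open>The algebra is not zero, since h(1) = 1.\<close>

lemma scaleC_one_eq_0_iff: "k *\<^sub>C (1 :: 'a) = 0 \<longleftrightarrow> k = 0"
  using clinear_scale[OF clinear_haar, of k 1] by (auto simp: haar_one clinear_zero[OF clinear_haar])

lemma form_invariant:
  "\<epsilon> c = 0 \<Longrightarrow> \<epsilon> c' = 0 \<Longrightarrow> form (omega_class H \<phi> (1 \<otimes>\<^sub>C c)) (omega_class H \<phi> (1 \<otimes>\<^sub>C c'))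
    = (- (1 / 2) * \<phi> (star (\<S> c) * \<S> c')) *\<^sub>C 1"
  by (simp add: form_class tensor_sub_pure G_invariant)

lemma strongly_nondegenerate_form:
  "strongly_nondegenerate_right_sesquilinear_form (omega H \<phi>) form"
  unfolding strongly_nondegenerate_right_sesquilinear_form_def
proof (intro conjI ballI allI impI sesquilinear_form_form form_right_mult)
  fix \<omega> \<eta> assume "\<omega> \<in> left_inv (omega H \<phi>)" "\<eta> \<in> left_inv (omega H \<phi>)"
  then show "\<exists>c. form \<omega> \<eta> = c *\<^sub>C 1" unfolding left_inv_omega using form_invariant by blast
next
  fix \<omega> assume "\<omega> \<in> left_inv (omega H \<phi>)" and null: "\<forall>\<eta>\<in>left_inv (omega H \<phi>). form \<omega> \<eta> = 0"
  then obtain c where c: "\<epsilon> c = 0" "\<omega> = omega_class H \<phi> (1 \<otimes>\<^sub>C c)" unfolding left_inv_omega by blast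
  have "\<phi> (star (\<S> c) * \<S> c') = 0" if "\<epsilon> c' = 0" for c'
  proof -
    have "form \<omega> (omega_class H \<phi> (1 \<otimes>\<^sub>C c')) = 0" using null that unfolding left_inv_omega by blast
    then show ?thesis using c that by (simp add: form_invariant scaleC_one_eq_0_iff)
  qed
  then show "\<omega> = form_zero (omega H \<phi>)" unfolding c(2) by (rule invariant_form_nondegenerate[OF c(1)])
next
  fix \<eta> assume "\<eta> \<in> left_inv (omega H \<phi>)" and null: "\<forall>\<omega>\<in>left_inv (omega H \<phi>). form \<omega> \<eta> = 0"
  then obtain c where c: "\<epsilon> c = 0" "\<eta> = omega_class H \<phi> (1 \<otimes>\<^sub>C c)" unfolding left_inv_omega by blast
  have "\<phi> (star (\<S> c) * \<S> c') = 0" if "\<epsilon> c' = 0" for c'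
  proof -
    have "form (omega_class H \<phi> (1 \<otimes>\<^sub>C c')) \<eta> = 0" using null that unfolding left_inv_omega by blast
    then have "\<phi> (star (\<S> c') * \<S> c) = 0" using c that by (simp add: form_invariant scaleC_one_eq_0_iff)
    then show ?thesis using phi_star[of "star (\<S> c') * \<S> c"] by (simp add: star_mult star_star)
  qed
  then show "\<eta> = form_zero (omega H \<phi>)" unfolding c(2) by (rule invariant_form_nondegenerate[OF c(1)])
qed

section \<open>The Laplacian identity\<close>

lemma G_unit: "G (f \<otimes>\<^sub>C 1) (g \<otimes>\<^sub>C 1) = (- (1 / 2)) *\<^sub>C convolve H \<phi> (star f * g)"
  by (simp add: G_tensor kern_def twist_def antipode_one star_one convolve_sw[OF clinear_phi]
      sw_scaleC[symmetric] scaleC_scaleC)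

text \<open>Invariance of h leaves \<phi>(1) h(a), and \<phi>(1) = 0.\<close>

lemma haar_convolve: "h (convolve H \<phi> a) = 0"
proof -
  have "h (convolve H \<phi> a) = \<phi> (sw (\<lambda>x y. h x *\<^sub>C y) a)"
    by (simp add: convolve_sw[OF clinear_phi] sw_apply[OF clinear_haar, symmetric]
        sw_apply[OF clinear_phi, symmetric] clinear_scale[OF clinear_haar] clinear_scale[OF clinear_phi]
        mult.commute)
  then show ?thesis by (simp add: sw_haar_left clinear_scale[OF clinear_phi] phi_one)
qed

text \<open>With \<open>df = [\<Delta> f - f \<otimes> 1]\<close> and \<open>\<Delta> f = (1 \<otimes> 1) \<Delta> f\<close>, right sesquilinearity reduces
  \<open>\<langle>df, dg\<rangle>\<close> to \<open>\<phi> \<triangleright>\<close> of \<open>g\<close>, of \<open>f\<close> and of \<open>f\<^sup>*g\<close>; the last has Haar integral zero.\<close>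

lemma is_laplacian_form: "is_laplacian h (omega H \<phi>) form (convolve H \<phi>)"
  unfolding is_laplacian_def
proof (intro conjI allI clinear_convolve clinear_phi)
  fix f g
  have unit: "\<Delta> a = (1 \<otimes>\<^sub>C 1) * \<Delta> a" for a
    by (simp add: tensor_mult_comult comult_sw[symmetric])
  have one: "convolve H \<phi> 1 = 0"
    unfolding convolve_sw[OF clinear_phi] by (subst sw_one) (auto intro!: phi_intros simp: phi_one)
  \<comment> \<open>This equals star f G(1 \<otimes> 1, 1 \<otimes> 1) g, whose middle factor is a
    multiple of \<phi> \<triangleright> 1 = 0. As \<open>G\<close> lives on all of A \<otimes> A, it
    can be evaluated at \<Delta> f, which need not lie in A \<otimes> ker \<epsilon>.\<close>
  have 1: "G (\<Delta> f) (\<Delta> g) = 0"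
    by (subst unit[of f], subst unit[of g])
      (simp add: G_left_mult G_right_mult G_unit star_one one)
  have right: "G (\<Delta> a) (b \<otimes>\<^sub>C 1) = (- (1 / 2)) *\<^sub>C (star a * convolve H \<phi> b)" for a b
    by (subst unit[of a]) (simp add: G_left_mult G_unit star_one mult_scaleC_right)
  have left: "G (f \<otimes>\<^sub>C 1) (\<Delta> g) = (- (1 / 2)) *\<^sub>C (star (convolve H \<phi> f) * g)"
    unfolding star_G[of "\<Delta> g", symmetric] right
    by (simp add: star_minus star_scaleC star_mult star_star)
  have "form (differential (omega H \<phi>) f) (differential (omega H \<phi>) g)
    = G (\<Delta> f - f \<otimes>\<^sub>C 1) (\<Delta> g - g \<otimes>\<^sub>C 1)"
    by (simp add: differential_omega form_class differential_mem)
  also have "\<dots> = (1 / 2) *\<^sub>C (star f * convolve H \<phi> g) + (1 / 2) *\<^sub>C (star (convolve H \<phi> f) * g)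
      + (- (1 / 2)) *\<^sub>C convolve H \<phi> (star f * g)"
    by (simp add: G_diff_left clinear_diff[OF clinear_G] 1 right left G_unit)
  finally have "h (form (differential (omega H \<phi>) f) (differential (omega H \<phi>) g))
    = 1 / 2 * h (star f * convolve H \<phi> g) + 1 / 2 * h (star (convolve H \<phi> f) * g)"
    by (simp add: clinear_add[OF clinear_haar] clinear_scale[OF clinear_haar] haar_convolve
        clinear_diff[OF clinear_haar])
  \<comment> \<open>The two halves become equal, which absorbs the constant 1/2.\<close>
  also have "h (star (convolve H \<phi> f) * g) = h (star f * convolve H \<phi> g)"
    using haar_convolve_adjoint[OF clinear_phi, of f g] by (simp add: dual_star_phi)
  finally show "h (star f * convolve H \<phi> g) = h (form (differential (omega H \<phi>) f) (differential (omega H \<phi>) g))"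
    by simp
qed

end

theorem theorem5p2p4:
  fixes H :: "'a::complex_star_algebra hopf" and h :: "'a \<Rightarrow> complex"
    and Irr :: "'i set" and u :: "'i \<Rightarrow> 'a mat"
    and L :: "'a \<Rightarrow> 'a" and \<phi> :: "'a \<Rightarrow> complex"
  assumes "compact_quantum_group H"
    and "haar_state H h"
    and "irreducible_representatives H Irr u"
  shows
    "(clinear L \<and> diagonalizes_with_real_eigenvalues Irr u L \<and>
        (\<forall>a. L (antipode H a) = antipode H (L a)) \<and> L 1 = 0 \<and> \<phi> = counit H \<circ> L
      \<longleftrightarrow>
      clinear \<phi> \<and> self_adjoint_functional H \<phi> \<and> ad_invariant_functional H \<phi> \<and>
        hermitian_functional \<phi> \<and> \<phi> 1 = 0 \<and> L = convolve H \<phi>)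
     \<and>
     (clinear L \<and> diagonalizes_with_real_eigenvalues Irr u L \<and>
        (\<forall>a. L (antipode H a) = antipode H (L a)) \<and> L 1 = 0 \<and> \<phi> = counit H \<circ> L
      \<longrightarrow>
      (\<exists>B. given_on_germs H \<phi> B \<and>
         (\<forall>B'. given_on_germs H \<phi> B' \<longrightarrow>
            (\<forall>\<omega> \<in> forms (omega H \<phi>). \<forall>\<eta> \<in> forms (omega H \<phi>). B' \<omega> \<eta> = B \<omega> \<eta>)) \<and>
         strongly_nondegenerate_right_sesquilinear_form (omega H \<phi>) B \<and>
         is_laplacian h (omega H \<phi>) B (convolve H \<phi>)))"
    (is "(?D \<longleftrightarrow> ?F) \<and> (?D \<longrightarrow> ?B)")
proof -
  interpret peter_weyl H h Irr u
    using assms by unfold_locales (simp_all add: compact_quantum_group_def)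
  have F: ?F if ?D using that diagonal_functional[of L \<phi>] by blast
  have D: ?D if ?F
    using that convolution_diagonal[of \<phi>] clinear_convolve[of \<phi>] by metis
  have B: ?B if ?D
  proof -
    interpret laplacian_functional H h \<phi>
      by (intro laplacian_functional.intro haar_hopf_axioms laplacian_functional_axioms.intro)
        (simp_all add: F[OF that])
    have "B' \<omega> \<eta> = form \<omega> \<eta>"
      if "given_on_germs H \<phi> B'" "\<omega> \<in> forms (omega H \<phi>)" "\<eta> \<in> forms (omega H \<phi>)" for B' \<omega> \<eta>
      using given_on_germs_unique[OF that(1) given_on_germs_form] that(2,3) by (auto simp: forms_omega)
    then show ?thesis
      using given_on_germs_form strongly_nondegenerate_form is_laplacian_form by blast
  qed
  from F D B show ?thesis by blast
qed

end
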